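(* Let $k\geq 4$, let $\ell\geq 2$ be even, and $t=\lfloor \frac{k-1}{2}\rfloor+\lfloor \frac{\ell-1}{2}\rfloor$. Then for all sufficiently large $n$, $H(n,2,t+2)$ is the unique extremal graph for $C_{k,\ell}^{3}$ (the unique $n$-vertex $C_{k,\ell}^3$-free graph with the maximum number of edges).
   Context: All graphs are finite, simple and undirected. For a graph $H$ and integer $p\geq 2$, the edge blow-up $H^{p+1}$ is obtained from $H$ by replacing each edge by a clique of order $p+1$, where the new vertices of the different cliques are all distinct. The lollipop $C_{k,\ell}$ is obtained from a cycle $C_k$ by identifying one endpoint of a path $P_{\ell+1}$ (on $\ell+1$ vertices) with a vertex of the cycle. $T_p(n)$ is the $p$-partite Turán graph on $n$ vertices and $H(n,p,q)=K_{q-1}\vee T_p(n-q+1)$ ($\vee$ = join). *)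

theory Defs
  imports Main
begin

text \<open>
  A graph is a pair of a vertex set and a set of edges, each edge being a two-element set of
  vertices; \<open>simple_graph\<close> below is the well-formedness condition.
\<close>

type_synonym 'a graph = "'a set \<times> 'a set set"

abbreviation verts :: "'a graph \<Rightarrow> 'a set" where
  "verts G \<equiv> fst G"

abbreviation edges :: "'a graph \<Rightarrow> 'a set set" where
  "edges G \<equiv> snd G"

definition simple_graph :: "'a graph \<Rightarrow> bool" where
  "simple_graph G \<longleftrightarrow> finite (verts G) \<and> (\<forall>e\<in>edges G. e \<subseteq> verts G \<and> card e = 2)"

text \<open>Containment as a not necessarily induced subgraph.\<close>

definition contains_copy :: "'a graph \<Rightarrow> 'b graph \<Rightarrow> bool" where
  "contains_copy G F \<longleftrightarrow>
     (\<exists>f. inj_on f (verts F) \<and> f ` verts F \<subseteq> verts G \<and> (\<forall>e\<in>edges F. f ` e \<in> edges G))"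

definition graph_iso :: "'a graph \<Rightarrow> 'b graph \<Rightarrow> bool" where
  "graph_iso G H \<longleftrightarrow>
     (\<exists>f. bij_betw f (verts G) (verts H) \<and> edges H = (\<lambda>e. f ` e) ` edges G)"

definition complete_graph :: "nat \<Rightarrow> nat graph" where
  "complete_graph n = ({..<n}, {e. e \<subseteq> {..<n} \<and> card e = 2})"

text \<open>\<open>path_graph m\<close> has \<open>m\<close> vertices; \<open>cycle_graph k\<close> is meant for \<open>k \<ge> 3\<close>.\<close>

definition path_graph :: "nat \<Rightarrow> nat graph" where
  "path_graph m = ({..<m}, {{i, i + 1} | i. i + 1 < m})"

definition cycle_graph :: "nat \<Rightarrow> nat graph" where
  "cycle_graph k = ({..<k}, {{i, (i + 1) mod k} | i. i < k})"

text \<open>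
  The path on \<open>l + 1\<close> vertices is relabelled by \<open>i \<mapsto> i + (k - 1)\<close>. Its endpoint \<open>0\<close> thereby becomes
  the vertex \<open>k - 1\<close> of the cycle, and its other vertices lie outside the cycle.
\<close>

definition lollipop :: "nat \<Rightarrow> nat \<Rightarrow> nat graph" where
  "lollipop k l =
     (let \<phi> = (\<lambda>i. i + (k - 1)) in
       (verts (cycle_graph k) \<union> \<phi> ` verts (path_graph (l + 1)),
        edges (cycle_graph k) \<union> (\<lambda>e. \<phi> ` e) ` edges (path_graph (l + 1))))"

text \<open>
  \<open>edge_blow_up H r\<close> is the graph written $H^r$: each edge \<open>e\<close> becomes a clique on \<open>r\<close> vertices,
  namely the two ends of \<open>e\<close> and the \<open>r - 2\<close> new vertices \<open>Inr (e, i)\<close>.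
\<close>

definition blow_up_clique :: "nat \<Rightarrow> 'a set \<Rightarrow> ('a + 'a set \<times> nat) set" where
  "blow_up_clique r e = Inl ` e \<union> Inr ` ({e} \<times> {..<r - 2})"

definition edge_blow_up :: "'a graph \<Rightarrow> nat \<Rightarrow> ('a + 'a set \<times> nat) graph" where
  "edge_blow_up H r =
     (Inl ` verts H \<union> (\<Union>e\<in>edges H. blow_up_clique r e),
      {d. card d = 2 \<and> (\<exists>e\<in>edges H. d \<subseteq> blow_up_clique r e)})"

text \<open>
  The parts of \<open>turan_graph p n\<close> are the residue classes modulo \<open>p\<close> in \<open>{..<n}\<close>, so their sizes
  differ by at most one.
\<close>

definition turan_graph :: "nat \<Rightarrow> nat \<Rightarrow> nat graph" where
  "turan_graph p n = ({..<n}, {{i, j} | i j. i < n \<and> j < n \<and> i mod p \<noteq> j mod p})"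

definition graph_join :: "'a graph \<Rightarrow> 'b graph \<Rightarrow> ('a + 'b) graph" where
  "graph_join G H =
     (verts G <+> verts H,
      (\<lambda>e. Inl ` e) ` edges G \<union> (\<lambda>e. Inr ` e) ` edges H
        \<union> {{Inl u, Inr v} | u v. u \<in> verts G \<and> v \<in> verts H})"

text \<open>Intended for \<open>1 \<le> q \<le> n + 1\<close>, where \<open>n + 1 - q\<close> is not truncated.\<close>

definition H_graph :: "nat \<Rightarrow> nat \<Rightarrow> nat \<Rightarrow> (nat + nat) graph" where
  "H_graph n p q = graph_join (complete_graph (q - 1)) (turan_graph p (n + 1 - q))"

definition free_graph_on :: "nat \<Rightarrow> 'b graph \<Rightarrow> 'a graph \<Rightarrow> bool" where
  "free_graph_on n F G \<longleftrightarrow> simple_graph G \<and> card (verts G) = n \<and> \<not> contains_copy G F"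

text \<open>
  Competitors and uniqueness range over graphs with natural numbers as vertices; every finite
  graph is isomorphic to one of these.
\<close>

definition extremal_graph :: "nat \<Rightarrow> 'b graph \<Rightarrow> 'a graph \<Rightarrow> bool" where
  "extremal_graph n F G \<longleftrightarrow>
     free_graph_on n F G \<and>
     (\<forall>G' :: nat graph. free_graph_on n F G' \<longrightarrow> card (edges G') \<le> card (edges G))"

definition unique_extremal_graph :: "nat \<Rightarrow> 'b graph \<Rightarrow> 'a graph \<Rightarrow> bool" where
  "unique_extremal_graph n F G \<longleftrightarrow>
     extremal_graph n F G \<and>
     (\<forall>G' :: nat graph. extremal_graph n F G' \<longrightarrow> graph_iso G' G)"

end

theory Submission
  imports Defs
begin

text \<open>
  Put \<open>s = t + 1\<close>. Every triangle of the extremal graph meets the \<open>s\<close> dominating vertices, while at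
  least \<open>s + 1\<close> vertices are needed to meet all triangles of the blown-up lollipop.

  For the upper bound, let \<open>G\<close> be free of the blown-up lollipop with at least as many edges as the
  extremal graph. Whenever deleting a balanced complete bipartite subgraph of bounded size loses fewer
  edges than it would in the extremal graph, delete it; the excess grows with each deletion and cannot
  grow forever, so \<open>G\<close> may be assumed to be good, that is, to admit no such deletion. By the
  Kovari-Sos-Turan argument \<open>G\<close> contains a large complete bipartite graph between sets \<open>A\<close> and \<open>B\<close>.
  While fewer than \<open>s\<close> vertices joined to everything in \<open>A \<union> B\<close> have been found, either a further one
  exists after shrinking \<open>A\<close> and \<open>B\<close>, or counting the edges touched by \<open>A \<union> B\<close> yields matchings or
  cherries inside the two sides, and with them a copy of the blown-up lollipop. Once a set \<open>D\<close> of \<open>s\<close>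
  such vertices is there, a triangle outside \<open>D\<close> through a vertex \<open>u \<in> A \<union> B\<close> can serve as the last
  triangle of the tail, so \<open>N(u) - D\<close> is independent. For \<open>a \<in> A\<close> and \<open>b \<in> B\<close> goodness gives
  \<open>deg a + deg b \<ge> n + s\<close>, hence \<open>N(a) - D\<close> and \<open>N(b) - D\<close> partition the rest of \<open>G\<close> into two
  independent sets.
\<close>

section \<open>Copies of the blown-up lollipop\<close>

text \<open>Why \<open>s\<close> is the threshold: as \<open>l\<close> is even, \<open>s\<close>
  suitable vertices meet every triangle of the blow-up except the last one of the tail, and that one
  hangs on the rest by a single vertex. Why goodness is tested on balanced complete pairs of all
  sizes up to \<open>M\<close>: deleting \<open>m\<close> vertices from each part of the extremal
  graph costs exactly m(n + s - m) edges, without rounding. Size 1 gives a degree bound along edges;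
  large sizes give an average over a block from which a bounded number of exceptional vertices has
  been discarded. The main obstacle is odd \<open>k\<close> while no dominating vertex is known. The
  odd cycle does not fit into the bipartite pair, so one of its edges has to run inside a side, and
  then the triangle on the chord needs a common neighbour that no cherry supplies. The degree bound
  yields it, because two adjacent vertices have at least \<open>s \<ge> 3\<close> common
  neighbours.\<close>

text \<open>
  With \<open>K = k + l\<close> the lollipop is the path on \<open>0, \<dots>, K - 1\<close> together with the chord
  \<open>{k - 1, 0}\<close>, which is the edge number \<open>K - 1\<close>; edge number \<open>i < K - 1\<close> is \<open>{i, i + 1}\<close>.
  In \<open>embeds\<close>, \<open>v\<close> gives the images of the lollipop vertices and \<open>w i\<close> that of the new vertex on
  edge number \<open>i\<close>.
\<close>

definition edge_fst :: "nat \<Rightarrow> nat \<Rightarrow> nat \<Rightarrow> nat" where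
  "edge_fst k K i = (if i = K - 1 then k - 1 else i)"

definition edge_snd :: "nat \<Rightarrow> nat \<Rightarrow> nat" where
  "edge_snd K i = (if i = K - 1 then 0 else i + 1)"

definition embeds :: "nat \<Rightarrow> nat \<Rightarrow> 'a set set \<Rightarrow> (nat \<Rightarrow> 'a) \<Rightarrow> (nat \<Rightarrow> 'a) \<Rightarrow> bool" where
  "embeds k K E v w \<longleftrightarrow>
     inj_on v {..<K} \<and> inj_on w {..<K} \<and> v ` {..<K} \<inter> w ` {..<K} = {} \<and>
     (\<forall>i<K. {v (edge_fst k K i), v (edge_snd K i)} \<in> E \<and>
            {v (edge_fst k K i), w i} \<in> E \<and> {v (edge_snd K i), w i} \<in> E)"

lemma verts_lollipop:
  assumes "k \<ge> 4" "l \<ge> 2"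
  shows "verts (lollipop k l) = {..<k + l}"
proof -
  have "{..<k} \<union> (\<lambda>i. i + (k - 1)) ` {..<l + 1} = {..<k + l}" (is "?L = ?R")
  proof
    show "?L \<subseteq> ?R" using assms by auto
    show "?R \<subseteq> ?L"
    proof
      fix x assume "x \<in> ?R"
      show "x \<in> ?L"
      proof (cases "x < k")
        case False
        then have "x = (x - (k - 1)) + (k - 1)" "x - (k - 1) \<in> {..<l + 1}"
          using \<open>x \<in> ?R\<close> assms by auto
        then show ?thesis by blast
      qed auto
    qed
  qed
  then show ?thesis by (simp add: lollipop_def cycle_graph_def path_graph_def Let_def)
qed

lemma edges_lollipop:
  assumes "k \<ge> 4" "l \<ge> 2"
  shows "edges (lollipop k l) =
    (\<lambda>i. {edge_fst k (k + l) i, edge_snd (k + l) i}) ` {..<k + l}"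
proof -
  let ?e = "\<lambda>i. {edge_fst k (k + l) i, edge_snd (k + l) i}"
  have e: "edges (lollipop k l) = {{i, (i + 1) mod k} | i. i < k} \<union>
      (\<lambda>e. (\<lambda>i. i + (k - 1)) ` e) ` {{i, i + 1} | i. i + 1 < l + 1}"
    by (simp add: lollipop_def cycle_graph_def path_graph_def Let_def)
  have "{{i, (i + 1) mod k} | i. i < k} \<subseteq> ?e ` {..<k + l}"
  proof clarify
    fix i assume i: "i < k"
    show "{i, (i + 1) mod k} \<in> ?e ` {..<k + l}"
    proof (cases "i = k - 1")
      case True
      then have "{i, (i + 1) mod k} = ?e (k + l - 1)"
        using assms by (simp add: edge_fst_def edge_snd_def)
      then show ?thesis using assms by (intro image_eqI[of _ _ "k + l - 1"]) auto
    next
      case False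
      then have "{i, (i + 1) mod k} = ?e i"
        using assms i by (simp add: edge_fst_def edge_snd_def)
      then show ?thesis using assms i by (intro image_eqI[of _ _ i]) auto
    qed
  qed
  moreover have "(\<lambda>e. (\<lambda>i. i + (k - 1)) ` e) ` {{i, i + 1} | i. i + 1 < l + 1} \<subseteq> ?e ` {..<k + l}"
  proof clarify
    fix i assume i: "i + 1 < l + 1"
    have "(\<lambda>i. i + (k - 1)) ` {i, i + 1} = ?e (i + (k - 1))"
      using assms i by (auto simp: edge_fst_def edge_snd_def)
    then show "(\<lambda>i. i + (k - 1)) ` {i, i + 1} \<in> ?e ` {..<k + l}"
      using assms i by (intro image_eqI[of _ _ "i + (k - 1)"]) auto
  qed
  moreover have "?e i \<in> edges (lollipop k l)" if i: "i < k + l" for i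
  proof -
    consider "i = k + l - 1" | "i < k - 1" | "k - 1 \<le> i" "i < k + l - 1" using i by linarith
    then show ?thesis
    proof cases
      case 1
      have "?e i = {k - 1, (k - 1 + 1) mod k}"
        using 1 assms by (simp add: edge_fst_def edge_snd_def)
      moreover have "k - 1 < k" using assms by simp
      ultimately show ?thesis unfolding e by blast
    next
      case 2
      have "?e i = {i, (i + 1) mod k}"
        using 2 assms by (simp add: edge_fst_def edge_snd_def)
      moreover have "i < k" using 2 by simp
      ultimately show ?thesis unfolding e by blast
    next
      case 3
      define j where "j = i - (k - 1)"
      have j: "j + 1 < l + 1" "i = j + (k - 1)" using 3 assms by (auto simp: j_def)
      have "?e i = (\<lambda>i. i + (k - 1)) ` {j, j + 1}"
        using 3 j assms by (auto simp: edge_fst_def edge_snd_def)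
      then show ?thesis unfolding e using j by blast
    qed
  qed
  ultimately show ?thesis
    by (intro equalityI image_subsetI) (simp_all only: e Un_least lessThan_iff)
qed

text \<open>The new vertices of the blow-up are indexed by edges as sets; this is what allows them
  to be numbered by \<open>i\<close>.\<close>

lemma inj_on_lollipop_edge:
  assumes "k \<ge> 4" "l \<ge> 2"
  shows "inj_on (\<lambda>i. {edge_fst k (k + l) i, edge_snd (k + l) i}) {..<k + l}"
proof (rule linorder_inj_onI')
  fix i j assume ij: "i \<in> {..<k + l}" "j \<in> {..<k + l}" "i < j"
  then have i: "edge_fst k (k + l) i = i" "edge_snd (k + l) i = i + 1"
    by (simp_all add: edge_fst_def edge_snd_def)
  show "{edge_fst k (k + l) i, edge_snd (k + l) i} \<noteq>
         {edge_fst k (k + l) j, edge_snd (k + l) j}"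
  proof (cases "j = k + l - 1")
    case True
    then have "edge_fst k (k + l) j = k - 1" "edge_snd (k + l) j = 0"
      by (simp_all add: edge_fst_def edge_snd_def)
    then show ?thesis unfolding i doubleton_eq_iff using assms(1) by arith
  next
    case False
    then have "edge_fst k (k + l) j = j" "edge_snd (k + l) j = j + 1"
      by (simp_all add: edge_fst_def edge_snd_def)
    then show ?thesis unfolding i doubleton_eq_iff using ij(3) by arith
  qed
qed

lemma card_2_subset_triangle:
  assumes "d \<subseteq> {x, y, z}" "card d = 2"
  shows "d = {x, y} \<or> d = {x, z} \<or> d = {y, z}"
proof -
  obtain p q where "d = {p, q}" "p \<noteq> q" using assms(2) by (meson card_2_iff)
  then show ?thesis using assms(1) by auto
qed

lemma blow_up_clique_3: "blow_up_clique 3 {a, b} = {Inl a, Inl b, Inr ({a, b}, 0)}"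
  by (auto simp: blow_up_clique_def)

lemma contains_copy_blow_up_iff:
  fixes G :: "'a graph"
  assumes "k \<ge> 4" "l \<ge> 2" and G: "simple_graph G"
  shows "contains_copy G (edge_blow_up (lollipop k l) 3) \<longleftrightarrow> (\<exists>v w. embeds k (k + l) (edges G) v w)"
proof
  let ?K = "k + l" and ?F = "edge_blow_up (lollipop k l) 3"
  let ?p = "edge_fst k ?K" and ?q = "edge_snd ?K"
  let ?e = "\<lambda>i. {?p i, ?q i}"
  have pq: "?p i < ?K" "?q i < ?K" "?p i \<noteq> ?q i" if "i < ?K" for i
    using that assms by (auto simp: edge_fst_def edge_snd_def)
  have FV: "verts ?F = Inl ` {..<?K} \<union> (\<Union>i<?K. {Inl (?p i), Inl (?q i), Inr (?e i, 0)})"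
    by (simp add: edge_blow_up_def verts_lollipop edges_lollipop assms blow_up_clique_3)
  have FE: "edges ?F = {d. card d = 2 \<and> (\<exists>i<?K. d \<subseteq> {Inl (?p i), Inl (?q i), Inr (?e i, 0)})}"
    by (auto simp add: edge_blow_up_def edges_lollipop assms blow_up_clique_3)
  {
    assume "contains_copy G ?F"
    then obtain f where f: "inj_on f (verts ?F)" "\<And>d. d \<in> edges ?F \<Longrightarrow> f ` d \<in> edges G"
      unfolding contains_copy_def by blast
    define v w where "v i = f (Inl i)" and "w i = f (Inr (?e i, 0))" for i
    have inV: "Inl i \<in> verts ?F" "Inr (?e i, 0) \<in> verts ?F" if "i < ?K" for i
      unfolding FV using that by auto
    have "inj_on v {..<?K}"
      using f(1) inV unfolding v_def inj_on_def by blast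
    moreover have "inj_on w {..<?K}"
    proof (rule inj_onI)
      fix i j assume ij: "i \<in> {..<?K}" "j \<in> {..<?K}" "w i = w j"
      then have "(Inr (?e i, 0) :: nat + nat set \<times> nat) = Inr (?e j, 0)"
        using f(1) inV(2) unfolding w_def inj_on_def by (meson lessThan_iff)
      then show "i = j" using inj_on_lollipop_edge[OF assms(1,2)] ij(1,2)
        unfolding inj_on_def by blast
    qed
    moreover have "v ` {..<?K} \<inter> w ` {..<?K} = {}"
    proof -
      have "v i \<noteq> w j" if "i < ?K" "j < ?K" for i j
        using f(1) inV(1)[OF that(1)] inV(2)[OF that(2)] unfolding v_def w_def inj_on_def by blast
      then show ?thesis by blast
    qed
    moreover have "{v (?p i), v (?q i)} \<in> edges G \<and> {v (?p i), w i} \<in> edges G \<and> {v (?q i), w i} \<in> edges G"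
      if i: "i < ?K" for i
    proof -
      have "{Inl (?p i), Inl (?q i)} \<in> edges ?F" "{Inl (?p i), Inr (?e i, 0)} \<in> edges ?F"
        "{Inl (?q i), Inr (?e i, 0)} \<in> edges ?F"
        unfolding FE using i pq[OF i] by auto
      from this[THEN f(2)] show ?thesis by (simp add: v_def w_def)
    qed
    ultimately show "\<exists>v w. embeds k ?K (edges G) v w" unfolding embeds_def by blast
  }
  {
    assume "\<exists>v w. embeds k ?K (edges G) v w"
    then obtain v w where inj: "inj_on v {..<?K}" "inj_on w {..<?K}" "v ` {..<?K} \<inter> w ` {..<?K} = {}"
      and tri: "\<And>i. i < ?K \<Longrightarrow> {v (?p i), v (?q i)} \<in> edges G \<and> {v (?p i), w i} \<in> edges G \<and> {v (?q i), w i} \<in> edges G"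
      unfolding embeds_def by blast
    define ix where "ix = inv_into {..<?K} ?e"
    have ix: "ix (?e i) = i" if "i < ?K" for i
      unfolding ix_def using inv_into_f_f[OF inj_on_lollipop_edge[OF assms(1,2)]] that by simp
    define f where "f = case_sum v (\<lambda>(e, j::nat). w (ix e))"
    have f: "f (Inl i) = v i" for i by (simp add: f_def)
    have f': "f (Inr (?e i, 0)) = w i" if "i < ?K" for i using ix[OF that] by (simp add: f_def)
    have FV': "verts ?F = Inl ` {..<?K} \<union> (\<lambda>i. Inr (?e i, 0)) ` {..<?K}"
      unfolding FV using pq by auto
    have "inj_on f (verts ?F)"
    proof -
      have 1: "inj_on f (Inl ` {..<?K})"
        using inj(1) by (auto simp: inj_on_def f)
      have 2: "inj_on f ((\<lambda>i. Inr (?e i, 0)) ` {..<?K})"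
      proof (rule inj_onI)
        fix x y assume "x \<in> (\<lambda>i. Inr (?e i, 0)) ` {..<?K}" "y \<in> (\<lambda>i. Inr (?e i, 0)) ` {..<?K}" "f x = f y"
        then obtain i j where ij: "i < ?K" "j < ?K" "x = Inr (?e i, 0)" "y = Inr (?e j, 0)" by blast
        then have "w i = w j" using \<open>f x = f y\<close> f' by simp
        then have "i = j" using inj(2) ij by (simp add: inj_on_def)
        then show "x = y" using ij by simp
      qed
      have im: "f ` Inl ` {..<?K} = v ` {..<?K}" "f ` (\<lambda>i. Inr (?e i, 0)) ` {..<?K} = w ` {..<?K}"
        by (simp_all add: image_image f f' cong: image_cong_simp)
      have "f ` (Inl ` {..<?K}) \<inter> f ` ((\<lambda>i. Inr (?e i, 0)) ` {..<?K}) = {}"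
        unfolding im by (rule inj(3))
      then show ?thesis unfolding FV' inj_on_Un using 1 2 by blast
    qed
    moreover have "f ` verts ?F \<subseteq> verts G"
    proof -
      have "v i \<in> verts G \<and> w i \<in> verts G" if i: "i < ?K" for i
      proof -
        have E: "e \<subseteq> verts G" if "e \<in> edges G" for e using G that by (auto simp: simple_graph_def)
        have w: "w i \<in> verts G" using E tri[OF i] by blast
        \<comment> \<open>\<open>embeds\<close> speaks only about edges, so each position needs an
          edge at it: position \<open>i\<close> starts edge \<open>i\<close>, except for the last
          position, which ends the last edge of the tail.\<close>
        have "i = ?p i \<or> i = ?q (i - 1) \<and> i - 1 < ?K"
          using i assms by (auto simp: edge_fst_def edge_snd_def)
        then have "v i \<in> verts G"
        proof
          assume "i = ?p i" then show ?thesis using E tri[OF i] by (metis insert_subset)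
        next
          assume "i = ?q (i - 1) \<and> i - 1 < ?K" then show ?thesis using E tri[of "i - 1"]
            by (metis insert_subset)
        qed
        then show ?thesis using w by simp
      qed
      then show ?thesis unfolding FV' using f f' by (intro subsetI) (elim imageE UnE, simp_all)
    qed
    moreover have "f ` d \<in> edges G" if "d \<in> edges ?F" for d
    proof -
      obtain i where i: "i < ?K" "d \<subseteq> {Inl (?p i), Inl (?q i), Inr (?e i, 0)}" "card d = 2"
        using \<open>d \<in> edges ?F\<close> unfolding FE by blast
      from card_2_subset_triangle[OF i(2,3)] tri[OF i(1)] show ?thesis
        by (elim disjE) (simp_all add: f f'[OF i(1)])
    qed
    ultimately show "contains_copy G ?F" unfolding contains_copy_def by blast
  }
qed

section \<open>Embeddings into labelled host graphs\<close>

datatype label = LA nat | LB nat | LD nat | LX nat | LX2 nat | LY nat | LS nat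

fun ladj :: "label \<Rightarrow> label \<Rightarrow> bool" where
  "ladj (LA i) (LB j) = True"
| "ladj (LD i) (LA j) = True"
| "ladj (LD i) (LB j) = True"
| "ladj (LX i) (LA j) = (i = j)"
| "ladj (LX2 i) (LA j) = (i = j)"
| "ladj (LX i) (LB j) = True"
| "ladj (LX2 i) (LB j) = True"
| "ladj (LY i) (LB j) = (i = j)"
| "ladj (LY i) (LA j) = True"
| "ladj (LS i) (LA j) = (i = 0)"
| "ladj (LS i) (LD j) = (i = 0)"
| "ladj (LS i) (LS j) = (i < j \<and> j \<le> 2)"
| "ladj (LS i) (LX j) = (i = 3 \<and> j = 0)"
| "ladj (LS i) (LB j) = (i = 3 \<and> j = 0)"
| "ladj _ _ = False"

definition hosts :: "'a set set \<Rightarrow> (label \<Rightarrow> 'a) \<Rightarrow> label set \<Rightarrow> bool" where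
  "hosts E g L \<longleftrightarrow> inj_on g L \<and> (\<forall>p\<in>L. \<forall>q\<in>L. ladj p q \<longrightarrow> {g p, g q} \<in> E)"

definition labels :: "nat \<Rightarrow> nat \<Rightarrow> bool \<Rightarrow> bool \<Rightarrow> bool \<Rightarrow> nat set \<Rightarrow> label set" where
  "labels q d x x2 y S = {p. case p of LA i \<Rightarrow> i < q | LB i \<Rightarrow> i < q | LD i \<Rightarrow> i < d
     | LX i \<Rightarrow> x \<and> i < q | LX2 i \<Rightarrow> x2 \<and> i < q | LY i \<Rightarrow> y \<and> i < q | LS i \<Rightarrow> i \<in> S}"

lemma in_labels [simp]:
  "LA i \<in> labels q d x x2 y S \<longleftrightarrow> i < q"
  "LB i \<in> labels q d x x2 y S \<longleftrightarrow> i < q"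
  "LD i \<in> labels q d x x2 y S \<longleftrightarrow> i < d"
  "LX i \<in> labels q d x x2 y S \<longleftrightarrow> x \<and> i < q"
  "LX2 i \<in> labels q d x x2 y S \<longleftrightarrow> x2 \<and> i < q"
  "LY i \<in> labels q d x x2 y S \<longleftrightarrow> y \<and> i < q"
  "LS i \<in> labels q d x x2 y S \<longleftrightarrow> i \<in> S"
  by (simp_all add: labels_def)

abbreviation sladj :: "label \<Rightarrow> label \<Rightarrow> bool" where
  "sladj p q \<equiv> ladj p q \<or> ladj q p"

lemma embeds_of_labels:
  assumes g: "hosts E g L"
    and L: "\<And>i. i < K \<Longrightarrow> lv i \<in> L \<and> lw i \<in> L"
    and c: "\<And>i. i < K \<Longrightarrow> c (lv i) = i \<and> c (lw i) = K + i"
    and path: "\<And>i. i < K - 1 \<Longrightarrow>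
       sladj (lv i) (lv (Suc i)) \<and> sladj (lv i) (lw i) \<and> sladj (lv (Suc i)) (lw i)"
    and chord: "sladj (lv (k - 1)) (lv 0) \<and> sladj (lv (k - 1)) (lw (K - 1)) \<and> sladj (lv 0) (lw (K - 1))"
    and k: "0 < k" "k \<le> K"
  shows "embeds k K E (g \<circ> lv) (g \<circ> lw)"
proof -
  have inj: "inj_on g L" using g by (simp add: hosts_def)
  have E: "{g p, g q} \<in> E" if "p \<in> L" "q \<in> L" "sladj p q" for p q
    using that g unfolding hosts_def by (metis insert_commute)
  have "inj_on (g \<circ> lv) {..<K}"
  proof (rule inj_onI)
    fix i j assume ij: "i \<in> {..<K}" "j \<in> {..<K}" "(g \<circ> lv) i = (g \<circ> lv) j"
    then have "lv i = lv j" using inj L by (auto dest: inj_onD)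
    then have "c (lv i) = c (lv j)" by simp
    then show "i = j" using c ij by simp
  qed
  moreover have "inj_on (g \<circ> lw) {..<K}"
  proof (rule inj_onI)
    fix i j assume ij: "i \<in> {..<K}" "j \<in> {..<K}" "(g \<circ> lw) i = (g \<circ> lw) j"
    then have "lw i = lw j" using inj L by (auto dest: inj_onD)
    then have "c (lw i) = c (lw j)" by simp
    then show "i = j" using c ij by simp
  qed
  moreover have "(g \<circ> lv) i \<noteq> (g \<circ> lw) j" if "i < K" "j < K" for i j
  proof
    assume "(g \<circ> lv) i = (g \<circ> lw) j"
    then have "lv i = lw j" using inj L that by (auto dest: inj_onD)
    then have "c (lv i) = c (lw j)" by simp
    then show False using c that by simp
  qed
  then have "(g \<circ> lv) ` {..<K} \<inter> (g \<circ> lw) ` {..<K} = {}" by blast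
  moreover have "{(g \<circ> lv) (edge_fst k K i), (g \<circ> lv) (edge_snd K i)} \<in> E \<and>
            {(g \<circ> lv) (edge_fst k K i), (g \<circ> lw) i} \<in> E \<and>
            {(g \<circ> lv) (edge_snd K i), (g \<circ> lw) i} \<in> E" if i: "i < K" for i
  proof (cases "i = K - 1")
    case True
    have "lv (k - 1) \<in> L" "lv 0 \<in> L" "lw (K - 1) \<in> L" using L k by auto
    then show ?thesis using chord E True
      by (simp add: edge_fst_def edge_snd_def)
  next
    case False
    then have "i < K - 1" "Suc i < K" using i by auto
    moreover from this have "lv i \<in> L" "lv (Suc i) \<in> L" "lw i \<in> L" using L i by auto
    ultimately show ?thesis using path[of i] E False
      by (simp add: edge_fst_def edge_snd_def)
  qed
  ultimately show ?thesis unfolding embeds_def by blast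
qed

text \<open>
  \<open>LD\<close> stands for vertices joined to all \<open>LA j\<close> and \<open>LB j\<close>, \<open>LX i\<close> and \<open>LX2 i\<close> for neighbours of
  \<open>LA i\<close> that are joined to all \<open>LB j\<close>, and \<open>LY i\<close> for a neighbour of \<open>LB i\<close> that is joined to all
  \<open>LA j\<close>. The labels \<open>LS 0, LS 1, LS 2\<close> form a triangle of which only \<open>LS 0\<close> is attached to the rest:
  it hosts the last triangle of the tail. \<open>LS 3\<close> is a common neighbour of the single pair
  \<open>LX 0, LB 0\<close>. The function \<open>c\<close> recovers the position in the blow-up from the label and so witnesses
  injectivity.
\<close>

lemma embeds_full_even:
  assumes "hosts E g (labels (2 * (2 * s + 2)) s False False False {0, 1, 2})"
    and "even k" "4 \<le> k" "k \<le> 2 * s" "2 \<le> s"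
  shows "\<exists>v w. embeds k (2 * s + 2) E v w"
proof -
  \<comment> \<open>The \<open>s\<close> dominating labels take the odd positions 1, 3, ..., 2s - 1.
    As \<open>k - 1\<close> is odd, they also meet the chord, and only edge \<open>2 * s\<close> is
    left for the triangle \<open>LS 0, LS 1, LS 2\<close>.\<close>
  let ?v = "\<lambda>i. if i = 2 * s + 1 then LS 1 else if i = 2 * s then LS 0
     else if odd i then LD (i div 2) else LB i"
  let ?w = "\<lambda>i. if i = 2 * s then LS 2 else LA (2 * s + 2 + i)"
  let ?c = "\<lambda>p. case p of LS i \<Rightarrow> (if i = 1 then 2 * s + 1 else if i = 0 then 2 * s else 4 * s + 2)
     | LD j \<Rightarrow> 2 * j + 1 | LA i \<Rightarrow> i | LB i \<Rightarrow> i"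
  have "embeds k (2 * s + 2) E (g \<circ> ?v) (g \<circ> ?w)"
    by (rule embeds_of_labels[OF assms(1), where c = ?c]) (use assms in \<open>(auto elim!: oddE evenE; presburger)+\<close>)
  then show ?thesis by blast
qed

text \<open>Both ends \<open>k - 1\<close> and 0 of the chord are even, and they cannot both carry
  \<open>LD\<close>. So \<open>LD 0\<close> becomes the new vertex of edge 0, the other
  \<open>s - 1\<close> dominating labels take positions 2, 4, ..., 2s - 2, and edge
  \<open>2 * s - 1\<close> is left for the separate triangle.\<close>

lemma embeds_full_odd:
  assumes "hosts E g (labels (2 * (2 * s + 1)) s False False False {0, 1, 2})"
    and "odd k" "4 \<le> k" "k < 2 * s" "2 \<le> s"
  shows "\<exists>v w. embeds k (2 * s + 1) E v w"
proof -
  let ?v = "\<lambda>i. if i = 0 then LA 0 else if i = 2 * s then LS 1 else if i + 1 = 2 * s then LS 0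
     else if even i then LD (i div 2) else LB i"
  let ?w = "\<lambda>i. if i = 0 then LD 0 else if i + 1 = 2 * s then LS 2
     else if i = 2 * s then LB (2 * s + 1 + i) else LA (2 * s + 1 + i)"
  let ?c = "\<lambda>p. case p of LS i \<Rightarrow> (if i = 1 then 2 * s else if i = 0 then 2 * s - 1 else 4 * s)
     | LD j \<Rightarrow> (if j = 0 then 2 * s + 1 else 2 * j) | LA i \<Rightarrow> i | LB i \<Rightarrow> i"
  have "embeds k (2 * s + 1) E (g \<circ> ?v) (g \<circ> ?w)"
    by (rule embeds_of_labels[OF assms(1), where c = ?c]) (use assms in \<open>(auto elim!: oddE evenE; presburger)+\<close>)
  then show ?thesis by blast
qed

text \<open>With \<open>s - 1\<close> dominating labels at 3, 5, ..., 2s - 1 only the triangles on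
  edges 0, 1 and \<open>2 * s\<close> miss them. Each is closed by the matching partner of its
  \<open>LA\<close> end, at positions 0, 2 and \<open>2 * s + 1\<close>.\<close>

lemma embeds_matching_even:
  assumes "hosts E g (labels (2 * (2 * s + 2)) (s - 1) True x2 y S)"
    and "even k" "4 \<le> k" "k \<le> 2 * s" "2 \<le> s"
  shows "\<exists>v w. embeds k (2 * s + 2) E v w"
proof -
  let ?v = "\<lambda>i. if i = 1 \<or> i = 2 * s then LB i else if i = 2 * s + 1 \<or> even i then LA i
     else LD (i div 2 - 1)"
  let ?w = "\<lambda>i. if i = 2 * s then LX (i + 1) else if i + 1 = 2 * s then LA (2 * s + 2 + i)
     else if i = 0 then LX 0 else if i = 1 then LX 2 else LB (2 * s + 2 + i)"
  let ?c = "\<lambda>p. case p of LD j \<Rightarrow> 2 * j + 3 | LA i \<Rightarrow> i | LB i \<Rightarrow> i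
     | LX i \<Rightarrow> (if i = 0 then 2 * s + 2 else if i = 2 then 2 * s + 3 else 4 * s + 2)"
  have "embeds k (2 * s + 2) E (g \<circ> ?v) (g \<circ> ?w)"
    by (rule embeds_of_labels[OF assms(1), where c = ?c]) (use assms in \<open>(auto elim!: oddE evenE; presburger)+\<close>)
  then show ?thesis by blast
qed

text \<open>Dominating labels at 2, 4, ..., 2s - 2 miss only the triangles on edges 0 and
  \<open>2 * s - 1\<close>, and the matching edges at \<open>LA 0\<close> and
  \<open>LA (2 * s)\<close> close these.\<close>

lemma embeds_matching_odd:
  assumes "hosts E g (labels (2 * (2 * s + 1)) (s - 1) True x2 y S)"
    and "odd k" "4 \<le> k" "k < 2 * s" "2 \<le> s"
  shows "\<exists>v w. embeds k (2 * s + 1) E v w"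
proof -
  let ?v = "\<lambda>i. if i = 0 \<or> i = 2 * s then LA i else if even i then LD (i div 2 - 1) else LB i"
  let ?w = "\<lambda>i. if i = 0 then LX 0 else if i + 1 = 2 * s then LX (2 * s)
     else if i = 2 * s then LB (2 * s + 1 + i) else LA (2 * s + 1 + i)"
  let ?c = "\<lambda>p. case p of LD j \<Rightarrow> 2 * j + 2 | LA i \<Rightarrow> i | LB i \<Rightarrow> i
     | LX i \<Rightarrow> (if i = 0 then 2 * s + 1 else 4 * s)"
  have "embeds k (2 * s + 1) E (g \<circ> ?v) (g \<circ> ?w)"
    by (rule embeds_of_labels[OF assms(1), where c = ?c]) (use assms in \<open>(auto elim!: oddE evenE; presburger)+\<close>)
  then show ?thesis by blast
qed

text \<open>For even \<open>k\<close> the lollipop is bipartite and its vertex of degree three,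
  \<open>k - 1\<close>, lies in the odd class. So every even position is on two edges, and its two
  cherry partners close their triangles unless a dominating label sits there.\<close>

lemma embeds_cherries_even:
  assumes "hosts E g (labels (2 * (2 * s + 2)) d True True y S)"
    and "even k" "4 \<le> k" "k \<le> 2 * s"
  shows "\<exists>v w. embeds k (2 * s + 2) E v w"
proof -
  let ?v = "\<lambda>i. if odd i then LB i else if i div 2 < d then LD (i div 2) else LA i"
  let ?w = "\<lambda>i. if i = 2 * s + 1 then (if 0 < d then LA (2 * s + 2 + i) else LX2 0)
     else if (i + 1) div 2 < d then LA (2 * s + 2 + i)
     else if even i then LX i else LX2 (i + 1)"
  let ?c = "\<lambda>p. case p of LD j \<Rightarrow> 2 * j | LA i \<Rightarrow> i | LB i \<Rightarrow> i | LX i \<Rightarrow> 2 * s + 2 + i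
     | LX2 i \<Rightarrow> (if i = 0 then 4 * s + 3 else 2 * s + 1 + i)"
  have "embeds k (2 * s + 2) E (g \<circ> ?v) (g \<circ> ?w)"
    by (rule embeds_of_labels[OF assms(1), where c = ?c]) (use assms in \<open>(auto elim!: oddE evenE; presburger)+\<close>)
  then show ?thesis by blast
qed

text \<open>\<open>LD 0\<close> at position 0 breaks the odd cycle, being joined to both sides; the
  other positions alternate, with \<open>k - 1\<close> in the class \<open>LB\<close>.\<close>

lemma embeds_cherries_odd:
  assumes "hosts E g (labels (2 * (2 * s + 1)) d True True y S)"
    and "odd k" "4 \<le> k" "k < 2 * s" "0 < d"
  shows "\<exists>v w. embeds k (2 * s + 1) E v w"
proof -
  let ?v = "\<lambda>i. if i = 0 then LD 0 else if even i then LB i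
     else if 1 < i \<and> i div 2 < d then LD (i div 2) else LA i"
  let ?w = "\<lambda>i. if i = 0 then LB (2 * s + 1) else if i = 2 * s then LA (2 * s + 1 + i)
     else if odd i then (if 1 < i \<and> i div 2 < d then LA (2 * s + 1 + i) else LX i)
     else if i div 2 < d then LA (2 * s + 1 + i) else LX2 (i + 1)"
  let ?c = "\<lambda>p. case p of LD j \<Rightarrow> (if j = 0 then 0 else 2 * j + 1) | LA i \<Rightarrow> i | LB i \<Rightarrow> i
     | LX i \<Rightarrow> 2 * s + 1 + i | LX2 i \<Rightarrow> 2 * s + i"
  have "embeds k (2 * s + 1) E (g \<circ> ?v) (g \<circ> ?w)"
    by (rule embeds_of_labels[OF assms(1), where c = ?c]) (use assms in \<open>(auto elim!: oddE evenE; presburger)+\<close>)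
  then show ?thesis by blast
qed

text \<open>No dominating label breaks the odd cycle, so edge 0 runs inside a side, from
  \<open>LX 0\<close> to \<open>LA 0\<close>. The chord from \<open>LB 0\<close> to
  \<open>LX 0\<close> then finds no cherry partner for its new vertex; \<open>LS 3\<close> fills
  this gap.\<close>

lemma embeds_cherries_triangle_odd:
  assumes "hosts E g (labels (2 * (2 * s + 1)) d True True y {3})"
    and "odd k" "4 \<le> k" "k < 2 * s"
  shows "\<exists>v w. embeds k (2 * s + 1) E v w"
proof -
  let ?v = "\<lambda>i. if i = 0 then LX 0 else if i = 1 then LA 0 else if i = k - 1 then LB 0
     else if odd i then LA i else LB i"
  let ?w = "\<lambda>i. if i = 0 then LB (2 * s + 1) else if i = 1 then LX2 0 else if i = 2 * s then LS 3
     else if odd i then LX i else LX2 (i + 1)"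
  let ?c = "\<lambda>p. case p of LA i \<Rightarrow> (if i = 0 then 1 else i) | LB i \<Rightarrow> (if i = 0 then k - 1 else i)
     | LX i \<Rightarrow> (if i = 0 then 0 else 2 * s + 1 + i)
     | LX2 i \<Rightarrow> (if i = 0 then 2 * s + 2 else 2 * s + i) | LS i \<Rightarrow> 4 * s + 1"
  have "embeds k (2 * s + 1) E (g \<circ> ?v) (g \<circ> ?w)"
    by (rule embeds_of_labels[OF assms(1), where c = ?c]) (use assms in \<open>(auto elim!: oddE evenE; presburger)+\<close>)
  then show ?thesis by blast
qed

text \<open>One partner per vertex suffices because the lollipop has as many edges as vertices: edge
  \<open>i\<close> is closed by the partner of its end \<open>i + 1\<close>, and the chord by the
  partner of 0.\<close>

lemma embeds_two_matchings_even:
  assumes "hosts E g (labels (2 * (2 * s + 2)) d True x2 True S)"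
    and "even k" "4 \<le> k" "k \<le> 2 * s"
  shows "\<exists>v w. embeds k (2 * s + 2) E v w"
proof -
  let ?v = "\<lambda>i. if even i then LA i else LB i"
  let ?w = "\<lambda>i. if i = 2 * s + 1 then LX 0 else if odd i then LX (i + 1) else LY (i + 1)"
  let ?c = "\<lambda>p. case p of LA i \<Rightarrow> i | LB i \<Rightarrow> i
     | LX i \<Rightarrow> (if i = 0 then 4 * s + 3 else 2 * s + 1 + i) | LY i \<Rightarrow> 2 * s + 1 + i"
  have "embeds k (2 * s + 2) E (g \<circ> ?v) (g \<circ> ?w)"
    by (rule embeds_of_labels[OF assms(1), where c = ?c]) (use assms in \<open>(auto elim!: oddE evenE; presburger)+\<close>)
  then show ?thesis by blast
qed

text \<open>\<open>LD 0\<close> at position 1 removes the parity conflict and serves edges 0 and 1;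
  the other edges are closed by partners as for even \<open>k\<close>.\<close>

lemma embeds_two_matchings_odd:
  assumes "hosts E g (labels (2 * (2 * s + 1)) d True x2 True S)"
    and "odd k" "4 \<le> k" "k < 2 * s" "0 < d"
  shows "\<exists>v w. embeds k (2 * s + 1) E v w"
proof -
  let ?v = "\<lambda>i. if i = 0 then LB 0 else if i = 1 then LD 0 else if even i then LA i else LB i"
  let ?w = "\<lambda>i. if i = 0 then LA (2 * s + 1) else if i = 1 then LB (2 * s + 2)
     else if i = 2 * s then LY 0 else if odd i then LX (i + 1) else LY (i + 1)"
  let ?c = "\<lambda>p. case p of LA i \<Rightarrow> i | LB i \<Rightarrow> i | LD i \<Rightarrow> 1
     | LX i \<Rightarrow> 2 * s + i | LY i \<Rightarrow> (if i = 0 then 4 * s + 1 else 2 * s + i)"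
  have "embeds k (2 * s + 1) E (g \<circ> ?v) (g \<circ> ?w)"
    by (rule embeds_of_labels[OF assms(1), where c = ?c]) (use assms in \<open>(auto elim!: oddE evenE; presburger)+\<close>)
  then show ?thesis by blast
qed

section \<open>Blocks and the local dichotomy\<close>

locale ugraph =
  fixes V :: "'a set" and E :: "'a set set"
  assumes finV: "finite V"
    and wfE: "\<And>e. e \<in> E \<Longrightarrow> e \<subseteq> V \<and> card e = 2"
begin

definition nbrs :: "'a \<Rightarrow> 'a set" where
  "nbrs x = {y. {x, y} \<in> E}"

definition joined :: "'a set \<Rightarrow> 'a set \<Rightarrow> bool" where
  "joined A B \<longleftrightarrow> (\<forall>a\<in>A. \<forall>b\<in>B. {a, b} \<in> E)"

text \<open>Disjointness of \<open>A\<close>, \<open>B\<close> and \<open>D\<close> is implicit,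
  since a loop is not an edge.\<close>

definition block :: "nat \<Rightarrow> nat \<Rightarrow> 'a set \<Rightarrow> 'a set \<Rightarrow> 'a set \<Rightarrow> bool" where
  "block p d A B D \<longleftrightarrow> A \<subseteq> V \<and> B \<subseteq> V \<and> D \<subseteq> V \<and> card A = p \<and> card B = p \<and> card D = d \<and>
     joined A B \<and> joined D A \<and> joined D B"

definition touched :: "'a set \<Rightarrow> 'a set set" where
  "touched X = {e \<in> E. e \<inter> X \<noteq> {}}"

text \<open>
  The bound below is the number of edges lost by the extremal graph when \<open>m\<close> vertices are deleted from
  each side; graphs that are not \<open>good\<close> can be shrunk while gaining on the extremal number.
\<close>

definition good :: "nat \<Rightarrow> nat \<Rightarrow> bool" where
  "good s M \<longleftrightarrow> (\<forall>m A B. 1 \<le> m \<longrightarrow> m \<le> M \<longrightarrow> A \<subseteq> V \<longrightarrow> B \<subseteq> V \<longrightarrow> card A = m \<longrightarrow> card B = m \<longrightarrow>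
     joined A B \<longrightarrow> m * (card V + s - m) \<le> card (touched (A \<union> B)))"

text \<open>If this fails at \<open>x\<close>, then \<open>x\<close> can be added to
  \<open>D\<close> after cutting both sides down to \<open>r\<close> neighbours of
  \<open>x\<close>.\<close>

definition nonext :: "nat \<Rightarrow> 'a set \<Rightarrow> 'a set \<Rightarrow> 'a set \<Rightarrow> bool" where
  "nonext r A B D \<longleftrightarrow> (\<forall>x\<in>V - D. card (nbrs x \<inter> A) < r \<or> card (nbrs x \<inter> B) < r)"

text \<open>
  For a block \<open>(A, B, D)\<close> that cannot be extended, the vertices of \<open>typical D R B\<close> behave like those
  of \<open>A\<close>.
\<close>

definition typical :: "'a set \<Rightarrow> nat \<Rightarrow> 'a set \<Rightarrow> 'a set" where
  "typical D R B = {x \<in> V - D. card (B - nbrs x) \<le> R}"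

text \<open>The value \<open>c = 1\<close> leads to matchings and \<open>c = 2\<close> to cherries
  inside the side of \<open>A\<close>.\<close>

definition many :: "nat \<Rightarrow> nat \<Rightarrow> 'a set \<Rightarrow> nat \<Rightarrow> 'a set \<Rightarrow> 'a set \<Rightarrow> bool" where
  "many N c D R A B \<longleftrightarrow> N \<le> card {a \<in> A. c \<le> card (nbrs a \<inter> typical D R B)}"

section \<open>Neighbourhoods, blocks and typical vertices\<close>

lemma finE: "finite E"
  using wfE finV by (metis PowI finite_Pow_iff finite_subset subsetI)

lemma no_loop: "{x, x} \<notin> E"
proof
  assume "{x, x} \<in> E"
  then have "card {x, x} = 2" using wfE by blast
  then show False by simp
qed

lemma edge_neq: "{x, y} \<in> E \<Longrightarrow> x \<noteq> y"
  using no_loop by auto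

lemma edge_sym: "{x, y} \<in> E \<Longrightarrow> {y, x} \<in> E"
  by (simp add: insert_commute)

lemma edge_in_V: "{x, y} \<in> E \<Longrightarrow> x \<in> V \<and> y \<in> V"
  using wfE by blast

lemma edgeE:
  assumes "e \<in> E" obtains x y where "e = {x, y}" "x \<noteq> y"
  using wfE[OF assms] by (meson card_2_iff)

lemma in_nbrs: "y \<in> nbrs x \<longleftrightarrow> {x, y} \<in> E"
  by (simp add: nbrs_def)

lemma nbrs_sym: "y \<in> nbrs x \<longleftrightarrow> x \<in> nbrs y"
  by (simp add: nbrs_def insert_commute)

lemma nbrs_subset: "nbrs x \<subseteq> V"
  using edge_in_V by (auto simp: nbrs_def)

lemma fin_nbrs: "finite (nbrs x)"
  using nbrs_subset finV finite_subset by blast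

lemma not_in_nbrs: "x \<notin> nbrs x"
  using no_loop by (auto simp: nbrs_def)

lemma joined_sym: "joined A B \<Longrightarrow> joined B A"
  unfolding joined_def using edge_sym by blast

lemma joined_mono: "joined A B \<Longrightarrow> A' \<subseteq> A \<Longrightarrow> B' \<subseteq> B \<Longrightarrow> joined A' B'"
  unfolding joined_def by blast

lemma joined_disjoint: "joined A B \<Longrightarrow> A \<inter> B = {}"
  unfolding joined_def using no_loop by fastforce

lemma joined_nbrs: "joined A B \<Longrightarrow> a \<in> A \<Longrightarrow> B \<subseteq> nbrs a"
  unfolding joined_def nbrs_def by blast

lemma block_sym: "block p d A B D \<Longrightarrow> block p d B A D"
  by (auto simp: block_def intro: joined_sym)

lemma block_fin: "block p d A B D \<Longrightarrow> finite A \<and> finite B \<and> finite D"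
  unfolding block_def using finV finite_subset by blast

lemma block_disjoint:
  "block p d A B D \<Longrightarrow> A \<inter> B = {} \<and> D \<inter> A = {} \<and> D \<inter> B = {}"
  unfolding block_def using joined_disjoint by blast

lemma block_mono:
  "block p d A B D \<Longrightarrow> A' \<subseteq> A \<Longrightarrow> B' \<subseteq> B \<Longrightarrow> card A' = m \<Longrightarrow> card B' = m \<Longrightarrow> block m d A' B' D"
  unfolding block_def using joined_mono by blast

lemma nonext_sym: "nonext r A B D \<Longrightarrow> nonext r B A D"
  unfolding nonext_def by blast

lemma nonext_mono:
  assumes "nonext r A B D" "A' \<subseteq> A" "B' \<subseteq> B" "finite A" "finite B"
  shows "nonext r A' B' D"
proof -
  have "card (nbrs x \<inter> A') \<le> card (nbrs x \<inter> A)" "card (nbrs x \<inter> B') \<le> card (nbrs x \<inter> B)" for x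
    using assms by (auto intro!: card_mono)
  then show ?thesis using assms(1) unfolding nonext_def by (meson le_less_trans)
qed

lemma good_mono: "good s M \<Longrightarrow> M' \<le> M \<Longrightarrow> good s M'"
  unfolding good_def by auto

lemma block_subset_typical: "block p d A B D \<Longrightarrow> A \<subseteq> typical D R B"
proof
  fix a assume b: "block p d A B D" and a: "a \<in> A"
  then have "card (B - nbrs a) = 0" using joined_nbrs unfolding block_def by (metis Diff_eq_empty_iff card.empty)
  moreover have "a \<in> V - D" using b a block_disjoint[OF b] unfolding block_def by blast
  ultimately show "a \<in> typical D R B" unfolding typical_def by simp
qed

text \<open>A typical vertex sees at least \<open>M - R \<ge> r\<close> vertices of
  \<open>B\<close>, so it may not see \<open>r\<close> vertices of \<open>A\<close>. This sparsity
  inside a side makes greedy disjoint choices possible.\<close>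

lemma typical_few:
  assumes b: "block M d A B D" and ne: "nonext r A B D" and "R + r \<le> M" and x: "x \<in> typical D R B"
  shows "card (nbrs x \<inter> A) < r" and "r \<le> card (nbrs x \<inter> B)"
proof -
  have "card B = card (B - nbrs x) + card (nbrs x \<inter> B)"
    using block_fin[OF b] by (metis Int_commute add.commute card_Int_Diff)
  then show 2: "r \<le> card (nbrs x \<inter> B)"
    using x assms(3) b unfolding typical_def block_def by auto
  show "card (nbrs x \<inter> A) < r"
    using ne x 2 unfolding nonext_def typical_def by fastforce
qed

section \<open>Degree bounds and dense graphs\<close>

lemma card_edges_le_degree_sum: "card E \<le> (\<Sum>x\<in>V. card (nbrs x))"
proof -
  have "E \<subseteq> (\<lambda>(x, y). {x, y}) ` (SIGMA x:V. nbrs x)"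
  proof
    fix e assume e: "e \<in> E"
    then obtain x y where xy: "e = {x, y}" by (rule edgeE)
    then have "(x, y) \<in> (SIGMA x:V. nbrs x)" using e edge_in_V[of x y] by (simp add: in_nbrs)
    then show "e \<in> (\<lambda>(x, y). {x, y}) ` (SIGMA x:V. nbrs x)" using xy by force
  qed
  then have "card E \<le> card ((\<lambda>(x, y). {x, y}) ` (SIGMA x:V. nbrs x))"
    using finV fin_nbrs by (intro card_mono) auto
  also have "\<dots> \<le> card (SIGMA x:V. nbrs x)"
    using finV fin_nbrs by (intro card_image_le) auto
  also have "\<dots> = (\<Sum>x\<in>V. card (nbrs x))"
    using finV fin_nbrs by simp
  finally show ?thesis .
qed

text \<open>Goodness for the pair \<open>{u}\<close>, \<open>{v}\<close>: the edge between them is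
  touched only once, which matches the \<open>- m\<close> of the bound at
  \<open>m = 1\<close>.\<close>

lemma common_nbrs_bound:
  assumes "good s M" "1 \<le> M" "{u, v} \<in> E"
  shows "card V + s \<le> card (nbrs u) + card (nbrs v)" "s \<le> card (nbrs u \<inter> nbrs v)"
proof -
  have uv: "u \<in> V" "v \<in> V" "u \<noteq> v" using assms(3) edge_in_V edge_neq by auto
  have "touched ({u} \<union> {v}) \<subseteq> (\<lambda>y. {u, y}) ` nbrs u \<union> (\<lambda>y. {v, y}) ` (nbrs v - {u})"
  proof
    fix e assume "e \<in> touched ({u} \<union> {v})"
    then have e: "e \<in> E" "u \<in> e \<or> v \<in> e" unfolding touched_def by auto
    from e(1) obtain x y where xy: "e = {x, y}" by (rule edgeE)
    show "e \<in> (\<lambda>y. {u, y}) ` nbrs u \<union> (\<lambda>y. {v, y}) ` (nbrs v - {u})"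
    proof (cases "u \<in> e")
      case True
      then obtain y where "e = {u, y}" using xy by auto
      then show ?thesis using e(1) by (auto simp: in_nbrs)
    next
      case False
      then obtain y where "e = {v, y}" using xy e(2) by auto
      then show ?thesis using e(1) False by (auto simp: in_nbrs)
    qed
  qed
  then have "card (touched ({u} \<union> {v})) \<le> card ((\<lambda>y. {u, y}) ` nbrs u \<union> (\<lambda>y. {v, y}) ` (nbrs v - {u}))"
    using fin_nbrs by (intro card_mono) auto
  also have "\<dots> \<le> card ((\<lambda>y. {u, y}) ` nbrs u) + card ((\<lambda>y. {v, y}) ` (nbrs v - {u}))"
    by (rule card_Un_le)
  also have "\<dots> \<le> card (nbrs u) + card (nbrs v - {u})"
    using fin_nbrs by (intro add_mono card_image_le) auto
  also have "card (nbrs v - {u}) = card (nbrs v) - 1"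
    using assms(3) fin_nbrs by (simp add: in_nbrs insert_commute)
  finally have 1: "card (touched ({u} \<union> {v})) \<le> card (nbrs u) + (card (nbrs v) - 1)" .
  have "joined {u} {v}" using assms(3) by (simp add: joined_def)
  then have "1 * (card V + s - 1) \<le> card (touched ({u} \<union> {v}))"
    using assms(1)[unfolded good_def, rule_format, of 1 "{u}" "{v}"] assms(2) uv by simp
  moreover have "card (nbrs v) > 0"
    using assms(3) fin_nbrs in_nbrs nbrs_sym card_gt_0_iff by blast
  moreover have "card V > 0" using uv finV card_gt_0_iff by blast
  ultimately show 2: "card V + s \<le> card (nbrs u) + card (nbrs v)" using 1 by linarith
  have "card (nbrs u) + card (nbrs v) = card (nbrs u \<union> nbrs v) + card (nbrs u \<inter> nbrs v)"
    using fin_nbrs by (intro card_Un_Int) auto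
  moreover have "card (nbrs u \<union> nbrs v) \<le> card V"
    using nbrs_subset finV by (intro card_mono) auto
  ultimately show "s \<le> card (nbrs u \<inter> nbrs v)" using 2 by linarith
qed

text \<open>Kovari-Sos-Turan by pigeonhole: linearly many vertices have \<open>r\<close> neighbours
  in a fixed set \<open>Y\<close> of \<open>q\<close> vertices of high degree, and \<open>r\<close>
  of them have the same trace on \<open>Y\<close>.\<close>

lemma dense_contains_block:
  assumes dense: "card V * card V \<le> 8 * card E"
    and large: "16 * (32 * r) + 32 * (2 ^ (32 * r) * r) < card V"
  shows "\<exists>A B. block r 0 A B {}"
proof -
  define n where "n = card V"
  \<comment> \<open>In the count of the edges at \<open>Y\<close>, scaled by 16, vertices with fewer
    than \<open>r\<close> neighbours in \<open>Y\<close> account for at most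
    \<open>16 * n * r\<close> out of \<open>q * n\<close>; this choice makes it one half.\<close>
  define q where "q = 32 * r"
  define H where "H = {x \<in> V. n \<le> 16 * card (nbrs x)}"
  have finH: "finite H" "H \<subseteq> V" using finV by (auto simp: H_def)
  have n0: "0 < n" using large by (simp add: n_def)
  have "16 * card E \<le> (\<Sum>x\<in>V. 16 * card (nbrs x))"
    using card_edges_le_degree_sum by (simp add: sum_distrib_left[symmetric])
  also have "\<dots> \<le> (\<Sum>x\<in>V. (if x \<in> H then 16 * n else 0) + n)"
  proof (rule sum_mono)
    fix x assume x: "x \<in> V"
    have "card (nbrs x) \<le> n" unfolding n_def by (intro card_mono finV nbrs_subset)
    then show "16 * card (nbrs x) \<le> (if x \<in> H then 16 * n else 0) + n"
      using x by (auto simp: H_def)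
  qed
  also have "\<dots> = card H * (16 * n) + n * n"
    using finV finH by (simp add: sum.distrib sum.If_cases Int_absorb1 n_def)
  finally have "2 * (n * n) \<le> card H * (16 * n) + n * n"
    using dense unfolding n_def by linarith
  then have "n * n \<le> card H * (16 * n)" by linarith
  then have "n * n \<le> (16 * card H) * n" by (metis mult.assoc mult.commute)
  then have H16: "n \<le> 16 * card H" using n0 mult_le_cancel2 by blast
  have "16 * q < n" using large by (simp add: n_def q_def)
  then have "q \<le> card H" using H16 by linarith
  from obtain_subset_with_card_n[OF this] obtain Y where Y: "Y \<subseteq> H" "card Y = q" "finite Y"
    by blast
  define S where "S = {x \<in> V. r \<le> card (nbrs x \<inter> Y)}"
  have "q * n \<le> (\<Sum>y\<in>Y. 16 * card (nbrs y))"
  proof -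
    have "(\<Sum>y\<in>Y. n) \<le> (\<Sum>y\<in>Y. 16 * card (nbrs y))"
      using Y(1) by (intro sum_mono) (auto simp: H_def)
    then show ?thesis using Y(2) by simp
  qed
  also have "\<dots> = 16 * (\<Sum>y\<in>Y. card (nbrs y))" by (simp add: sum_distrib_left)
  also have "(\<Sum>y\<in>Y. card (nbrs y)) = (\<Sum>y\<in>Y. card {x \<in> V. {y, x} \<in> E})"
    using nbrs_subset by (intro sum.cong refl arg_cong[where f = card]) (auto simp: nbrs_def)
  also have "\<dots> = (\<Sum>x\<in>V. card {y \<in> Y. {y, x} \<in> E})"
    by (rule sum_multicount_gen) (use Y finV in auto)
  also have "\<dots> \<le> (\<Sum>x\<in>V. (if x \<in> S then q else 0) + r)"
  proof (rule sum_mono)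
    fix x assume x: "x \<in> V"
    have eq: "{y \<in> Y. {y, x} \<in> E} = nbrs x \<inter> Y" by (auto simp: nbrs_def insert_commute)
    have "card (nbrs x \<inter> Y) \<le> q" using Y by (metis Int_lower2 card_mono)
    then show "card {y \<in> Y. {y, x} \<in> E} \<le> (if x \<in> S then q else 0) + r"
      unfolding eq using x by (auto simp: S_def)
  qed
  also have "\<dots> = card S * q + n * r"
    using finV by (simp add: sum.distrib sum.If_cases S_def Int_def n_def conj_commute)
  finally have "q * n \<le> 16 * (card S * q + n * r)" by simp
  then have "r * n \<le> r * (32 * card S)" by (simp add: q_def algebra_simps)
  moreover have "r = 0 \<Longrightarrow> ?thesis"
    by (rule exI[of _ "{}"], rule exI[of _ "{}"]) (auto simp: block_def joined_def)
  moreover have ?thesis if r: "0 < r" and S32: "n \<le> 32 * card S"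
  proof -
    have "\<exists>W\<in>Pow Y. r \<le> card {x \<in> S. nbrs x \<inter> Y = W}"
    proof (rule ccontr)
      assume "\<not> ?thesis"
      then have *: "card {x \<in> S. nbrs x \<inter> Y = W} \<le> r" if "W \<in> Pow Y" for W
        using that nat_le_linear by blast
      have "card S \<le> card (\<Union>W\<in>Pow Y. {x \<in> S. nbrs x \<inter> Y = W})"
      proof (rule card_mono)
        have "finite S" using finV unfolding S_def by simp
        then show "finite (\<Union>W\<in>Pow Y. {x \<in> S. nbrs x \<inter> Y = W})"
          by (rule rev_finite_subset) (intro UN_least Collect_restrict)
        show "S \<subseteq> (\<Union>W\<in>Pow Y. {x \<in> S. nbrs x \<inter> Y = W})"
        proof
          fix x assume "x \<in> S"
          then show "x \<in> (\<Union>W\<in>Pow Y. {x \<in> S. nbrs x \<inter> Y = W})"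
            by (intro UN_I[of "nbrs x \<inter> Y"]) auto
        qed
      qed
      also have "\<dots> \<le> (\<Sum>W\<in>Pow Y. card {x \<in> S. nbrs x \<inter> Y = W})"
        using Y(3) by (intro card_UN_le) auto
      also have "\<dots> \<le> (\<Sum>W\<in>Pow Y. r)" using * by (intro sum_mono) auto
      also have "\<dots> = 2 ^ q * r" using Y by (simp add: card_Pow)
      finally have "n \<le> 32 * (2 ^ q * r)" using S32 by linarith
      then show False using large by (simp add: n_def q_def)
    qed
    then obtain W where W: "W \<subseteq> Y" "r \<le> card {x \<in> S. nbrs x \<inter> Y = W}" by blast
    from obtain_subset_with_card_n[OF W(2)] obtain A
      where A: "A \<subseteq> {x \<in> S. nbrs x \<inter> Y = W}" "card A = r" by blast
    then have "A \<noteq> {}" using r by auto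
    then have "r \<le> card W" using A unfolding S_def by auto
    from obtain_subset_with_card_n[OF this] obtain B where B: "B \<subseteq> W" "card B = r" by blast
    have "joined A B" using A B unfolding joined_def nbrs_def by blast
    moreover have "A \<subseteq> V" "B \<subseteq> V" using A B W Y finH unfolding S_def by auto
    ultimately have "block r 0 A B {}" using A B by (simp add: block_def joined_def)
    then show ?thesis by blast
  qed
  ultimately show ?thesis by (metis gr0I mult_le_cancel1)
qed

text \<open>
  Count the edges touched by the vertices of \<open>A \<union> B\<close> that have few neighbours on their own side:
  a vertex outside \<open>D\<close> contributes at most \<open>m\<close> apart from its edges into its own side, so goodness
  forces on average \<open>s - d\<close> such edges for each pair from \<open>A \<times> B\<close>.
\<close>

lemma dichotomy:
  assumes b: "block M d A B D" and ne: "nonext r A B D" and g: "good s M"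
    and N: "1 \<le> N" "N < M" and sum: "\<alpha> + \<beta> + d < s"
  shows "many N (Suc \<alpha>) D (r + N) A B \<or> many N (Suc \<beta>) D (r + N) B A"
proof (rule ccontr)
  assume neg: "\<not> ?thesis"
  \<comment> \<open>A vertex outside \<open>D\<close> that is typical for neither side sees fewer
    than \<open>r\<close> vertices of one side and fewer than \<open>M - R\<close> of the other,
    together fewer than \<open>M - N\<close>, which is \<open>m\<close>.\<close>
  define R where "R = r + N"
  define TA where "TA = typical D R B"
  define TB where "TB = typical D R A"
  define m where "m = M - N"
  define n where "n = card V"
  have fin: "finite A" "finite B" "finite D" using block_fin[OF b] by auto
  have sub: "A \<subseteq> V" "B \<subseteq> V" "D \<subseteq> V" "card A = M" "card B = M" "card D = d" "joined A B"
    using b by (auto simp: block_def)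
  have ATA: "A \<subseteq> TA" using block_subset_typical[OF b] by (simp add: TA_def)
  have BTB: "B \<subseteq> TB" using block_subset_typical[OF block_sym[OF b]] by (simp add: TB_def)
  have low: "\<exists>A'\<subseteq>{a \<in> A. card (nbrs a \<inter> typical D R B) \<le> \<gamma>}. card A' = m"
    if "\<not> many N (Suc \<gamma>) D R A B" "finite A" "card A = M" for A B \<gamma>
  proof -
    have "card A \<le> card ({a \<in> A. card (nbrs a \<inter> typical D R B) \<le> \<gamma>} \<union> {a \<in> A. Suc \<gamma> \<le> card (nbrs a \<inter> typical D R B)})"
      using that by (intro card_mono) auto
    also have "\<dots> \<le> card {a \<in> A. card (nbrs a \<inter> typical D R B) \<le> \<gamma>} + card {a \<in> A. Suc \<gamma> \<le> card (nbrs a \<inter> typical D R B)}"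
      by (rule card_Un_le)
    finally have "card A \<le> \<dots>" .
    then have "m \<le> card {a \<in> A. card (nbrs a \<inter> typical D R B) \<le> \<gamma>}"
      using that unfolding many_def m_def by linarith
    then show ?thesis by (rule obtain_subset_with_card_n) blast
  qed
  from low[of \<alpha> A B] neg fin sub obtain A' where
    A': "A' \<subseteq> {a \<in> A. card (nbrs a \<inter> TA) \<le> \<alpha>}" "card A' = m" unfolding R_def TA_def by blast
  from low[of \<beta> B A] neg fin sub obtain B' where
    B': "B' \<subseteq> {a \<in> B. card (nbrs a \<inter> TB) \<le> \<beta>}" "card B' = m" unfolding R_def TB_def by blast
  have subAB: "A' \<subseteq> A" "B' \<subseteq> B" using A' B' by auto
  have fin': "finite A'" "finite B'" using subAB fin finite_subset by auto
  have m1: "1 \<le> m" "m \<le> M" using N by (auto simp: m_def)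
  have disj: "A \<inter> B = {}" "D \<inter> A = {}" "D \<inter> B = {}" using block_disjoint[OF b] by auto
  have cX: "card (A' \<union> B') = 2 * m" 
  proof -
    have "A' \<inter> B' = {}" using disj(1) subAB by blast
    then show ?thesis using card_Un_disjoint[OF fin'] A'(2) B'(2) by simp
  qed
  let ?X = "A' \<union> B'"
  \<comment> \<open>Edges from \<open>A'\<close> into \<open>TA\<close> and from \<open>B'\<close>
    into \<open>TB\<close> are counted in \<open>T1\<close> and \<open>T2\<close>, those between
    \<open>A'\<close> and \<open>B'\<close> in \<open>T3\<close>; \<open>S y\<close> records what is
    left at an outside vertex \<open>y\<close>.\<close>
  define S where "S y = (if y \<in> TA then {} else A' \<inter> nbrs y) \<union> (if y \<in> TB then {} else B' \<inter> nbrs y)" for y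
  have finS: "finite (S y)" for y using fin' by (auto simp: S_def)
  define T1 where "T1 = (\<Union>a\<in>A'. (\<lambda>y. {a, y}) ` (nbrs a \<inter> TA))"
  define T2 where "T2 = (\<Union>a\<in>B'. (\<lambda>y. {a, y}) ` (nbrs a \<inter> TB))"
  define T3 where "T3 = (\<Union>a\<in>A'. (\<lambda>b. {a, b}) ` B')"
  define T4 where "T4 = (\<Union>y\<in>V - ?X. (\<lambda>x. {x, y}) ` S y)"
  have "touched ?X \<subseteq> T1 \<union> T2 \<union> T3 \<union> T4"
  proof
    fix e assume "e \<in> touched ?X"
    then obtain x where e: "e \<in> E" "x \<in> e" "x \<in> ?X" unfolding touched_def by blast
    from e(1,2) obtain y where xy: "e = {x, y}" by (metis edgeE insertE insert_commute singletonD)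
    have xyE: "y \<in> nbrs x" "x \<in> nbrs y" "y \<in> V"
      using e xy edge_in_V by (auto simp: in_nbrs insert_commute)
    show "e \<in> T1 \<union> T2 \<union> T3 \<union> T4"
    proof (cases "x \<in> A'")
      case True
      have "e \<in> T1" if "y \<in> TA" using True xyE that xy unfolding T1_def by blast
      moreover have "e \<in> T3" if "y \<in> B'" using True xyE that xy unfolding T3_def by blast
      moreover have "e \<in> T4" if "y \<notin> TA" "y \<notin> B'"
      proof -
        have "y \<notin> A'" using that ATA subAB by blast
        moreover have "x \<in> S y" using that True xyE by (simp add: S_def)
        ultimately show ?thesis using that xyE xy unfolding T4_def by blast
      qed
      ultimately show ?thesis by blast
    next
      case False
      then have x: "x \<in> B'" using e by blast
      have "e \<in> T2" if "y \<in> TB" using x xyE that xy unfolding T2_def by blast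
      moreover have "e \<in> T3" if "y \<in> A'" using x xyE that xy unfolding T3_def by blast
      moreover have "e \<in> T4" if "y \<notin> TB" "y \<notin> A'"
      proof -
        have "y \<notin> B'" using that BTB subAB by blast
        moreover have "x \<in> S y" using that x xyE by (simp add: S_def)
        ultimately show ?thesis using that xyE xy unfolding T4_def by blast
      qed
      ultimately show ?thesis by blast
    qed
  qed
  moreover have finT: "finite T1" "finite T2" "finite T3" "finite T4"
    unfolding T1_def T2_def T3_def T4_def using fin' fin_nbrs finS finV by auto
  ultimately have "card (touched ?X) \<le> card (T1 \<union> T2 \<union> T3 \<union> T4)"
    by (intro card_mono) auto
  also have "\<dots> \<le> card T1 + card T2 + card T3 + card T4"
    using card_Un_le[of "T1 \<union> T2 \<union> T3" T4] card_Un_le[of "T1 \<union> T2" T3] card_Un_le[of T1 T2] by linarith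
  finally have t: "card (touched ?X) \<le> card T1 + card T2 + card T3 + card T4" .
  have T1: "card T1 \<le> m * \<alpha>"
  proof -
    have "card T1 \<le> (\<Sum>a\<in>A'. card ((\<lambda>y. {a, y}) ` (nbrs a \<inter> TA)))"
      unfolding T1_def using fin' by (intro card_UN_le)
    also have "\<dots> \<le> (\<Sum>a\<in>A'. card (nbrs a \<inter> TA))"
      using fin_nbrs by (intro sum_mono card_image_le) auto
    also have "\<dots> \<le> (\<Sum>a\<in>A'. \<alpha>)" using A' by (intro sum_mono) auto
    finally show ?thesis using A' by simp
  qed
  have T2: "card T2 \<le> m * \<beta>"
  proof -
    have "card T2 \<le> (\<Sum>a\<in>B'. card ((\<lambda>y. {a, y}) ` (nbrs a \<inter> TB)))"
      unfolding T2_def using fin' by (intro card_UN_le)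
    also have "\<dots> \<le> (\<Sum>a\<in>B'. card (nbrs a \<inter> TB))"
      using fin_nbrs by (intro sum_mono card_image_le) auto
    also have "\<dots> \<le> (\<Sum>a\<in>B'. \<beta>)" using B' by (intro sum_mono) auto
    finally show ?thesis using B' by simp
  qed
  have T3: "card T3 \<le> m * m"
  proof -
    have "card T3 \<le> (\<Sum>a\<in>A'. card ((\<lambda>b. {a, b}) ` B'))"
      unfolding T3_def using fin' by (intro card_UN_le)
    also have "\<dots> \<le> (\<Sum>a\<in>A'. card B')"
      using fin' by (intro sum_mono card_image_le) auto
    finally show ?thesis using A' B' by simp
  qed
  have S2m: "card (S y) \<le> 2 * m" for y
  proof -
    have "S y \<subseteq> ?X" by (auto simp: S_def)
    then show ?thesis using cX fin' by (metis card_mono finite_UnI)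
  qed
  have Sm: "card (S y) \<le> m" if "y \<in> V - D" for y
  proof -
    consider "y \<in> TA" | "y \<in> TB" | "y \<notin> TA" "y \<notin> TB" by blast
    then show ?thesis
    proof cases
      case 1
      then have "S y \<subseteq> B'" by (auto simp: S_def)
      then show ?thesis using B' fin' by (metis card_mono)
    next
      case 2
      then have "S y \<subseteq> A'" by (auto simp: S_def)
      then show ?thesis using A' fin' by (metis card_mono)
    next
      case 3
      have "S y \<subseteq> (nbrs y \<inter> A) \<union> (nbrs y \<inter> B)" using subAB by (auto simp: S_def)
      then have "card (S y) \<le> card (nbrs y \<inter> A) + card (nbrs y \<inter> B)"
        using fin by (meson card_Un_le card_mono finite_Int finite_UnI le_trans)
      moreover have "card A = card (A - nbrs y) + card (nbrs y \<inter> A)"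
        "card B = card (B - nbrs y) + card (nbrs y \<inter> B)"
        using fin by (metis Int_commute add.commute card_Int_Diff)+
      moreover have "R < card (A - nbrs y)" "R < card (B - nbrs y)"
        using 3 that unfolding TA_def TB_def typical_def by auto
      moreover have "card (nbrs y \<inter> A) < r \<or> card (nbrs y \<inter> B) < r"
        using ne that unfolding nonext_def by blast
      ultimately show ?thesis using sub by (auto simp: m_def R_def)
    qed
  qed
  have DV: "D \<subseteq> V - ?X" using sub disj subAB by blast
  have T4: "card T4 \<le> 2 * m * d + m * (n - 2 * m - d)"
  proof -
    have "card T4 \<le> (\<Sum>y\<in>V - ?X. card ((\<lambda>x. {x, y}) ` S y))"
      unfolding T4_def using finV by (intro card_UN_le) auto
    also have "\<dots> \<le> (\<Sum>y\<in>V - ?X. card (S y))"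
      using finS by (intro sum_mono card_image_le) auto
    also have "\<dots> = (\<Sum>y\<in>D. card (S y)) + (\<Sum>y\<in>V - ?X - D. card (S y))"
      using DV finV by (metis (no_types, lifting) add.commute finite_Diff sum.subset_diff)
    also have "\<dots> \<le> (\<Sum>y\<in>D. 2 * m) + (\<Sum>y\<in>V - ?X - D. m)"
      using S2m Sm by (intro add_mono sum_mono) auto
    also have "\<dots> = 2 * m * d + m * card (V - ?X - D)" using sub by simp
    also have "card (V - ?X - D) = n - 2 * m - d"
    proof -
      have "?X \<subseteq> V" using sub subAB by blast
      then have "card (V - ?X) = n - 2 * m" using cX fin' card_Diff_subset[of ?X V] by (simp add: n_def)
      then show ?thesis using DV fin sub(6) card_Diff_subset[of D "V - ?X"] by simp
    qed
    finally show ?thesis .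
  qed
  have nl: "2 * m + d \<le> n"
  proof -
    have "card (?X \<union> D) = 2 * m + d"
      using cX sub fin fin' disj subAB by (subst card_Un_disjoint) auto
    moreover have "card (?X \<union> D) \<le> n" unfolding n_def using finV sub subAB by (intro card_mono) auto
    ultimately show ?thesis by simp
  qed
  have "joined A' B'" using sub subAB joined_mono by blast
  then have "m * (n + s - m) \<le> card (touched ?X)"
    using g[unfolded good_def, rule_format, of m A' B'] m1 sub(1,2) subAB A'(2) B'(2)
    unfolding n_def by (meson order_trans)
  then have "m * (n + s - m) \<le> m * \<alpha> + m * \<beta> + m * m + (2 * m * d + m * (n - 2 * m - d))"
    using t T1 T2 T3 T4 by linarith
  also have "\<dots> = m * (\<alpha> + \<beta> + m + 2 * d + (n - 2 * m - d))" by (simp add: algebra_simps)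
  \<comment> \<open>A factor \<open>m\<close> is cancelled. Vertices of \<open>D\<close> were
    allowed \<open>2 * m\<close> edges and the other outside vertices \<open>m\<close>, so what
    remains amounts to \<open>s \<le> \<alpha> + \<beta> + d\<close>.\<close>
  finally have "n + s - m \<le> \<alpha> + \<beta> + m + 2 * d + (n - 2 * m - d)" using m1 by simp
  then show False using nl sum by linarith
qed

end

section \<open>Finding host graphs\<close>

text \<open>Greedy choice: each chosen element excludes at most \<open>c\<close> elements, itself
  included because \<open>W a\<close> is nonempty.\<close>

lemma disjoint_selection:
  fixes W :: "'a \<Rightarrow> 'b set"
  assumes "\<And>a. a \<in> S \<Longrightarrow> card {a' \<in> S. W a \<inter> W a' \<noteq> {}} \<le> c"
    and "\<And>a. a \<in> S \<Longrightarrow> W a \<noteq> {}" and "finite S" and "q * c < card S"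
  shows "\<exists>Q\<subseteq>S. finite Q \<and> card Q = q \<and> (\<forall>a\<in>Q. \<forall>a'\<in>Q. a \<noteq> a' \<longrightarrow> W a \<inter> W a' = {})"
  using assms(4)
proof (induction q)
  case 0
  show ?case by (rule exI[of _ "{}"]) simp
next
  case (Suc q)
  then obtain Q where Q: "Q \<subseteq> S" "finite Q" "card Q = q"
      "\<And>a a'. a \<in> Q \<Longrightarrow> a' \<in> Q \<Longrightarrow> a \<noteq> a' \<Longrightarrow> W a \<inter> W a' = {}" by auto
  let ?U = "\<Union>a\<in>Q. {a' \<in> S. W a \<inter> W a' \<noteq> {}}"
  have "card ?U \<le> (\<Sum>a\<in>Q. card {a' \<in> S. W a \<inter> W a' \<noteq> {}})"
    using Q(2) by (rule card_UN_le)
  also have "\<dots> \<le> (\<Sum>a\<in>Q. c)" using Q(1) assms(1) by (intro sum_mono) auto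
  finally have "card ?U < card S" using Q(3) Suc.prems by simp
  moreover have "finite ?U" using Q(2) assms(3) by simp
  ultimately obtain x where x: "x \<in> S" "x \<notin> ?U"
    using card_mono[of ?U S] by fastforce
  then have "W a \<inter> W x = {}" if "a \<in> Q" for a using that by blast
  moreover from this have "x \<notin> Q" using assms(2)[OF x(1)] by auto
  ultimately have "insert x Q \<subseteq> S \<and> finite (insert x Q) \<and> card (insert x Q) = Suc q \<and>
      (\<forall>a\<in>insert x Q. \<forall>a'\<in>insert x Q. a \<noteq> a' \<longrightarrow> W a \<inter> W a' = {})"
    using Q x(1) by (auto simp: Int_commute)
  then show ?case by blast
qed

text \<open>The value at 0 is prescribed because \<open>LS 3\<close> is attached only to labels of
  index 0.\<close>

lemma inj_enumeration_from:
  assumes "finite I" "e \<in> I" "q \<le> card I"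
  shows "\<exists>h. inj_on h {..<q} \<and> h ` {..<q} \<subseteq> I \<and> (0 < q \<longrightarrow> h 0 = e)"
proof -
  obtain h where h: "bij_betw h {0..<card (I - {e})} (I - {e})"
    using ex_bij_betw_nat_finite[of "I - {e}"] assms(1) by auto
  let ?h = "\<lambda>i. if i = 0 then e else h (i - 1)"
  have c: "card (I - {e}) = card I - 1" using assms by simp
  have m: "h (i - 1) \<in> I - {e}" if "i < q" "i \<noteq> 0" for i
  proof -
    have "i - 1 \<in> {0..<card (I - {e})}" using that c assms(3) by simp
    then show ?thesis using h unfolding bij_betw_def by blast
  qed
  have "inj_on ?h {..<q}"
  proof (rule linorder_inj_onI')
    fix i j assume ij: "i \<in> {..<q}" "j \<in> {..<q}" "i < j"
    show "?h i \<noteq> ?h j"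
    proof (cases "i = 0")
      case True then show ?thesis using m[of j] ij by auto
    next
      case False
      have "h (i - 1) \<noteq> h (j - 1)"
        using h ij False c assms(3) unfolding bij_betw_def inj_on_def by force
      then show ?thesis using False ij by simp
    qed
  qed
  moreover have "?h ` {..<q} \<subseteq> I" using m assms(2) by auto
  ultimately show ?thesis by (intro exI[of _ ?h]) simp
qed

lemma inj_enumeration:
  assumes "finite I" "q \<le> card I"
  shows "\<exists>h. inj_on h {..<q::nat} \<and> h ` {..<q} \<subseteq> I"
proof (cases "I = {}")
  case True
  then show ?thesis using assms by simp
next
  case False
  then show ?thesis using inj_enumeration_from assms by (metis all_not_in_conv)
qed

lemma labels_insert:
  "labels q d x x2 y (insert i S) = insert (LS i) (labels q d x x2 y S)"
  by (auto simp: labels_def split: label.splits)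

lemma hosts_insert:
  assumes h: "hosts E g L" and "p \<notin> L" "z \<notin> g ` L" "\<not> ladj p p"
    and E: "\<And>p'. p' \<in> L \<Longrightarrow> sladj p p' \<Longrightarrow> {z, g p'} \<in> E"
  shows "hosts E (g(p := z)) (insert p L)"
proof -
  have "inj_on (g(p := z)) (insert p L)"
    using h assms(2,3) unfolding hosts_def inj_on_def by auto
  moreover have "{(g(p := z)) p1, (g(p := z)) p2} \<in> E"
    if pp: "p1 \<in> insert p L" "p2 \<in> insert p L" "ladj p1 p2" for p1 p2
  proof -
    consider "p1 = p" "p2 = p" | "p1 = p" "p2 \<noteq> p" "p2 \<in> L" | "p2 = p" "p1 \<noteq> p" "p1 \<in> L"
      | "p1 \<noteq> p" "p2 \<noteq> p" "p1 \<in> L" "p2 \<in> L" using pp(1,2) by auto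
    then show ?thesis
    proof cases
      case 1 then show ?thesis using pp assms(4) by simp
    next
      case 2 then show ?thesis using pp E by simp
    next
      case 3 then show ?thesis using pp E[of p1] by (simp add: insert_commute)
    next
      case 4 then show ?thesis using pp h unfolding hosts_def by simp
    qed
  qed
  ultimately show ?thesis unfolding hosts_def by blast
qed

section \<open>Host graphs inside a block\<close>

context ugraph
begin

text \<open>Adjacent labels get distinct vertices for free, as there are no loops; only nonadjacent
  labels have to be compared.\<close>

lemma hostsI:
  assumes "\<And>p q. p \<in> L \<Longrightarrow> q \<in> L \<Longrightarrow> ladj p q \<Longrightarrow> {g p, g q} \<in> E"
    and "\<And>p q. p \<in> L \<Longrightarrow> q \<in> L \<Longrightarrow> p \<noteq> q \<Longrightarrow> \<not> sladj p q \<Longrightarrow> g p \<noteq> g q"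
  shows "hosts E g L"
proof -
  have "inj_on g L"
  proof (rule inj_onI)
    fix p q assume "p \<in> L" "q \<in> L" "g p = g q"
    then show "p = q" using assms edge_neq by metis
  qed
  then show ?thesis using assms(1) unfolding hosts_def by blast
qed

lemma hosts_family:
  assumes ab: "\<And>i j. i < q \<Longrightarrow> j < q \<Longrightarrow> {a i, b j} \<in> E"
    and da: "\<And>i j. i < d \<Longrightarrow> j < q \<Longrightarrow> {\<delta> i, a j} \<in> E"
    and db: "\<And>i j. i < d \<Longrightarrow> j < q \<Longrightarrow> {\<delta> i, b j} \<in> E"
    and inj: "inj_on a {..<q}" "inj_on b {..<q}" "inj_on \<delta> {..<d}"
    and x: "\<And>i. X \<Longrightarrow> i < q \<Longrightarrow> {x i, a i} \<in> E"
    and xb: "\<And>i j. X \<Longrightarrow> i < q \<Longrightarrow> j < q \<Longrightarrow> {x i, b j} \<in> E"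
    and xd: "\<And>i j. X \<Longrightarrow> i < q \<Longrightarrow> j < d \<Longrightarrow> x i \<noteq> \<delta> j"
    and xx: "\<And>i j. X \<Longrightarrow> i < q \<Longrightarrow> j < q \<Longrightarrow> i \<noteq> j \<Longrightarrow> x i \<noteq> x j \<and> x i \<noteq> a j"
    and x2: "\<And>i. X2 \<Longrightarrow> i < q \<Longrightarrow> {x2 i, a i} \<in> E"
    and x2b: "\<And>i j. X2 \<Longrightarrow> i < q \<Longrightarrow> j < q \<Longrightarrow> {x2 i, b j} \<in> E"
    and x2d: "\<And>i j. X2 \<Longrightarrow> i < q \<Longrightarrow> j < d \<Longrightarrow> x2 i \<noteq> \<delta> j"
    and x2x2: "\<And>i j. X2 \<Longrightarrow> i < q \<Longrightarrow> j < q \<Longrightarrow> i \<noteq> j \<Longrightarrow> x2 i \<noteq> x2 j \<and> x2 i \<noteq> a j"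
    and xx2: "\<And>i j. X2 \<Longrightarrow> i < q \<Longrightarrow> j < q \<Longrightarrow> x i \<noteq> x2 j"
    and y: "\<And>i. Y \<Longrightarrow> i < q \<Longrightarrow> {y i, b i} \<in> E"
    and ya: "\<And>i j. Y \<Longrightarrow> i < q \<Longrightarrow> j < q \<Longrightarrow> {y i, a j} \<in> E"
    and yd: "\<And>i j. Y \<Longrightarrow> i < q \<Longrightarrow> j < d \<Longrightarrow> y i \<noteq> \<delta> j"
    and yy: "\<And>i j. Y \<Longrightarrow> i < q \<Longrightarrow> j < q \<Longrightarrow> i \<noteq> j \<Longrightarrow> y i \<noteq> y j \<and> y i \<noteq> b j"
    and xy: "\<And>i j. X \<Longrightarrow> Y \<Longrightarrow> i < q \<Longrightarrow> j < q \<Longrightarrow> x i \<noteq> y j \<and> (X2 \<longrightarrow> x2 i \<noteq> y j)"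
    and X2: "X2 \<Longrightarrow> X"
  shows "hosts E (case_label a b \<delta> x x2 y \<sigma>) (labels q d X X2 Y {})"
proof (rule hostsI)
  fix p p' assume "p \<in> labels q d X X2 Y {}" "p' \<in> labels q d X X2 Y {}" "ladj p p'"
  then show "{case_label a b \<delta> x x2 y \<sigma> p, case_label a b \<delta> x x2 y \<sigma> p'} \<in> E"
    by (cases p; cases p') (simp_all add: ab da db x xb x2 x2b y ya)
next
  fix p p' assume *: "p \<in> labels q d X X2 Y {}" "p' \<in> labels q d X X2 Y {}" "p \<noteq> p'" "\<not> sladj p p'"
  show "case_label a b \<delta> x x2 y \<sigma> p \<noteq> case_label a b \<delta> x x2 y \<sigma> p'"
    using * inj[THEN inj_on_eq_iff]
    by (cases p; cases p')
      (simp_all add: xd xx x2d x2x2 xx2 yd yy xy X2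
        xd[THEN not_sym] xx[THEN conjunct1, THEN not_sym] xx[THEN conjunct2, THEN not_sym] x2d[THEN not_sym]
        x2x2[THEN conjunct1, THEN not_sym] x2x2[THEN conjunct2, THEN not_sym] xx2[THEN not_sym]
        yd[THEN not_sym] yy[THEN conjunct1, THEN not_sym] yy[THEN conjunct2, THEN not_sym]
        xy[THEN conjunct1, THEN not_sym] xy[THEN conjunct2, THEN mp, THEN not_sym])
qed

text \<open>If the sets chosen for \<open>a\<close> and \<open>a'\<close> meet, then
  \<open>a'\<close> equals or is adjacent to one of the three vertices chosen for \<open>a\<close>.
  These are typical, so each accounts for at most \<open>r\<close> conflicts. For
  \<open>c = 1\<close> the two partners may coincide.\<close>

lemma select_partners:
  assumes b: "block M d A B D" and ne: "nonext r A B D" and R: "R + r \<le> M"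
    and m: "many N c D R A B" and c: "1 \<le> c" and N: "q * (3 * r) < N"
  shows "\<exists>a x x2. (\<forall>i<q. a i \<in> A \<and> x i \<in> nbrs (a i) \<inter> typical D R B \<and>
      x2 i \<in> nbrs (a i) \<inter> typical D R B \<and> (2 \<le> c \<longrightarrow> x i \<noteq> x2 i)) \<and>
    (\<forall>i<q. \<forall>j<q. i \<noteq> j \<longrightarrow> {a i, x i, x2 i} \<inter> {a j, x j, x2 j} = {})"
proof -
  let ?T = "typical D R B"
  define S where "S = {a \<in> A. c \<le> card (nbrs a \<inter> ?T)}"
  have fin: "finite A" "finite S" using block_fin[OF b] by (auto simp: S_def)
  have "\<exists>x x2. x \<in> nbrs a \<inter> ?T \<and> x2 \<in> nbrs a \<inter> ?T \<and> (2 \<le> c \<longrightarrow> x \<noteq> x2)" if "a \<in> S" for a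
  proof (cases "2 \<le> c")
    case True
    then have "2 \<le> card (nbrs a \<inter> ?T)" using that by (simp add: S_def)
    then obtain Z where "Z \<subseteq> nbrs a \<inter> ?T" "card Z = 2" by (rule obtain_subset_with_card_n) blast
    then show ?thesis by (metis card_2_iff insert_subset)
  next
    case False
    have "1 \<le> card (nbrs a \<inter> ?T)" using that c by (simp add: S_def)
    then obtain x where "x \<in> nbrs a \<inter> ?T" by (metis card.empty equals0I not_one_le_zero)
    then show ?thesis using False by blast
  qed
  then obtain \<xi> \<xi>2 where \<xi>: "\<And>a. a \<in> S \<Longrightarrow> \<xi> a \<in> nbrs a \<inter> ?T \<and> \<xi>2 a \<in> nbrs a \<inter> ?T \<and> (2 \<le> c \<longrightarrow> \<xi> a \<noteq> \<xi>2 a)"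
    by metis
  define W where "W a = {a, \<xi> a, \<xi>2 a}" for a
  have WT: "W a \<subseteq> ?T" if "a \<in> S" for a
    using \<xi>[OF that] that block_subset_typical[OF b, of R] by (auto simp: W_def S_def)
  have conf: "card {a' \<in> S. W a \<inter> W a' \<noteq> {}} \<le> 3 * r" if a: "a \<in> S" for a
  proof -
    have "{a' \<in> S. W a \<inter> W a' \<noteq> {}} \<subseteq> (\<Union>v\<in>W a. insert v (nbrs v \<inter> A))"
    proof
      fix a' assume "a' \<in> {a' \<in> S. W a \<inter> W a' \<noteq> {}}"
      then obtain v where v: "a' \<in> S" "v \<in> W a" "v \<in> W a'" by blast
      then have "a' = v \<or> v \<in> nbrs a'" using \<xi>[OF v(1)] by (auto simp: W_def)
      then have "a' \<in> insert v (nbrs v \<inter> A)" using v(1) nbrs_sym by (auto simp: S_def)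
      then show "a' \<in> (\<Union>v\<in>W a. insert v (nbrs v \<inter> A))" using v(2) by blast
    qed
    then have "card {a' \<in> S. W a \<inter> W a' \<noteq> {}} \<le> card (\<Union>v\<in>W a. insert v (nbrs v \<inter> A))"
      using fin by (intro card_mono) (auto simp: W_def)
    also have "\<dots> \<le> (\<Sum>v\<in>W a. card (insert v (nbrs v \<inter> A)))"
      by (rule card_UN_le) (simp add: W_def)
    also have "\<dots> \<le> (\<Sum>v\<in>W a. r)"
    proof (rule sum_mono)
      fix v assume "v \<in> W a"
      then have "card (nbrs v \<inter> A) < r" using typical_few(1)[OF b ne R] WT[OF a] by blast
      then show "card (insert v (nbrs v \<inter> A)) \<le> r"
        using fin by (metis Suc_leI card_insert_le_m1 card_insert_if finite_Int le_SucI less_imp_le_nat)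
    qed
    also have "\<dots> \<le> 3 * r"
      by (simp add: W_def card_insert_if)
    finally show ?thesis .
  qed
  have "N \<le> card S" using m by (simp add: many_def S_def)
  then have "\<exists>Q\<subseteq>S. finite Q \<and> card Q = q \<and> (\<forall>a\<in>Q. \<forall>a'\<in>Q. a \<noteq> a' \<longrightarrow> W a \<inter> W a' = {})"
    using conf fin N by (intro disjoint_selection[of S W "3 * r"]) (auto simp: W_def)
  then obtain Q where Q: "Q \<subseteq> S" "finite Q" "card Q = q"
      "\<And>a a'. a \<in> Q \<Longrightarrow> a' \<in> Q \<Longrightarrow> a \<noteq> a' \<Longrightarrow> W a \<inter> W a' = {}" by blast
  obtain a where a: "inj_on a {..<q}" "a ` {..<q} \<subseteq> Q"
    using inj_enumeration[of Q q] Q by blast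
  have aQ: "a i \<in> Q" if "i < q" for i using a that by blast
  have "W (a i) \<inter> W (a j) = {}" if "i < q" "j < q" "i \<noteq> j" for i j
  proof -
    have "a i \<noteq> a j" using a(1) that by (auto simp: inj_on_def)
    then show ?thesis using Q(4) aQ that by blast
  qed
  moreover have "a i \<in> A \<and> \<xi> (a i) \<in> nbrs (a i) \<inter> ?T \<and> \<xi>2 (a i) \<in> nbrs (a i) \<inter> ?T \<and>
      (2 \<le> c \<longrightarrow> \<xi> (a i) \<noteq> \<xi>2 (a i))" if "i < q" for i
    using \<xi>[of "a i"] aQ[OF that] Q(1) by (auto simp: S_def)
  ultimately show ?thesis
    by (intro exI[of _ a] exI[of _ "\<lambda>i. \<xi> (a i)"] exI[of _ "\<lambda>i. \<xi>2 (a i)"]) (simp add: W_def)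
qed

lemma common_typical_nbrs:
  assumes b: "block M d A B D" and "finite T" "T \<subseteq> typical D R B"
  shows "M \<le> card {b \<in> B. \<forall>v\<in>T. b \<in> nbrs v} + card T * R"
proof -
  have fin: "finite B" using block_fin[OF b] by simp
  have "card B \<le> card ({b \<in> B. \<forall>v\<in>T. b \<in> nbrs v} \<union> (\<Union>v\<in>T. B - nbrs v))"
    using fin assms(2) by (intro card_mono) auto
  also have "\<dots> \<le> card {b \<in> B. \<forall>v\<in>T. b \<in> nbrs v} + card (\<Union>v\<in>T. B - nbrs v)"
    by (rule card_Un_le)
  also have "card (\<Union>v\<in>T. B - nbrs v) \<le> (\<Sum>v\<in>T. card (B - nbrs v))"
    using assms(2) by (rule card_UN_le)
  also have "\<dots> \<le> (\<Sum>v\<in>T. R)"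
    using assms(3) by (intro sum_mono) (auto simp: typical_def)
  finally show ?thesis using b by (simp add: block_def)
qed

lemma enumerate_dominating:
  assumes "block M d A B D"
  shows "\<exists>\<delta>. inj_on \<delta> {..<d} \<and> \<delta> ` {..<d} \<subseteq> D"
  using inj_enumeration[of D d] block_fin[OF assms] assms by (auto simp: block_def)

text \<open>The partners miss at most \<open>2 * q * R\<close> vertices of \<open>B\<close>
  altogether, so \<open>B\<close> still contains \<open>q\<close> vertices joined to all of
  them.\<close>

lemma one_sided_host:
  assumes b: "block M d A B D" and ne: "nonext r A B D" and R: "R + r \<le> M"
    and m: "many N c D R A B" and c: "1 \<le> c" and N: "q * (3 * r) < N"
    and M: "q + 2 * q * R \<le> M"
  shows "\<exists>g. hosts E g (labels q d True (2 \<le> c) False {})"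
proof -
  obtain a x x2 where ax: "\<And>i. i < q \<Longrightarrow> a i \<in> A \<and> x i \<in> nbrs (a i) \<inter> typical D R B \<and>
      x2 i \<in> nbrs (a i) \<inter> typical D R B \<and> (2 \<le> c \<longrightarrow> x i \<noteq> x2 i)"
    and dis: "\<And>i j. i < q \<Longrightarrow> j < q \<Longrightarrow> i \<noteq> j \<Longrightarrow> {a i, x i, x2 i} \<inter> {a j, x j, x2 j} = {}"
    using select_partners[OF b ne R m c N] by metis
  define T where "T = x ` {..<q} \<union> x2 ` {..<q}"
  have cT: "card T \<le> 2 * q"
    unfolding T_def using card_Un_le[of "x ` {..<q}" "x2 ` {..<q}"]
      card_image_le[of "{..<q}" x] card_image_le[of "{..<q}" x2] by simp
  have "M \<le> card {b \<in> B. \<forall>v\<in>T. b \<in> nbrs v} + card T * R"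
    using ax by (intro common_typical_nbrs[OF b]) (auto simp: T_def)
  moreover have "card T * R \<le> 2 * q * R" using cT by simp
  ultimately have "q \<le> card {b \<in> B. \<forall>v\<in>T. b \<in> nbrs v}" using M by linarith
  then obtain \<beta> where \<beta>: "inj_on \<beta> {..<q}" "\<beta> ` {..<q} \<subseteq> {b \<in> B. \<forall>v\<in>T. b \<in> nbrs v}"
    using inj_enumeration[of "{b \<in> B. \<forall>v\<in>T. b \<in> nbrs v}" q] block_fin[OF b] by auto
  have \<beta>i: "\<beta> i \<in> B" "\<And>v. v \<in> T \<Longrightarrow> {v, \<beta> i} \<in> E" if "i < q" for i
    using \<beta>(2) that by (auto simp: nbrs_def)
  obtain \<delta> where \<delta>: "inj_on \<delta> {..<d}" "\<delta> ` {..<d} \<subseteq> D" using enumerate_dominating[OF b] by blast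
  have \<delta>i: "\<delta> i \<in> D" if "i < d" for i using \<delta> that by blast
  have "hosts E (case_label a \<beta> \<delta> x x2 undefined undefined) (labels q d True (2 \<le> c) False {})"
  proof (rule hosts_family)
    fix i j
    show "{a i, \<beta> j} \<in> E" if "i < q" "j < q"
      using b ax[OF that(1)] \<beta>i[OF that(2)] by (auto simp: block_def joined_def)
    show "{\<delta> i, a j} \<in> E" if "i < d" "j < q"
      using b ax[OF that(2)] \<delta>i[OF that(1)] by (auto simp: block_def joined_def)
    show "{\<delta> i, \<beta> j} \<in> E" if "i < d" "j < q"
      using b \<beta>i[OF that(2)] \<delta>i[OF that(1)] by (auto simp: block_def joined_def)
    show "inj_on a {..<q}" using dis unfolding inj_on_def by blast
    show "{x i, a i} \<in> E" if "i < q" using ax[OF that] by (auto simp: nbrs_def insert_commute)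
    show "{x2 i, a i} \<in> E" if "i < q" using ax[OF that] by (auto simp: nbrs_def insert_commute)
    show "{x i, \<beta> j} \<in> E" if "i < q" "j < q" using \<beta>i(2)[OF that(2)] that(1) by (auto simp: T_def)
    show "{x2 i, \<beta> j} \<in> E" if "i < q" "j < q" using \<beta>i(2)[OF that(2)] that(1) by (auto simp: T_def)
    show "x i \<noteq> \<delta> j" if "i < q" "j < d" using ax[OF that(1)] \<delta>i[OF that(2)] by (auto simp: typical_def)
    show "x2 i \<noteq> \<delta> j" if "i < q" "j < d" using ax[OF that(1)] \<delta>i[OF that(2)] by (auto simp: typical_def)
    show "x i \<noteq> x j \<and> x i \<noteq> a j" if "i < q" "j < q" "i \<noteq> j" using dis[OF that] by blast
    show "x2 i \<noteq> x2 j \<and> x2 i \<noteq> a j" if "i < q" "j < q" "i \<noteq> j" using dis[OF that] by blast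
    show "x i \<noteq> x2 j" if "2 \<le> c" "i < q" "j < q"
    proof (cases "i = j")
      case True then show ?thesis using ax that by blast
    next
      case False then show ?thesis using dis[OF that(2,3)] by blast
    qed
  qed (use \<beta> \<delta> in auto)
  then show ?thesis by blast
qed

text \<open>One cherry more than needed is selected, because the additional common neighbour
  \<open>z\<close> of \<open>x 0\<close> and \<open>b0\<close> may lie in one of them; that one is
  dropped.\<close>

lemma triangle_host:
  assumes b: "block M 0 A B {}" and ne: "nonext r A B {}" and R: "R + r \<le> M"
    and m: "many N 2 {} R A B" and N: "(q + 1) * (3 * r) < N"
    and M: "q + 2 + 2 * (q + 1) * R \<le> M" and g: "good s M'" "1 \<le> M'" "3 \<le> s"
  shows "\<exists>g. hosts E g (labels q 0 True True False {3})"
proof -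
  have c: "(1::nat) \<le> 2" by simp
  obtain a x x2 where ax: "\<And>i. i < q + 1 \<Longrightarrow> a i \<in> A \<and> x i \<in> nbrs (a i) \<inter> typical {} R B \<and>
      x2 i \<in> nbrs (a i) \<inter> typical {} R B \<and> x i \<noteq> x2 i"
    and dis: "\<And>i j. i < q + 1 \<Longrightarrow> j < q + 1 \<Longrightarrow> i \<noteq> j \<Longrightarrow> {a i, x i, x2 i} \<inter> {a j, x j, x2 j} = {}"
    using select_partners[OF b ne R m c N] by (metis order_refl)
  define T where "T = x ` {..<q+1} \<union> x2 ` {..<q+1}"
  define C where "C = {b \<in> B. \<forall>v\<in>T. b \<in> nbrs v}"
  have cT: "card T \<le> 2 * (q + 1)"
    unfolding T_def using card_Un_le[of "x ` {..<q+1}" "x2 ` {..<q+1}"]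
      card_image_le[of "{..<q+1}" x] card_image_le[of "{..<q+1}" x2] by simp
  have "M \<le> card C + card T * R"
    unfolding C_def using ax by (intro common_typical_nbrs[OF b]) (auto simp: T_def)
  moreover have "card T * R \<le> 2 * (q + 1) * R" using cT by (rule mult_le_mono1)
  ultimately have C: "q + 2 \<le> card C" using M by linarith
  have finC: "finite C" using block_fin[OF b] by (simp add: C_def)
  obtain b0 where b0: "b0 \<in> C" using C by fastforce
  have Ci: "{v, b} \<in> E" if "b \<in> C" "v \<in> T" for v b using that by (auto simp: C_def nbrs_def)
  have "{x 0, b0} \<in> E" using Ci[OF b0] by (simp add: T_def)
  \<comment> \<open>Three common neighbours are enough to avoid both \<open>a 0\<close> and
    \<open>x2 0\<close>, so the cherry with index 0 is never the dropped one.\<close>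
  then have "3 \<le> card (nbrs (x 0) \<inter> nbrs b0)"
    using common_nbrs_bound(2)[OF g(1,2)] g(3) order_trans by blast
  moreover have "card {a 0, x2 0} \<le> 2" by (simp add: card_insert_if)
  ultimately have "\<not> nbrs (x 0) \<inter> nbrs b0 \<subseteq> {a 0, x2 0}"
    using card_mono[of "{a 0, x2 0}" "nbrs (x 0) \<inter> nbrs b0"] by fastforce
  then obtain z where z: "z \<in> nbrs (x 0)" "z \<in> nbrs b0" "z \<noteq> a 0" "z \<noteq> x2 0" by blast
  have zx: "z \<noteq> x 0" "z \<noteq> b0" using z not_in_nbrs by auto
  define I where "I = {i. i < q + 1 \<and> z \<notin> {a i, x i, x2 i}}"
  have "\<exists>i. {i. i < q + 1} - I \<subseteq> {i}"
  proof (cases "\<exists>i. i < q + 1 \<and> z \<in> {a i, x i, x2 i}")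
    case True
    then obtain i where i: "i < q + 1" "z \<in> {a i, x i, x2 i}" by blast
    have "j = i" if "j < q + 1" "z \<in> {a j, x j, x2 j}" for j
      using dis[OF i(1) that(1)] i(2) that(2) by blast
    then show ?thesis unfolding I_def by blast
  next
    case False then show ?thesis unfolding I_def by blast
  qed
  then obtain i1 where i1: "{i. i < q + 1} - I \<subseteq> {i1}" by blast
  have "card {i. i < q + 1} \<le> card (I \<union> {i1})"
    using i1 by (intro card_mono) (auto simp: I_def)
  also have "\<dots> \<le> card I + 1" using card_Un_le[of I "{i1}"] by simp
  finally have "q \<le> card I" by simp
  moreover have "0 \<in> I" using z zx by (simp add: I_def)
  moreover have "finite I" by (simp add: I_def)
  ultimately obtain \<iota> where \<iota>: "inj_on \<iota> {..<q}" "\<iota> ` {..<q} \<subseteq> I" "0 < q \<longrightarrow> \<iota> 0 = 0"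
    using inj_enumeration_from[of I 0 q] by blast
  have \<iota>i: "\<iota> i < q + 1" "z \<notin> {a (\<iota> i), x (\<iota> i), x2 (\<iota> i)}" if "i < q" for i
    using \<iota>(2) that by (auto simp: I_def)
  have \<iota>ne: "\<iota> i \<noteq> \<iota> j" if "i < q" "j < q" "i \<noteq> j" for i j
    using \<iota>(1) that by (auto simp: inj_on_def)
  have "card (C - {z}) \<ge> q" using C finC card_Diff1_le[of C z] by (auto simp: card_Diff_singleton_if)
  then obtain \<beta> where \<beta>: "inj_on \<beta> {..<q}" "\<beta> ` {..<q} \<subseteq> C - {z}" "0 < q \<longrightarrow> \<beta> 0 = b0"
    using inj_enumeration_from[of "C - {z}" b0 q] finC b0 zx by blast
  have \<beta>i: "\<beta> i \<in> C" "\<beta> i \<in> B" "\<beta> i \<noteq> z" if "i < q" for i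
    using \<beta>(2) that by (auto simp: C_def)
  let ?g = "case_label (a \<circ> \<iota>) \<beta> undefined (x \<circ> \<iota>) (x2 \<circ> \<iota>) undefined undefined"
  have h: "hosts E ?g (labels q 0 True True False {})"
  proof (rule hosts_family)
    fix i j
    show "{(a \<circ> \<iota>) i, \<beta> j} \<in> E" if "i < q" "j < q"
      using b ax[OF \<iota>i(1)[OF that(1)]] \<beta>i[OF that(2)] by (auto simp: block_def joined_def)
    show "inj_on (a \<circ> \<iota>) {..<q}"
    proof (rule inj_onI)
      fix i j assume "i \<in> {..<q}" "j \<in> {..<q}" "(a \<circ> \<iota>) i = (a \<circ> \<iota>) j"
      then show "i = j" using dis[OF \<iota>i(1) \<iota>i(1), of i j] \<iota>ne[of i j] by auto
    qed
    show "{(x \<circ> \<iota>) i, (a \<circ> \<iota>) i} \<in> E" if "i < q"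
      using ax[OF \<iota>i(1)[OF that]] by (auto simp: nbrs_def insert_commute)
    show "{(x2 \<circ> \<iota>) i, (a \<circ> \<iota>) i} \<in> E" if "i < q"
      using ax[OF \<iota>i(1)[OF that]] by (auto simp: nbrs_def insert_commute)
    show "{(x \<circ> \<iota>) i, \<beta> j} \<in> E" if "i < q" "j < q"
      using Ci[OF \<beta>i(1)[OF that(2)]] \<iota>i(1)[OF that(1)] by (simp add: T_def)
    show "{(x2 \<circ> \<iota>) i, \<beta> j} \<in> E" if "i < q" "j < q"
      using Ci[OF \<beta>i(1)[OF that(2)]] \<iota>i(1)[OF that(1)] by (simp add: T_def)
    show "(x \<circ> \<iota>) i \<noteq> (x \<circ> \<iota>) j \<and> (x \<circ> \<iota>) i \<noteq> (a \<circ> \<iota>) j" if "i < q" "j < q" "i \<noteq> j"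
      using dis[OF \<iota>i(1)[OF that(1)] \<iota>i(1)[OF that(2)] \<iota>ne[OF that]] by auto
    show "(x2 \<circ> \<iota>) i \<noteq> (x2 \<circ> \<iota>) j \<and> (x2 \<circ> \<iota>) i \<noteq> (a \<circ> \<iota>) j" if "i < q" "j < q" "i \<noteq> j"
      using dis[OF \<iota>i(1)[OF that(1)] \<iota>i(1)[OF that(2)] \<iota>ne[OF that]] by auto
    show "(x \<circ> \<iota>) i \<noteq> (x2 \<circ> \<iota>) j" if "i < q" "j < q"
    proof (cases "i = j")
      case True then show ?thesis using ax[OF \<iota>i(1)[OF that(1)]] by auto
    next
      case False then show ?thesis
        using dis[OF \<iota>i(1)[OF that(1)] \<iota>i(1)[OF that(2)] \<iota>ne[OF that False]] by auto
    qed
  qed (use \<beta> in auto)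
  have "hosts E (?g(LS 3 := z)) (insert (LS 3) (labels q 0 True True False {}))"
  proof (rule hosts_insert[OF h])
    show "z \<notin> ?g ` labels q 0 True True False {}"
    proof
      assume "z \<in> ?g ` labels q 0 True True False {}"
      then obtain p where "p \<in> labels q 0 True True False {}" "z = ?g p" by blast
      then show False using \<iota>i(2) \<beta>i(3) by (cases p) auto
    qed
    fix p assume "p \<in> labels q 0 True True False {}" "sladj (LS 3) p"
    then show "{z, ?g p} \<in> E"
      using \<iota>(3) \<beta>(3) z by (cases p) (auto simp: nbrs_def insert_commute)
  qed auto
  then show ?thesis using labels_insert by metis
qed

text \<open>
  The hypothesis \<open>m2\<close> is about all sub-blocks, because the vertices of \<open>B\<close> with neighbours on
  their own side have to be found among the common neighbours of the partners chosen for \<open>A\<close>.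
\<close>

lemma two_sided_host:
  assumes b: "block M d A B D" and ne: "nonext r A B D"
    and m1: "many N1 1 D R1 A B"
    and m2: "\<And>A' B'. A' \<subseteq> A \<Longrightarrow> B' \<subseteq> B \<Longrightarrow> card A' = M2 \<Longrightarrow> card B' = M2 \<Longrightarrow> many N2 1 D R2 B' A'"
    and N1: "(q + q * R2) * (3 * r) < N1" and N2: "q * (3 * r) < N2"
    and M2: "R2 + r \<le> M2" "q + q * R2 \<le> M2"
    and M: "R1 + r \<le> M" "M2 + (q + q * R2) * R1 \<le> M"
  shows "\<exists>g. hosts E g (labels q d True False True {})"
proof -
  \<comment> \<open>Each of the \<open>q\<close> partners chosen later on the other side misses at
    most \<open>R2\<close> of the vertices \<open>a i\<close>, so \<open>q\<close> of the
    \<open>a i\<close> remain joined to all of them.\<close>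
  define q' where "q' = q + q * R2"
  have fin: "finite A" "finite B" using block_fin[OF b] by auto
  have cardAB: "card A = M" "card B = M" using b by (auto simp: block_def)
  obtain a x where ax: "\<And>i. i < q' \<Longrightarrow> a i \<in> A \<and> x i \<in> nbrs (a i) \<inter> typical D R1 B"
    and dis: "\<And>i j. i < q' \<Longrightarrow> j < q' \<Longrightarrow> i \<noteq> j \<Longrightarrow> {a i, x i} \<inter> {a j, x j} = {}"
  proof -
    obtain a x x2 where 1: "\<forall>i<q'. a i \<in> A \<and> x i \<in> nbrs (a i) \<inter> typical D R1 B \<and>
        x2 i \<in> nbrs (a i) \<inter> typical D R1 B \<and> (2 \<le> (1::nat) \<longrightarrow> x i \<noteq> x2 i)"
      and 2: "\<forall>i<q'. \<forall>j<q'. i \<noteq> j \<longrightarrow> {a i, x i, x2 i} \<inter> {a j, x j, x2 j} = {}"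
      using select_partners[OF b ne M(1) m1 order_refl N1] unfolding q'_def[symmetric] by (elim exE conjE)
    show thesis
    proof (rule that)
      show "a i \<in> A \<and> x i \<in> nbrs (a i) \<inter> typical D R1 B" if "i < q'" for i using 1 that by simp
      show "{a i, x i} \<inter> {a j, x j} = {}" if "i < q'" "j < q'" "i \<noteq> j" for i j
        using 2[rule_format, OF that] by blast
    qed
  qed
  define T where "T = x ` {..<q'}"
  have "card T \<le> q'" unfolding T_def using card_image_le[of "{..<q'}" x] by simp
  then have "card T * R1 \<le> q' * R1" by (rule mult_le_mono1)
  moreover have "M \<le> card {b \<in> B. \<forall>v\<in>T. b \<in> nbrs v} + card T * R1"
    using ax by (intro common_typical_nbrs[OF b]) (auto simp: T_def)
  ultimately have "M2 \<le> card {b \<in> B. \<forall>v\<in>T. b \<in> nbrs v}" using M(2) unfolding q'_def by linarith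
  from obtain_subset_with_card_n[OF this] obtain B1
    where B1: "B1 \<subseteq> {b \<in> B. \<forall>v\<in>T. b \<in> nbrs v}" "card B1 = M2" by blast
  have inja: "inj_on a {..<q'}" using dis unfolding inj_on_def by blast
  \<comment> \<open>\<open>A1\<close> has to contain all \<open>a i\<close>, so that being typical
    for \<open>A1\<close> limits how many of them a partner \<open>y j\<close> misses.\<close>
  have "\<exists>A1. a ` {..<q'} \<subseteq> A1 \<and> A1 \<subseteq> A \<and> card A1 = M2"
    using exists_subset_between[of "a ` {..<q'}" M2 A] ax fin cardAB M M2(2) card_image[OF inja]
    unfolding q'_def[symmetric] by (metis card_lessThan image_subsetI le_add1 lessThan_iff order_trans)
  then obtain A1 where A1: "a ` {..<q'} \<subseteq> A1" "A1 \<subseteq> A" "card A1 = M2" by blast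
  have subB1: "B1 \<subseteq> B" using B1 by blast
  have b1: "block M2 d B1 A1 D"
    using block_sym[OF block_mono[OF b A1(2) subB1 A1(3) B1(2)]] .
  have ne1: "nonext r B1 A1 D"
    using nonext_sym[OF nonext_mono[OF ne A1(2) subB1 fin]] .
  have mm: "many N2 1 D R2 B1 A1" using m2 A1 subB1 B1(2) by blast
  obtain \<beta> y where by0: "\<And>i. i < q \<Longrightarrow> \<beta> i \<in> B1 \<and> y i \<in> nbrs (\<beta> i) \<inter> typical D R2 A1"
    and disy: "\<And>i j. i < q \<Longrightarrow> j < q \<Longrightarrow> i \<noteq> j \<Longrightarrow> {\<beta> i, y i} \<inter> {\<beta> j, y j} = {}"
  proof -
    obtain \<beta> y x2 where 1: "\<forall>i<q. \<beta> i \<in> B1 \<and> y i \<in> nbrs (\<beta> i) \<inter> typical D R2 A1 \<and>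
        x2 i \<in> nbrs (\<beta> i) \<inter> typical D R2 A1 \<and> (2 \<le> (1::nat) \<longrightarrow> y i \<noteq> x2 i)"
      and 2: "\<forall>i<q. \<forall>j<q. i \<noteq> j \<longrightarrow> {\<beta> i, y i, x2 i} \<inter> {\<beta> j, y j, x2 j} = {}"
      using select_partners[OF b1 ne1 M2(1) mm order_refl N2] by (elim exE conjE)
    show thesis
    proof (rule that)
      show "\<beta> i \<in> B1 \<and> y i \<in> nbrs (\<beta> i) \<inter> typical D R2 A1" if "i < q" for i using 1 that by simp
      show "{\<beta> i, y i} \<inter> {\<beta> j, y j} = {}" if "i < q" "j < q" "i \<noteq> j" for i j
        using 2[rule_format, OF that] by blast
    qed
  qed
  define I where "I = {i. i < q' \<and> (\<forall>j<q. a i \<in> nbrs (y j))}"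
  have "{..<q'} \<subseteq> I \<union> (\<Union>j<q. {i. i < q' \<and> a i \<notin> nbrs (y j)})" by (auto simp: I_def)
  then have "card {..<q'} \<le> card (I \<union> (\<Union>j<q. {i. i < q' \<and> a i \<notin> nbrs (y j)}))"
    by (intro card_mono) (auto simp: I_def)
  also have "\<dots> \<le> card I + card (\<Union>j<q. {i. i < q' \<and> a i \<notin> nbrs (y j)})" by (rule card_Un_le)
  also have "card (\<Union>j<q. {i. i < q' \<and> a i \<notin> nbrs (y j)}) \<le> (\<Sum>j<q. card {i. i < q' \<and> a i \<notin> nbrs (y j)})"
    by (rule card_UN_le) simp
  also have "\<dots> \<le> (\<Sum>j<q. R2)"
  proof (rule sum_mono)
    fix j assume j: "j \<in> {..<q}"
    have "card {i. i < q' \<and> a i \<notin> nbrs (y j)} = card (a ` {i. i < q' \<and> a i \<notin> nbrs (y j)})"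
      using inja by (intro card_image[symmetric]) (auto simp: inj_on_def)
    also have "\<dots> \<le> card (A1 - nbrs (y j))"
      using A1 fin by (intro card_mono) (auto intro: finite_subset)
    also have "\<dots> \<le> R2" using by0[of j] j by (auto simp: typical_def)
    finally show "card {i. i < q' \<and> a i \<notin> nbrs (y j)} \<le> R2" .
  qed
  finally have "q \<le> card I" by (simp add: q'_def)
  moreover have "finite I" by (simp add: I_def)
  ultimately obtain \<iota> where \<iota>: "inj_on \<iota> {..<q}" "\<iota> ` {..<q} \<subseteq> I"
    using inj_enumeration[of I q] by blast
  have \<iota>i: "\<iota> i < q'" "\<And>j. j < q \<Longrightarrow> a (\<iota> i) \<in> nbrs (y j)" if "i < q" for i
    using \<iota>(2) that by (auto simp: I_def)
  have \<iota>ne: "\<iota> i \<noteq> \<iota> j" if "i < q" "j < q" "i \<noteq> j" for i j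
    using \<iota>(1) that by (auto simp: inj_on_def)
  obtain \<delta> where \<delta>: "inj_on \<delta> {..<d}" "\<delta> ` {..<d} \<subseteq> D" using enumerate_dominating[OF b] by blast
  have \<delta>i: "\<delta> i \<in> D" if "i < d" for i using \<delta> that by blast
  have \<beta>i: "\<beta> i \<in> B" "\<And>j. j < q' \<Longrightarrow> {x j, \<beta> i} \<in> E" if "i < q" for i
    using by0[OF that] B1(1) by (auto simp: T_def nbrs_def)
  \<comment> \<open>The two kinds of partners behave oppositely towards \<open>A\<close>:
    \<open>x i\<close> has fewer than \<open>r\<close> neighbours there, \<open>y j\<close> at least
    \<open>r\<close>.\<close>
  have xy: "x i \<noteq> y j" if "i < q'" "j < q" for i j
  proof -
    have "card (nbrs (x i) \<inter> A) < r" using typical_few(1)[OF b ne M(1)] ax[OF that(1)] by blast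
    moreover have "r \<le> card (nbrs (y j) \<inter> A1)"
      using typical_few(2)[OF b1 ne1 M2(1)] by0[OF that(2)] by blast
    moreover have "card (nbrs (y j) \<inter> A1) \<le> card (nbrs (y j) \<inter> A)"
      using A1 fin by (intro card_mono) auto
    ultimately show ?thesis by auto
  qed
  have "hosts E (case_label (a \<circ> \<iota>) \<beta> \<delta> (x \<circ> \<iota>) undefined y undefined) (labels q d True False True {})"
  proof (rule hosts_family)
    fix i j
    show "{(a \<circ> \<iota>) i, \<beta> j} \<in> E" if "i < q" "j < q"
      using b ax[OF \<iota>i(1)[OF that(1)]] \<beta>i[OF that(2)] by (auto simp: block_def joined_def)
    show "{\<delta> i, (a \<circ> \<iota>) j} \<in> E" if "i < d" "j < q"
      using b ax[OF \<iota>i(1)[OF that(2)]] \<delta>i[OF that(1)] by (auto simp: block_def joined_def)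
    show "{\<delta> i, \<beta> j} \<in> E" if "i < d" "j < q"
      using b \<beta>i[OF that(2)] \<delta>i[OF that(1)] by (auto simp: block_def joined_def)
    show "inj_on (a \<circ> \<iota>) {..<q}"
    proof (rule inj_onI)
      fix i j assume "i \<in> {..<q}" "j \<in> {..<q}" "(a \<circ> \<iota>) i = (a \<circ> \<iota>) j"
      then show "i = j" using dis[OF \<iota>i(1) \<iota>i(1), of i j] \<iota>ne[of i j] by auto
    qed
    show "inj_on \<beta> {..<q}" using disy unfolding inj_on_def by blast
    show "{(x \<circ> \<iota>) i, (a \<circ> \<iota>) i} \<in> E" if "i < q"
      using ax[OF \<iota>i(1)[OF that]] by (auto simp: nbrs_def insert_commute)
    show "{(x \<circ> \<iota>) i, \<beta> j} \<in> E" if "i < q" "j < q"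
      using \<beta>i(2)[OF that(2) \<iota>i(1)[OF that(1)]] by simp
    show "(x \<circ> \<iota>) i \<noteq> \<delta> j" if "i < q" "j < d"
      using ax[OF \<iota>i(1)[OF that(1)]] \<delta>i[OF that(2)] by (auto simp: typical_def)
    show "(x \<circ> \<iota>) i \<noteq> (x \<circ> \<iota>) j \<and> (x \<circ> \<iota>) i \<noteq> (a \<circ> \<iota>) j" if "i < q" "j < q" "i \<noteq> j"
      using dis[OF \<iota>i(1)[OF that(1)] \<iota>i(1)[OF that(2)] \<iota>ne[OF that]] by auto
    show "{y i, \<beta> i} \<in> E" if "i < q" using by0[OF that] by (auto simp: nbrs_def insert_commute)
    show "{y i, (a \<circ> \<iota>) j} \<in> E" if "i < q" "j < q"
      using \<iota>i(2)[OF that(2,1)] by (simp add: nbrs_def)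
    show "y i \<noteq> \<delta> j" if "i < q" "j < d"
      using by0[OF that(1)] \<delta>i[OF that(2)] by (auto simp: typical_def)
    show "y i \<noteq> y j \<and> y i \<noteq> \<beta> j" if "i < q" "j < q" "i \<noteq> j" using disy[OF that] by blast
    show "(x \<circ> \<iota>) i \<noteq> y j \<and> (False \<longrightarrow> undefined i \<noteq> y j)" if "i < q" "j < q"
      using xy[OF \<iota>i(1)[OF that(1)] that(2)] by simp
  qed (use \<delta> in auto)
  then show ?thesis by blast
qed

text \<open>Besides \<open>u\<close>, also \<open>y\<close> and \<open>z\<close> may lie in
  \<open>A\<close> or \<open>B\<close>; three spare vertices per side absorb them.\<close>

lemma triangle_at_block_host:
  assumes b: "block p d A B D" and p: "q + 3 \<le> p" and u: "u \<in> B"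
    and yz: "y \<in> nbrs u - D" "z \<in> nbrs u - D" "{y, z} \<in> E"
  shows "\<exists>g. hosts E g (labels q d False False False {0, 1, 2})"
proof -
  have fin: "finite A" "finite B" using block_fin[OF b] by auto
  have cardAB: "card A = p" "card B = p" using b by (auto simp: block_def)
  have dj: "A \<inter> B = {}" "D \<inter> A = {}" "D \<inter> B = {}" using block_disjoint[OF b] by auto
  have "card {u, y, z} \<le> 3" by (simp add: card_insert_if)
  then have "q \<le> card (A - {u, y, z})" "q \<le> card (B - {u, y, z})"
    using fin cardAB p diff_card_le_card_Diff[of "{u, y, z}" A] diff_card_le_card_Diff[of "{u, y, z}" B]
    by auto
  then obtain a \<beta> where a: "inj_on a {..<q}" "a ` {..<q} \<subseteq> A - {u, y, z}"
    and \<beta>: "inj_on \<beta> {..<q}" "\<beta> ` {..<q} \<subseteq> B - {u, y, z}"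
    using inj_enumeration[of "A - {u, y, z}" q] inj_enumeration[of "B - {u, y, z}" q] fin by auto
  have ai: "a i \<in> A" "a i \<noteq> u" "a i \<noteq> y" "a i \<noteq> z" if "i < q" for i using a that by auto
  have \<beta>i: "\<beta> i \<in> B" "\<beta> i \<noteq> u" "\<beta> i \<noteq> y" "\<beta> i \<noteq> z" if "i < q" for i using \<beta> that by auto
  obtain \<delta> where \<delta>: "inj_on \<delta> {..<d}" "\<delta> ` {..<d} \<subseteq> D" using enumerate_dominating[OF b] by blast
  have \<delta>i: "\<delta> i \<in> D" if "i < d" for i using \<delta> that by blast
  let ?L = "labels q d False False False"
  let ?g = "case_label a \<beta> \<delta> undefined undefined undefined undefined"
  have E: "{v, w} \<in> E" if "v \<in> A \<and> w \<in> B \<or> v \<in> D \<and> w \<in> A \<or> v \<in> D \<and> w \<in> B" for v w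
    using that b by (auto simp: block_def joined_def)
  have h0: "hosts E ?g (?L {})"
    by (rule hosts_family) (use a \<beta> \<delta> ai \<beta>i \<delta>i E in auto)
  have uD: "u \<notin> D" using u dj by blast
  have h1: "hosts E (?g(LS 0 := u)) (insert (LS 0) (?L {}))"
  proof (rule hosts_insert[OF h0])
    show "u \<notin> ?g ` ?L {}"
    proof
      assume "u \<in> ?g ` ?L {}"
      then obtain p where "p \<in> ?L {}" "u = ?g p" by blast
      then show False using ai(2)[THEN not_sym] \<beta>i(2)[THEN not_sym] \<delta>i uD by (cases p) auto
    qed
    fix p assume "p \<in> ?L {}" "sladj (LS 0) p"
    then show "{u, ?g p} \<in> E"
      using u ai \<delta>i E edge_sym by (cases p) auto
  qed auto
  then have h1: "hosts E (?g(LS 0 := u)) (?L {0})" by (simp only: labels_insert)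
  have neq: "u \<noteq> y" "u \<noteq> z" "y \<noteq> z" using yz not_in_nbrs edge_neq by auto
  have h2: "hosts E (?g(LS 0 := u, LS 1 := y)) (insert (LS 1) (?L {0}))"
  proof (rule hosts_insert[OF h1])
    show "y \<notin> (?g(LS 0 := u)) ` ?L {0}"
    proof
      assume "y \<in> (?g(LS 0 := u)) ` ?L {0}"
      then obtain p where "p \<in> ?L {0}" "y = (?g(LS 0 := u)) p" by blast
      then show False using ai(3)[THEN not_sym] \<beta>i(3)[THEN not_sym] \<delta>i yz neq by (cases p) auto
    qed
    fix p assume "p \<in> ?L {0}" "sladj (LS 1) p"
    then show "{y, (?g(LS 0 := u)) p} \<in> E"
      using yz by (cases p) (auto simp: nbrs_def insert_commute)
  qed auto
  then have h2: "hosts E (?g(LS 0 := u, LS 1 := y)) (?L {1, 0})" by (simp only: labels_insert)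
  have h3: "hosts E (?g(LS 0 := u, LS 1 := y, LS 2 := z)) (insert (LS 2) (?L {1, 0}))"
  proof (rule hosts_insert[OF h2])
    show "z \<notin> (?g(LS 0 := u, LS 1 := y)) ` ?L {1, 0}"
    proof
      assume "z \<in> (?g(LS 0 := u, LS 1 := y)) ` ?L {1, 0}"
      then obtain p where "p \<in> ?L {1, 0}" "z = (?g(LS 0 := u, LS 1 := y)) p" by blast
      then show False using ai(4)[THEN not_sym] \<beta>i(4)[THEN not_sym] \<delta>i yz neq by (cases p) auto
    qed
    fix p assume "p \<in> ?L {1, 0}" "sladj (LS 2) p"
    then show "{z, (?g(LS 0 := u, LS 1 := y)) p} \<in> E"
      using yz by (cases p) (auto simp: nbrs_def insert_commute)
  qed auto
  then have "hosts E (?g(LS 0 := u, LS 1 := y, LS 2 := z)) (?L {2, 1, 0})" by (simp only: labels_insert)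
  moreover have "{2, 1, 0} = {0, 1, 2 :: nat}" by auto
  ultimately show ?thesis by metis
qed

end

section \<open>Blocks in lollipop-free graphs\<close>

locale lollipop_free_graph = ugraph V E for V :: "'a set" and E +
  fixes k l s :: nat
  assumes k: "4 \<le> k" and l: "2 \<le> l" "even l" and s: "s = (k + l - 1) div 2"
    and lollipop_free: "\<not> (\<exists>v w. embeds k (k + l) E v w)"
begin

text \<open>Odd \<open>k\<close> is at least 5, which gives \<open>s \<ge> 3\<close>; the odd case
  without dominating vertices depends on this.\<close>

lemma parity_cases:
  obtains (even) "even k" "k + l = 2 * s + 2" "k \<le> 2 * s" "2 \<le> s"
  | (odd) "odd k" "k + l = 2 * s + 1" "k < 2 * s" "3 \<le> s"
proof (cases "even k")
  case True
  then have "k + l = 2 * s + 2 \<and> k \<le> 2 * s \<and> 2 \<le> s" using k l s by presburger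
  then show ?thesis using True even by blast
next
  case False
  then have "k + l = 2 * s + 1 \<and> k < 2 * s \<and> 3 \<le> s" using k l s by presburger
  then show ?thesis using False odd by blast
qed

lemma nbrs_block_independent:
  assumes b: "block p s A B D" and p: "2 * (k + l) + 3 \<le> p" and u: "u \<in> A \<union> B"
    and yz: "y \<in> nbrs u - D" "z \<in> nbrs u - D"
  shows "{y, z} \<notin> E"
proof
  assume E: "{y, z} \<in> E"
  obtain g where g: "hosts E g (labels (2 * (k + l)) s False False False {0, 1, 2})"
    using triangle_at_block_host[OF b p _ yz E] triangle_at_block_host[OF block_sym[OF b] p _ yz E] u
    by blast
  show False
  proof (cases rule: parity_cases)
    case even
    then show ?thesis using embeds_full_even[of E g s k] g k lollipop_free by simp
  next
    case odd
    then show ?thesis using embeds_full_odd[of E g s k] g k lollipop_free by simp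
  qed
qed

lemma bipartite_outside_block:
  assumes b: "block p s A B D" and p: "2 * (k + l) + 3 \<le> p" and g: "good s M" "1 \<le> M"
  shows "\<exists>P Q. P \<inter> Q = {} \<and> P \<union> Q = V - D \<and> (\<forall>y\<in>P. \<forall>z\<in>P. {y, z} \<notin> E) \<and> (\<forall>y\<in>Q. \<forall>z\<in>Q. {y, z} \<notin> E)"
proof -
  have sub: "A \<subseteq> V" "B \<subseteq> V" "D \<subseteq> V" "card A = p" "card B = p" "card D = s"
    "joined A B" "joined D A" "joined D B"
    using b by (auto simp: block_def)
  obtain a c where ac: "a \<in> A" "c \<in> B"
    using sub(4,5) p by (metis add_is_0 card.empty ex_in_conv le_zero_eq numeral_eq_iff zero_neq_numeral)
  then have E: "{a, c} \<in> E" using sub(7) by (simp add: joined_def)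
  have DN: "D \<subseteq> nbrs a" "D \<subseteq> nbrs c"
    using sub ac joined_nbrs joined_sym by blast+
  define P where "P = nbrs a - D"
  define Q where "Q = nbrs c - D"
  have ind: "\<forall>y\<in>P. \<forall>z\<in>P. {y, z} \<notin> E" "\<forall>y\<in>Q. \<forall>z\<in>Q. {y, z} \<notin> E"
    using nbrs_block_independent[OF b p] ac unfolding P_def Q_def by blast+
  have cP: "a \<notin> D" "c \<notin> D" using block_disjoint[OF b] ac by auto
  \<comment> \<open>\<open>c\<close> lies in \<open>P\<close>, so a common element \<open>y\<close>
    would give the edge \<open>{c, y}\<close> inside the independent set \<open>P\<close>.\<close>
  have dj: "P \<inter> Q = {}"
  proof (rule ccontr)
    assume "P \<inter> Q \<noteq> {}"
    then obtain y where "y \<in> P" "y \<in> Q" by blast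
    moreover have "c \<in> P" using E cP by (simp add: P_def in_nbrs)
    moreover have "{c, y} \<in> E" using \<open>y \<in> Q\<close> by (simp add: Q_def in_nbrs)
    ultimately show False using ind(1) by blast
  qed
  have finD: "finite D" using block_fin[OF b] by simp
  have PQ: "P \<union> Q \<subseteq> V - D" using nbrs_subset by (auto simp: P_def Q_def)
  have "card P = card (nbrs a) - s" "card Q = card (nbrs c) - s"
    unfolding P_def Q_def using DN finD sub(6) by (simp_all add: card_Diff_subset)
  moreover have "card (P \<union> Q) = card P + card Q"
    using dj fin_nbrs by (intro card_Un_disjoint) (auto simp: P_def Q_def)
  moreover have "card (V - D) = card V - s" using finD sub by (simp add: card_Diff_subset)
  \<comment> \<open>Both neighbourhoods contain \<open>D\<close>; removing it from each leaves
    \<open>P\<close> and \<open>Q\<close> with at least \<open>card V - s\<close> vertices together,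
    as many as \<open>V - D\<close> has.\<close>
  moreover have "card V + s \<le> card (nbrs a) + card (nbrs c)" using common_nbrs_bound(1)[OF g E] .
  moreover have "s \<le> card (nbrs a)" "s \<le> card (nbrs c)"
    using DN sub(6) fin_nbrs card_mono by metis+
  ultimately have "card (V - D) \<le> card (P \<union> Q)" by linarith
  then have "P \<union> Q = V - D" using PQ finV card_seteq[of "V - D" "P \<union> Q"] by simp
  then show ?thesis using dj ind by blast
qed

text \<open>Cherries on one side suffice except for odd \<open>k\<close> with \<open>D\<close>
  empty; there goodness contributes \<open>LS 3\<close>.\<close>

lemma no_many_cherries:
  assumes b: "block M d A B D" and ne: "nonext r A B D" and m: "many N 2 D R A B"
    and N: "(2 * (k + l) + 1) * (3 * r) < N" and R: "R + r \<le> M"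
    and M: "2 * (k + l) + 2 + 2 * (2 * (k + l) + 1) * R \<le> M" and g: "good s M'" "1 \<le> M'"
  shows False
proof -
  let ?q = "2 * (k + l)"
  have N': "?q * (3 * r) < N" using N by (simp add: algebra_simps)
  have M': "?q + 2 * ?q * R \<le> M" using M by (simp add: algebra_simps)
  obtain h where h: "hosts E h (labels ?q d True True False {})"
    using one_sided_host[OF b ne R m _ N' M'] by auto
  show False
  proof (cases rule: parity_cases)
    case even
    then show ?thesis using embeds_cherries_even[of E h s d False "{}" k] h k lollipop_free by simp
  next
    case odd
    show ?thesis
    proof (cases "d = 0")
      case False
      then show ?thesis using embeds_cherries_odd[of E h s d False "{}" k] h odd k lollipop_free by simp
    next
      case True
      then have D: "D = {}" using b block_fin[OF b] by (simp add: block_def)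
      obtain h' where "hosts E h' (labels ?q 0 True True False {3})"
        using triangle_host[OF b[unfolded D True] ne[unfolded D] R m[unfolded D] N M g odd(4)] by blast
      then show ?thesis
        using embeds_cherries_triangle_odd[of E h' s 0 False k] odd k lollipop_free by simp
    qed
  qed
qed

lemma no_many_matching:
  assumes b: "block M d A B D" and ne: "nonext r A B D" and m: "many N 1 D R A B"
    and N: "2 * (k + l) * (3 * r) < N" and R: "R + r \<le> M"
    and M: "2 * (k + l) + 2 * (2 * (k + l)) * R \<le> M" and d: "d + 1 = s"
  shows False
proof -
  obtain h where h: "hosts E h (labels (2 * (k + l)) d True False False {})"
    using one_sided_host[OF b ne R m _ N M] by auto
  have d': "d = s - 1" using d by simp
  show False
  proof (cases rule: parity_cases)
    case even
    then show ?thesis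
      using embeds_matching_even[of E h s False False "{}" k] h[unfolded d'] k lollipop_free by simp
  next
    case odd
    then show ?thesis
      using embeds_matching_odd[of E h s False False "{}" k] h[unfolded d'] k lollipop_free by simp
  qed
qed

lemma no_two_matchings:
  assumes h: "hosts E h (labels (2 * (k + l)) d True False True {})" and d: "even k \<or> 0 < d"
  shows False
proof (cases rule: parity_cases)
  case even
  then show ?thesis
    using embeds_two_matchings_even[of E h s d False "{}" k] h k lollipop_free by simp
next
  case odd
  then show ?thesis
    using embeds_two_matchings_odd[of E h s d False "{}" k] h d k lollipop_free by simp
qed

text \<open>
  If the block has no extension, the dichotomy gives many vertices with neighbours on their own side:
  one such neighbour suffices if \<open>d + 1 = s\<close>; otherwise there are two such neighbours on one side, or
  one on both sides. The last alternative is useless when \<open>k\<close> is odd and \<open>d = 0\<close>, but then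
  \<open>s \<ge> 3\<close> rules it out.
\<close>

lemma extend_block:
  assumes b: "block M d A B D" and d: "d < s" and g: "good s M"
    and N2: "N2 = 3 * r * (2 * (k + l) + 1) + 1" and R2: "R2 = r + N2"
    and q': "q' = 2 * (k + l) + 2 * (k + l) * R2" and N1: "N1 = 3 * r * q' + N2" and R1: "R1 = r + N1"
    and M2: "M2 = R2 + r + q' + N2 + 2 * (k + l) + 2 + 2 * (2 * (k + l) + 1) * R2"
    and M: "M2 + q' * R1 + R1 + r + 2 * (k + l) + 2 + 2 * (2 * (k + l) + 1) * R1 + N1 + 1 \<le> M"
  shows "\<exists>A B D. block r (Suc d) A B D"
proof (rule ccontr)
  assume neg: "\<not> ?thesis"
  have fin: "finite A" "finite B" "finite D" using block_fin[OF b] by auto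
  have ne: "nonext r A B D"
    unfolding nonext_def
  proof (rule ballI, rule ccontr)
    fix x assume x: "x \<in> V - D" and "\<not> (card (nbrs x \<inter> A) < r \<or> card (nbrs x \<inter> B) < r)"
    then have r: "r \<le> card (nbrs x \<inter> A)" "r \<le> card (nbrs x \<inter> B)" by auto
    obtain A' where A': "A' \<subseteq> nbrs x \<inter> A" "card A' = r" by (rule obtain_subset_with_card_n[OF r(1)]) blast
    obtain B' where B': "B' \<subseteq> nbrs x \<inter> B" "card B' = r" by (rule obtain_subset_with_card_n[OF r(2)]) blast
    have b': "block r d A' B' D" using block_mono[OF b _ _ A'(2) B'(2)] A' B' by blast
    have "joined (insert x D) A'" "joined (insert x D) B'"
      using A' B' b' unfolding block_def joined_def nbrs_def by auto
    then have "block r (Suc d) A' B' (insert x D)"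
      using b' x fin by (auto simp: block_def)
    then show False using neg by blast
  qed
  note bs = block_sym[OF b] and nes = nonext_sym[OF ne]
  \<comment> \<open>\<open>N1\<close> and \<open>N2\<close> exceed the conflicts in choosing
    \<open>q'\<close> and \<open>2 * (k + l) + 1\<close> disjoint sets, \<open>R1\<close> and
    \<open>R2\<close> have the form \<open>r + N\<close> of the dichotomy, and \<open>M2\<close> is
    the size at which the argument runs again inside a sub-block.\<close>
  have sz: "1 \<le> N1" "N1 < M" "1 \<le> N2" "N2 < M2" "1 \<le> M" "R1 + r \<le> M"
    "2 * (k + l) + 2 + 2 * (2 * (k + l) + 1) * R1 \<le> M" "M2 + q' * R1 \<le> M" "R2 + r \<le> M2"
    "M2 \<le> M" "(2 * (k + l) + 1) * (3 * r) < N1" "q' * (3 * r) < N1"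
    "(2 * (k + l) + 1) * (3 * r) < N2" "q' \<le> M2"
    using N1 N2 M2 M R1 R2 by (auto simp: algebra_simps)
  have q3: "2 * (k + l) * (3 * r) < N1" "2 * (k + l) * (3 * r) < N2"
    "2 * (k + l) + 2 * (2 * (k + l)) * R1 \<le> M"
    using sz(11,13,7) by (auto simp: algebra_simps)
  have no2: "\<not> many N1 2 D R1 A B" "\<not> many N1 2 D R1 B A"
    using no_many_cherries[OF b ne _ sz(11,6,7) g sz(5)] no_many_cherries[OF bs nes _ sz(11,6,7) g sz(5)]
    by blast+
  show False
  proof (cases "d + 1 = s")
    case True
    then have "many N1 1 D R1 A B \<or> many N1 1 D R1 B A"
      using dichotomy[OF b ne g sz(1,2), of 0 0] by (simp add: R1)
    then show False
      using no_many_matching[OF b ne _ q3(1) sz(6) q3(3) True]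
        no_many_matching[OF bs nes _ q3(1) sz(6) q3(3) True] by blast
  next
    case False
    then have d2: "d + 2 \<le> s" using d by simp
    show False
    proof (cases "even k \<or> 0 < d")
      case True
      \<comment> \<open>With \<alpha> + \<beta> = 1 the dichotomy offers a matching on one side or
        cherries on the other. Cherries are excluded, so both sides have matchings; for the second
        side this is done in sub-blocks, to which \<open>good\<close> and \<open>nonext\<close>
        pass.\<close>
      have "many N1 1 D R1 A B \<or> many N1 2 D R1 B A"
        using dichotomy[OF b ne g sz(1,2), of 0 1] d2 by (simp add: R1 numeral_2_eq_2)
      then have m1: "many N1 1 D R1 A B" using no2 by blast
      have m2: "many N2 1 D R2 B' A'"
        if "A' \<subseteq> A" "B' \<subseteq> B" "card A' = M2" "card B' = M2" for A' B'
      proof -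
        note b' = block_mono[OF b that(1,2,3,4)]
        note ne' = nonext_mono[OF ne that(1,2) fin(1,2)]
        have "many N2 2 D R2 A' B' \<or> many N2 1 D R2 B' A'"
          using dichotomy[OF b' ne' good_mono[OF g sz(10)] sz(3,4), of 1 0] d2
          by (simp add: R2 numeral_2_eq_2)
        moreover have "\<not> many N2 2 D R2 A' B'"
        proof
          assume "many N2 2 D R2 A' B'"
          moreover have "2 * (k + l) + 2 + 2 * (2 * (k + l) + 1) * R2 \<le> M2" by (simp add: M2)
          ultimately show False
            using no_many_cherries[OF b' ne' _ sz(13,9) _ g sz(5)] by blast
        qed
        ultimately show ?thesis by blast
      qed
      obtain h where "hosts E h (labels (2 * (k + l)) d True False True {})"
        using two_sided_host[OF b ne m1 _ sz(12)[unfolded q'] q3(2) sz(9) sz(14)[unfolded q'] sz(6)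
            sz(8)[unfolded q']] m2 by blast
      then show False using no_two_matchings True by blast
    next
      case False
      then have "3 \<le> s" using parity_cases by metis
      then have "many N1 2 D R1 A B \<or> many N1 2 D R1 B A"
        using dichotomy[OF b ne g sz(1,2), of 1 1] False by (simp add: R1 numeral_2_eq_2)
      then show False using no2 by blast
    qed
  qed
qed

end

section \<open>The extremal graph\<close>

text \<open>For disjoint sets these are the edges of the join of a complete graph on
  \<open>D\<close> with the complete bipartite graph between \<open>P\<close> and
  \<open>Q\<close>.\<close>

definition join_bipartite :: "'a set \<Rightarrow> 'a set \<Rightarrow> 'a set \<Rightarrow> 'a set set" where
  "join_bipartite D P Q = {e. e \<subseteq> D \<union> P \<union> Q \<and> card e = 2 \<and> \<not> e \<subseteq> P \<and> \<not> e \<subseteq> Q}"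

definition extremal_number :: "nat \<Rightarrow> nat \<Rightarrow> nat" where
  "extremal_number s n = (s choose 2) + s * (n - s) + (n - s) * (n - s) div 4"

definition extremal_structure :: "nat \<Rightarrow> 'a set \<Rightarrow> 'a set set \<Rightarrow> bool" where
  "extremal_structure s V E \<longleftrightarrow> (\<exists>D P Q. V = D \<union> P \<union> Q \<and> D \<inter> P = {} \<and> D \<inter> Q = {} \<and> P \<inter> Q = {} \<and>
     card D = s \<and> card P = (card V - s + 1) div 2 \<and> card Q = (card V - s) div 2 \<and>
     E = join_bipartite D P Q)"

lemma card_join_bipartite:
  assumes "finite D" "finite P" "finite Q" "D \<inter> P = {}" "D \<inter> Q = {}" "P \<inter> Q = {}"
  shows "card (join_bipartite D P Q) =
    (card D choose 2) + card D * (card P + card Q) + card P * card Q"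
proof -
  let ?pair = "\<lambda>(x, y). {x, y}"
  let ?S1 = "{e. e \<subseteq> D \<and> card e = 2}" and ?S2 = "?pair ` (D \<times> (P \<union> Q))" and ?S3 = "?pair ` (P \<times> Q)"
  have eq: "join_bipartite D P Q = ?S1 \<union> ?S2 \<union> ?S3"
  proof (intro equalityI subsetI)
    fix e assume "e \<in> join_bipartite D P Q"
    then have e: "e \<subseteq> D \<union> P \<union> Q" "card e = 2" "\<not> e \<subseteq> P" "\<not> e \<subseteq> Q"
      by (auto simp: join_bipartite_def)
    from e(2) obtain x y where xy: "e = {x, y}" "x \<noteq> y" by (meson card_2_iff)
    have yx: "e = {y, x}" using xy by auto
    have "x \<in> D \<union> P \<union> Q" "y \<in> D \<union> P \<union> Q" using e xy by auto
    then consider "x \<in> D" "y \<in> D" | "x \<in> D" "y \<in> P \<union> Q" | "y \<in> D" "x \<in> P \<union> Q"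
      | "x \<in> P" "y \<in> Q" | "x \<in> Q" "y \<in> P" using e xy by auto
    then show "e \<in> ?S1 \<union> ?S2 \<union> ?S3"
    proof cases
      case 1 then show ?thesis using e xy by auto
    next
      case 2 then have "e \<in> ?S2" using xy(1) by (intro image_eqI[of _ _ "(x, y)"]) auto
      then show ?thesis by blast
    next
      case 3 then have "e \<in> ?S2" using yx by (intro image_eqI[of _ _ "(y, x)"]) auto
      then show ?thesis by blast
    next
      case 4 then have "e \<in> ?S3" using xy(1) by (intro image_eqI[of _ _ "(x, y)"]) auto
      then show ?thesis by blast
    next
      case 5 then have "e \<in> ?S3" using yx by (intro image_eqI[of _ _ "(y, x)"]) auto
      then show ?thesis by blast
    qed
  next
    fix e assume "e \<in> ?S1 \<union> ?S2 \<union> ?S3"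
    then consider "e \<subseteq> D" "card e = 2" | x y where "e = {x, y}" "x \<in> D" "y \<in> P \<union> Q"
      | x y where "e = {x, y}" "x \<in> P" "y \<in> Q" by fast
    then show "e \<in> join_bipartite D P Q"
    proof cases
      case 1
      then have "e \<noteq> {}" by auto
      then have "\<not> e \<subseteq> P" "\<not> e \<subseteq> Q" using 1 assms by blast+
      then show ?thesis using 1 by (auto simp: join_bipartite_def)
    next
      case 2
      then have "x \<noteq> y" "x \<notin> P" "x \<notin> Q" using assms by blast+
      then show ?thesis using 2 by (auto simp: join_bipartite_def)
    next
      case 3
      then have "x \<noteq> y" "x \<notin> Q" "y \<notin> P" using assms by blast+
      then show ?thesis using 3 by (auto simp: join_bipartite_def)
    qed
  qed
  have inj2: "inj_on ?pair (D \<times> (P \<union> Q))" and inj3: "inj_on ?pair (P \<times> Q)"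
    using assms(4-6) unfolding inj_on_def by (auto simp: doubleton_eq_iff)
  have "card ?S2 = card D * (card P + card Q)"
    using assms by (subst card_image[OF inj2]) (simp add: card_cartesian_product card_Un_disjoint)
  moreover have "card ?S3 = card P * card Q"
    by (subst card_image[OF inj3]) (simp add: card_cartesian_product)
  moreover have "card ?S1 = card D choose 2" using assms(1) by (rule n_subsets)
  moreover have "?S1 \<inter> ?S2 = {}" using assms(4-6) by fastforce
  moreover have "(?S1 \<union> ?S2) \<inter> ?S3 = {}"
  proof (rule equals0I)
    fix e assume e: "e \<in> (?S1 \<union> ?S2) \<inter> ?S3"
    then have "e \<inter> D = {}" using assms(4-6) by auto
    moreover have "e \<noteq> {}" using e by auto
    ultimately show False using e by auto
  qed
  moreover have "finite ?S1" "finite ?S2" "finite ?S3" using assms by auto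
  ultimately show ?thesis unfolding eq by (simp add: card_Un_disjoint)
qed

lemma join_bipartite_image:
  assumes "inj_on f (D \<union> P \<union> Q)"
  shows "join_bipartite (f ` D) (f ` P) (f ` Q) = (\<lambda>e. f ` e) ` join_bipartite D P Q"
proof (intro equalityI subsetI)
  fix e' assume "e' \<in> join_bipartite (f ` D) (f ` P) (f ` Q)"
  then have e': "e' \<subseteq> f ` (D \<union> P \<union> Q)" "card e' = 2" "\<not> e' \<subseteq> f ` P" "\<not> e' \<subseteq> f ` Q"
    unfolding join_bipartite_def image_Un by simp_all
  from e'(1) obtain e where e: "e \<subseteq> D \<union> P \<union> Q" "e' = f ` e" by (meson subset_imageE)
  have "card e = 2" using e e'(2) card_image[OF inj_on_subset[OF assms e(1)]] by simp
  moreover have "\<not> e \<subseteq> P" "\<not> e \<subseteq> Q" using e e' by auto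
  ultimately show "e' \<in> (\<lambda>e. f ` e) ` join_bipartite D P Q"
    using e by (auto simp: join_bipartite_def)
next
  fix e' assume "e' \<in> (\<lambda>e. f ` e) ` join_bipartite D P Q"
  then obtain e where e: "e' = f ` e" "e \<subseteq> D \<union> P \<union> Q" "card e = 2" "\<not> e \<subseteq> P" "\<not> e \<subseteq> Q"
    by (auto simp: join_bipartite_def)
  have "e \<subseteq> S" if S: "S \<subseteq> D \<union> P \<union> Q" "f ` e \<subseteq> f ` S" for S
  proof
    fix x assume x: "x \<in> e"
    then obtain y where y: "y \<in> S" "f x = f y" using S(2) by auto
    then have "x = y" using inj_onD[OF assms] x e(2) S(1) by blast
    then show "x \<in> S" using y by simp
  qed
  from this[of P] this[of Q] have "\<not> f ` e \<subseteq> f ` P" "\<not> f ` e \<subseteq> f ` Q"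
    using e(4,5) by blast+
  moreover have "card (f ` e) = 2" using e(3) card_image[OF inj_on_subset[OF assms e(2)]] by simp
  moreover have "f ` e \<subseteq> f ` D \<union> f ` P \<union> f ` Q" using e(2) by auto
  ultimately show "e' \<in> join_bipartite (f ` D) (f ` P) (f ` Q)"
    using e(1) by (simp add: join_bipartite_def)
qed

lemma extremal_structure_card:
  assumes "finite V" "extremal_structure s V E"
  shows "card E = extremal_number s (card V)"
proof -
  obtain D P Q where V: "V = D \<union> P \<union> Q" and dj: "D \<inter> P = {}" "D \<inter> Q = {}" "P \<inter> Q = {}"
    and c: "card D = s" "card P = (card V - s + 1) div 2" "card Q = (card V - s) div 2"
    and E: "E = join_bipartite D P Q"
    using assms(2) unfolding extremal_structure_def by blast
  have fin: "finite D" "finite P" "finite Q" using assms(1) V by auto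
  have halves: "card P + card Q = card V - s" using c by presburger
  have "(x + 1) div 2 * (x div 2) = x * x div 4" for x :: nat
    by (cases "even x") (auto elim!: evenE oddE)
  then have "card P * card Q = (card V - s) * (card V - s) div 4" using c by simp
  then show ?thesis unfolding E extremal_number_def card_join_bipartite[OF fin dj] halves c(1) by simp
qed

text \<open>\<open>H_graph\<close> has vertices of a sum type while competitors have numbers as
  vertices; this moves its structure to the latter.\<close>

lemma extremal_structure_image:
  assumes "inj f" "extremal_structure s V E"
  shows "extremal_structure s (f ` V) ((\<lambda>e. f ` e) ` E)"
proof -
  obtain D P Q where *: "V = D \<union> P \<union> Q" "D \<inter> P = {}" "D \<inter> Q = {}" "P \<inter> Q = {}" "card D = s"
    "card P = (card V - s + 1) div 2" "card Q = (card V - s) div 2" "E = join_bipartite D P Q"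
    using assms(2) unfolding extremal_structure_def by blast
  have card: "card (f ` S) = card S" for S
    using assms(1) by (meson card_image inj_on_subset subset_UNIV)
  have "f ` S \<inter> f ` T = {}" if "S \<inter> T = {}" for S T
    using assms(1) that by (metis image_Int image_empty)
  note dj = this[OF *(2)] this[OF *(3)] this[OF *(4)]
  have "f ` V = f ` D \<union> f ` P \<union> f ` Q" unfolding *(1) by (simp only: image_Un)
  moreover have "(\<lambda>e. f ` e) ` E = join_bipartite (f ` D) (f ` P) (f ` Q)"
    unfolding *(8) using join_bipartite_image inj_on_subset[OF assms(1) subset_UNIV] by metis
  ultimately show ?thesis
    unfolding extremal_structure_def card[of V] using dj *(5-7) card[of D] card[of P] card[of Q]
    by (intro exI[of _ "f ` D"] exI[of _ "f ` P"] exI[of _ "f ` Q"] conjI) simp_all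
qed

lemma extremal_structure_iso:
  fixes G :: "'a graph" and H :: "'b graph"
  assumes "finite (verts G)" "finite (verts H)" "card (verts G) = card (verts H)"
    and "extremal_structure s (verts G) (edges G)" "extremal_structure s (verts H) (edges H)"
  shows "graph_iso G H"
proof -
  obtain D P Q where V: "verts G = D \<union> P \<union> Q" and dj: "D \<inter> P = {}" "D \<inter> Q = {}" "P \<inter> Q = {}"
    and c: "card D = s" "card P = (card (verts G) - s + 1) div 2" "card Q = (card (verts G) - s) div 2"
    and E: "edges G = join_bipartite D P Q"
    using assms(4) unfolding extremal_structure_def by blast
  obtain D' P' Q' where V': "verts H = D' \<union> P' \<union> Q'" and dj': "D' \<inter> P' = {}" "D' \<inter> Q' = {}" "P' \<inter> Q' = {}"
    and c': "card D' = s" "card P' = (card (verts H) - s + 1) div 2" "card Q' = (card (verts H) - s) div 2"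
    and E': "edges H = join_bipartite D' P' Q'"
    using assms(5) unfolding extremal_structure_def by blast
  have fin: "finite D" "finite P" "finite Q" "finite D'" "finite P'" "finite Q'"
    using assms V V' by auto
  obtain fD where fD: "bij_betw fD D D'" using finite_same_card_bij[of D D'] fin c c' by auto
  obtain fP where fP: "bij_betw fP P P'" using finite_same_card_bij[of P P'] fin c c' assms(3) by auto
  obtain fQ where fQ: "bij_betw fQ Q Q'" using finite_same_card_bij[of Q Q'] fin c c' assms(3) by auto
  define f where "f x = (if x \<in> D then fD x else if x \<in> P then fP x else fQ x)" for x
  have D: "bij_betw f D D'" using fD by (rule iffD1[OF bij_betw_cong, rotated]) (simp add: f_def)
  have P: "bij_betw f P P'"
    using fP by (rule iffD1[OF bij_betw_cong, rotated]) (use dj in \<open>auto simp: f_def\<close>)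
  have Q: "bij_betw f Q Q'"
    using fQ by (rule iffD1[OF bij_betw_cong, rotated]) (use dj in \<open>auto simp: f_def\<close>)
  have "(D' \<union> P') \<inter> Q' = {}" using dj' by blast
  then have b: "bij_betw f (verts G) (verts H)"
    unfolding V V' by (rule bij_betw_combine[OF bij_betw_combine[OF D P dj'(1)] Q])
  moreover have "edges H = (\<lambda>e. f ` e) ` edges G"
  proof -
    have "inj_on f (D \<union> P \<union> Q)" using b unfolding V bij_betw_def by simp
    moreover have "f ` D = D'" "f ` P = P'" "f ` Q = Q'" using D P Q by (auto simp: bij_betw_def)
    ultimately show ?thesis unfolding E E' using join_bipartite_image by metis
  qed
  ultimately show ?thesis unfolding graph_iso_def by blast
qed

text \<open>Of three vertices outside \<open>D\<close> two lie in the same part, and such a pair is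
  no edge.\<close>

lemma join_bipartite_triangle_meets:
  assumes "{x, y} \<in> join_bipartite D P Q" "{x, z} \<in> join_bipartite D P Q" "{y, z} \<in> join_bipartite D P Q"
  shows "x \<in> D \<or> y \<in> D \<or> z \<in> D"
  using assms unfolding join_bipartite_def by auto

text \<open>
  All triangles would meet \<open>D\<close>. The \<open>k\<close> triangles of the cycle need at least \<open>k / 2\<close> vertices, as each
  vertex is in at most two of them, and every second triangle of the tail needs a further vertex.
\<close>

lemma join_bipartite_lollipop_free:
  fixes v w :: "nat \<Rightarrow> 'a"
  assumes "4 \<le> k" "2 \<le> l" "even l" "finite D" "card D = (k + l - 1) div 2"
  shows "\<not> embeds k (k + l) (join_bipartite D P Q) v w"
proof
  let ?K = "k + l"
  let ?p = "edge_fst k ?K" and ?q = "edge_snd ?K"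
  assume "embeds k ?K (join_bipartite D P Q) v w"
  then have inj: "inj_on v {..<?K}" "inj_on w {..<?K}" "v ` {..<?K} \<inter> w ` {..<?K} = {}"
    and tri: "\<And>i. i < ?K \<Longrightarrow> v (?p i) \<in> D \<or> v (?q i) \<in> D \<or> w i \<in> D"
    unfolding embeds_def using join_bipartite_triangle_meets by metis+
  have veq: "v i = v j \<longleftrightarrow> i = j" if "i < ?K" "j < ?K" for i j
    using inj(1) that by (auto simp: inj_on_def)
  have weq: "w i = w j \<longleftrightarrow> i = j" if "i < ?K" "j < ?K" for i j
    using inj(2) that by (auto simp: inj_on_def)
  have vw: "v i \<noteq> w j" if "i < ?K" "j < ?K" for i j using inj(3) that by blast
  have pq: "?p i < ?K" "?q i < ?K" if "i < ?K" for i
    using that assms by (auto simp: edge_fst_def edge_snd_def)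
  define h where "h i = (SOME x. x \<in> D \<and> x \<in> {v (?p i), v (?q i), w i})" for i
  have h: "h i \<in> D" "h i \<in> {v (?p i), v (?q i), w i}" if "i < ?K" for i
  proof -
    have "\<exists>x. x \<in> D \<and> x \<in> {v (?p i), v (?q i), w i}" using tri[OF that] by blast
    then have "h i \<in> D \<and> h i \<in> {v (?p i), v (?q i), w i}" unfolding h_def by (rule someI_ex)
    then show "h i \<in> D" "h i \<in> {v (?p i), v (?q i), w i}" by auto
  qed
  have meet: "i = j \<or> ?p i = ?p j \<or> ?p i = ?q j \<or> ?q i = ?p j \<or> ?q i = ?q j"
    if "i < ?K" "j < ?K" "h i = h j" for i j
    using h(2)[OF that(1)] h(2)[OF that(2)] that(3) veq weq[OF that(1,2)] vw vw[THEN not_sym]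
      pq[OF that(1)] pq[OF that(2)] that(1,2) by auto
  \<comment> \<open>\<open>C\<close> numbers the cycle edges. \<open>T\<close> takes every second
    tail edge starting with number \<open>k\<close>, since the tail edge \<open>k - 1\<close> still
    touches the cycle; the edges in \<open>T\<close> are disjoint from the cycle and from each
    other.\<close>
  define C where "C = {..<k - 1} \<union> {?K - 1}"
  define T where "T = (\<lambda>j. k + 2 * j) ` {..<l div 2}"
  have CT: "C \<subseteq> {..<?K}" "T \<subseteq> {..<?K}" using assms by (auto simp: C_def T_def)
  have cC: "card C = k" using assms by (simp add: C_def)
  have cT: "card T = l div 2" unfolding T_def by (subst card_image) (auto simp: inj_on_def)
  have pqT: "?p i = i \<and> ?q i = i + 1" if "i \<in> T" for i
    using that assms by (auto simp: T_def edge_fst_def edge_snd_def)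
  have "inj_on h T"
  proof (rule inj_onI)
    fix i j assume ij: "i \<in> T" "j \<in> T" "h i = h j"
    then have "i = j \<or> i = j + 1 \<or> j = i + 1" using meet[of i j] pqT CT(2) by auto
    then show "i = j" using ij(1,2) unfolding T_def by (elim disjE imageE) presburger+
  qed
  then have chT: "card (h ` T) = l div 2" by (simp add: card_image cT)
  have "h ` C \<inter> h ` T = {}"
  proof -
    have "h i \<noteq> h j" if ij: "i \<in> C" "j \<in> T" for i j
    proof
      assume "h i = h j"
      then have "i = j \<or> ?p i = j \<or> ?p i = j + 1 \<or> ?q i = j \<or> ?q i = j + 1"
        using meet[of i j] pqT[OF ij(2)] CT ij by auto
      moreover have "k \<le> j" "j < ?K - 1" using ij(2) assms by (auto simp: T_def)
      ultimately show False
        using ij(1) assms(1,2)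
        by (auto simp: C_def edge_fst_def edge_snd_def split: if_splits)
    qed
    then show ?thesis by blast
  qed
  moreover have "k \<le> 2 * card (h ` C)"
  proof -
    have two: "card {i \<in> C. h i = x} \<le> 2" for x
    proof (cases "\<exists>i\<in>C. h i = x")
      case False
      then have "{i \<in> C. h i = x} = {}" by blast
      then show ?thesis by (simp only: card.empty)
    next
      case True
      then obtain i where i: "i \<in> C" "h i = x" by blast
      have iK: "i < ?K" using i CT by blast
      have "\<exists>a b. {i \<in> C. h i = x} \<subseteq> {a, b}"
      proof (cases "x = w i")
        case True
        have "j = i" if "j \<in> C" "h j = x" for j
        proof -
          have jK: "j < ?K" using that CT by blast
          then show ?thesis using h(2)[OF jK] that True vw[OF pq(1)[OF jK] iK] vw[OF pq(2)[OF jK] iK] weq[OF jK iK] by auto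
        qed
        then show ?thesis by blast
      next
        case False
        then obtain n where n: "x = v n" "n < ?K" using h(2)[OF iK] i pq[OF iK] by auto
        have *: "?p j = n \<or> ?q j = n" if "j \<in> C" "h j = x" for j
        proof -
          have jK: "j < ?K" using that CT by blast
          then show ?thesis using h(2)[OF jK] that n vw[OF n(2) jK] veq pq[OF jK] by auto
        qed
        \<comment> \<open>A lollipop vertex lies on at most two cycle edges; 0 and
          \<open>k - 1\<close> are separate cases because they are the ends of the chord.\<close>
        have "{j \<in> C. h j = x} \<subseteq> (if n = 0 then {0, ?K - 1} else if n = k - 1 then {k - 2, ?K - 1} else {n - 1, n})"
        proof
          fix j assume "j \<in> {j \<in> C. h j = x}"
          then have "j \<in> C" "?p j = n \<or> ?q j = n" using * by auto
          then show "j \<in> (if n = 0 then {0, ?K - 1} else if n = k - 1 then {k - 2, ?K - 1} else {n - 1, n})"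
            using assms(1,2) by (auto simp: C_def edge_fst_def edge_snd_def split: if_splits)
        qed
        moreover have "\<exists>a b. (if n = 0 then {0, ?K - 1} else if n = k - 1 then {k - 2, ?K - 1}
            else {n - 1, n}) = {a, b}"
          by (split if_split, split if_split) blast
        ultimately show ?thesis by (elim exE) (simp only:, blast)
      qed
      then obtain a b where "{i \<in> C. h i = x} \<subseteq> {a, b}" by blast
      then have "card {i \<in> C. h i = x} \<le> card {a, b}" by (intro card_mono) auto
      also have "\<dots> \<le> 2" by (simp add: card_insert_if)
      finally show ?thesis .
    qed
    have finC: "finite C" by (simp add: C_def)
    have "C \<subseteq> (\<Union>x\<in>h ` C. {i \<in> C. h i = x})" by blast
    then have "card C \<le> card (\<Union>x\<in>h ` C. {i \<in> C. h i = x})"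
      using finC by (intro card_mono) auto
    also have "\<dots> \<le> (\<Sum>x\<in>h ` C. card {i \<in> C. h i = x})" using finC by (intro card_UN_le) auto
    also have "\<dots> \<le> (\<Sum>x\<in>h ` C. 2)" using two by (intro sum_mono) auto
    finally show ?thesis using cC by simp
  qed
  moreover have "card (h ` C \<union> h ` T) \<le> card D"
    using h(1) CT assms(4) by (intro card_mono) auto
  moreover have "card (h ` C \<union> h ` T) = card (h ` C) + card (h ` T)"
    using calculation(1) by (intro card_Un_disjoint) (auto simp: C_def T_def)
  \<comment> \<open>For even \<open>l\<close> the left side is \<open>k + l\<close>, whereas
    \<open>2 * card D\<close> is at most \<open>k + l - 1\<close>.\<close>
  ultimately have "k + 2 * (l div 2) \<le> 2 * card D" using chT by linarith
  then show False using assms(1-3,5) by presburger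
qed

section \<open>The graph H(n, 2, s + 1)\<close>

lemma card_even_lessThan: "card {i. i < (x::nat) \<and> even i} = (x + 1) div 2"
proof (induction x)
  case (Suc x)
  have "{i. i < Suc x \<and> even i} = (if even x then insert x {i. i < x \<and> even i} else {i. i < x \<and> even i})"
    using less_Suc_eq by auto
  then show ?case using Suc by (auto elim!: evenE oddE)
qed simp

lemma card_odd_lessThan: "card {i. i < (x::nat) \<and> odd i} = x div 2"
proof (induction x)
  case (Suc x)
  have "{i. i < Suc x \<and> odd i} = (if odd x then insert x {i. i < x \<and> odd i} else {i. i < x \<and> odd i})"
    using less_Suc_eq by auto
  then show ?case using Suc by (auto elim!: evenE oddE)
qed simp

lemma H_graph_structure:
  assumes "1 \<le> s" "s \<le> n"
  shows "simple_graph (H_graph n 2 (s + 1))" "card (verts (H_graph n 2 (s + 1))) = n"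
    "extremal_structure s (verts (H_graph n 2 (s + 1))) (edges (H_graph n 2 (s + 1)))"
proof -
  let ?x = "n - s" and ?H = "H_graph n 2 (s + 1)"
  let ?D = "Inl ` {..<s} :: (nat + nat) set"
  let ?P = "Inr ` {i. i < ?x \<and> even i} :: (nat + nat) set"
  let ?Q = "Inr ` {i. i < ?x \<and> odd i} :: (nat + nat) set"
  have V: "verts ?H = ?D \<union> ?P \<union> ?Q"
    by (auto simp: H_graph_def graph_join_def complete_graph_def turan_graph_def)
  have E: "edges ?H = join_bipartite ?D ?P ?Q"
  proof (intro equalityI subsetI)
    fix e assume "e \<in> edges ?H"
    then consider e' where "e = Inl ` e'" "e' \<subseteq> {..<s}" "card e' = 2"
      | i j where "e = {Inr i, Inr j}" "i < ?x" "j < ?x" "i mod 2 \<noteq> j mod 2"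
      | i j where "e = {Inl i, Inr j}" "i < s" "j < ?x"
      by (auto simp: H_graph_def graph_join_def complete_graph_def turan_graph_def)
    then show "e \<in> join_bipartite ?D ?P ?Q"
    proof cases
      case 1
      then have "card e = 2" by (simp add: card_image)
      moreover have "e' \<noteq> {}" using 1 by auto
      ultimately show ?thesis using 1 by (auto simp: join_bipartite_def)
    next
      case 2
      then have "i \<noteq> j" "even i \<longleftrightarrow> odd j" by presburger+
      then show ?thesis using 2 by (auto simp: join_bipartite_def)
    next
      case 3
      then show ?thesis by (auto simp: join_bipartite_def)
    qed
  next
    fix e assume "e \<in> join_bipartite ?D ?P ?Q"
    then have e: "e \<subseteq> ?D \<union> ?P \<union> ?Q" "card e = 2" "\<not> e \<subseteq> ?P" "\<not> e \<subseteq> ?Q"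
      by (auto simp: join_bipartite_def)
    from e(2) obtain a b where ab: "e = {a, b}" "a \<noteq> b" by (meson card_2_iff)
    have edge: "{Inl i, Inr j} \<in> edges ?H" if "i < s" "j < ?x" for i j
      using that by (auto simp: H_graph_def graph_join_def complete_graph_def turan_graph_def)
    have edge2: "{Inr i, Inr j} \<in> edges ?H" if "i < ?x" "j < ?x" "i mod 2 \<noteq> j mod 2" for i j
    proof -
      have "{i, j} \<in> edges (turan_graph 2 ?x)" using that by (auto simp: turan_graph_def)
      then have "Inr ` {i, j} \<in> edges ?H"
        by (simp add: H_graph_def graph_join_def del: image_insert)
      then show ?thesis by simp
    qed
    have edge1: "{Inl i, Inl j} \<in> edges ?H" if "i < s" "j < s" "i \<noteq> j" for i j
    proof -
      have "{i, j} \<in> edges (complete_graph s)" using that by (auto simp: complete_graph_def)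
      then have "Inl ` {i, j} \<in> edges ?H"
        by (simp add: H_graph_def graph_join_def del: image_insert)
      then show ?thesis by simp
    qed
    have mem: "(\<exists>i<s. c = Inl i) \<or> (\<exists>i<?x. c = Inr i)" if "c \<in> e" for c using that e(1) by blast
    have "a \<in> e" "b \<in> e" using ab by auto
    from mem[OF this(1)] mem[OF this(2)]
    consider i j where "a = Inl i" "b = Inl j" "i < s" "j < s"
      | i j where "a = Inl i" "b = Inr j" "i < s" "j < ?x"
      | i j where "a = Inr i" "b = Inl j" "i < ?x" "j < s"
      | i j where "a = Inr i" "b = Inr j" "i < ?x" "j < ?x" by blast
    then show "e \<in> edges ?H"
    proof cases
      case 1 then show ?thesis using ab edge1 by auto
    next
      case 2 then show ?thesis using ab edge by auto
    next
      case 3 then show ?thesis using ab edge[of j i] by (simp add: insert_commute)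
    next
      case 4
      have "i mod 2 \<noteq> j mod 2"
      proof
        assume "i mod 2 = j mod 2"
        then have "(even i \<and> even j) \<or> (odd i \<and> odd j)" by presburger
        then show False using 4 e(3,4) ab by auto
      qed
      then show ?thesis using 4 ab edge2 by auto
    qed
  qed
  have cD: "card ?D = s" by (simp add: card_image)
  have cP: "card ?P = (?x + 1) div 2" by (simp add: card_image card_even_lessThan)
  have cQ: "card ?Q = ?x div 2" by (simp add: card_image card_odd_lessThan)
  have dj: "?D \<inter> ?P = {}" "?D \<inter> ?Q = {}" "?P \<inter> ?Q = {}" by auto
  have "card (?D \<union> ?P \<union> ?Q) = card ?D + card ?P + card ?Q"
    using dj by (subst card_Un_disjoint) (auto simp: card_Un_disjoint)
  also have "\<dots> = n" unfolding cD cP cQ using assms by presburger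
  finally show cV: "card (verts ?H) = n" unfolding V .
  show "simple_graph ?H" unfolding simple_graph_def E unfolding V by (auto simp: join_bipartite_def)
  show "extremal_structure s (verts ?H) (edges ?H)"
    unfolding extremal_structure_def cV using V E dj cD cP cQ by blast
qed

section \<open>Reduction to good graphs\<close>

lemma embeds_mono: "embeds k K E v w \<Longrightarrow> E \<subseteq> E' \<Longrightarrow> embeds k K E' v w"
  unfolding embeds_def by (simp add: subset_iff)

text \<open>Changing the base by \<open>2 * m\<close> changes the square by a multiple of 4, so the
  floor in \<open>extremal_number\<close> causes no loss. This is the origin of the bound in
  \<open>good\<close>.\<close>

lemma extremal_number_diff:
  assumes "s + 2 * m \<le> n"
  shows "extremal_number s n = extremal_number s (n - 2 * m) + m * (n + s - m)"
proof -
  define x where "x = n - s - 2 * m"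
  have n: "n = s + x + 2 * m" using assms by (simp add: x_def)
  have "(x + 2 * m) * (x + 2 * m) = x * x + (m * x + m * m) * 4" by (simp add: algebra_simps)
  then have "(x + 2 * m) * (x + 2 * m) div 4 = x * x div 4 + (m * x + m * m)" by simp
  then show ?thesis unfolding n extremal_number_def by (simp add: algebra_simps)
qed

lemma extremal_number_dense:
  assumes "1 \<le> s" "2 * s \<le> n"
  shows "n * n \<le> 8 * extremal_number s n"
proof -
  define x where "x = n - s"
  have n: "n = s + x" "s \<le> x" using assms by (auto simp: x_def)
  have "x * x < 4 * (x * x div 4) + 4" by presburger
  moreover have "s * s \<le> s * x" "1 * 1 \<le> s * x" "1 * 1 \<le> x * x"
    using n(2) assms(1) by (intro mult_le_mono; simp)+
  moreover have "n * n = s * s + 2 * (s * x) + x * x" unfolding n(1) by (simp add: algebra_simps)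
  moreover have "8 * (s * x) + 8 * (x * x div 4) \<le> 8 * extremal_number s n"
    by (simp add: extremal_number_def x_def)
  ultimately show ?thesis by linarith
qed

text \<open>With \<open>c = p - q\<close> one has
  \<open>(p + q) * (p + q) = c * c + 4 * p * q\<close>, and \<open>c * c < 4\<close> means
  \<open>c \<le> 1\<close>.\<close>

lemma half_product_bound:
  fixes p q :: nat
  assumes "q \<le> p"
  shows "p * q \<le> (p + q) * (p + q) div 4"
    and "(p + q) * (p + q) div 4 \<le> p * q \<Longrightarrow> p = (p + q + 1) div 2 \<and> q = (p + q) div 2"
proof -
  define c where "c = p - q"
  have p: "p = q + c" using assms by (simp add: c_def)
  have "(p + q) * (p + q) = c * c + (p * q) * 4" unfolding p by (simp add: algebra_simps)
  then have eq: "(p + q) * (p + q) div 4 = c * c div 4 + p * q" by simp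
  then show "p * q \<le> (p + q) * (p + q) div 4" by simp
  assume "(p + q) * (p + q) div 4 \<le> p * q"
  then have "c * c div 4 = 0" using eq by simp
  then have "c < 2"
  proof -
    have "c * c < 4" using \<open>c * c div 4 = 0\<close> by simp
    then show ?thesis using mult_le_mono[of 2 c 2 c] by fastforce
  qed
  then show "p = (p + q + 1) div 2 \<and> q = (p + q) div 2" unfolding p by presburger
qed

section \<open>Extremality and reduction of lollipop-free graphs\<close>

context lollipop_free_graph
begin

text \<open>\<open>E\<close> lies in \<open>join_bipartite D P Q\<close>, which has at most
  \<open>extremal_number s (card V)\<close> edges. Having that many, \<open>E\<close> fills it, and
  equality forces balanced parts.\<close>

lemma bipartite_extremal:
  assumes "P \<inter> Q = {}" "P \<union> Q = V - D" "D \<subseteq> V" "card D = s"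
    and ind: "\<forall>y\<in>P. \<forall>z\<in>P. {y, z} \<notin> E" "\<forall>y\<in>Q. \<forall>z\<in>Q. {y, z} \<notin> E"
    and le: "card Q \<le> card P" and many: "extremal_number s (card V) \<le> card E"
  shows "extremal_structure s V E"
proof -
  have V: "V = D \<union> P \<union> Q" using assms(2,3) by blast
  have dj: "D \<inter> P = {}" "D \<inter> Q = {}" using assms(2) by auto
  have fin: "finite D" "finite P" "finite Q" using V finV by auto
  have cV: "card V - s = card P + card Q"
    using fin dj assms(1,4) unfolding V by (simp add: card_Un_disjoint Int_Un_distrib2)
  have sub: "E \<subseteq> join_bipartite D P Q"
  proof
    fix e assume e: "e \<in> E"
    then obtain x y where xy: "e = {x, y}" by (rule edgeE)
    have "e \<subseteq> V" "card e = 2" using wfE[OF e] by auto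
    moreover have "\<not> e \<subseteq> P" "\<not> e \<subseteq> Q" using ind e xy by auto
    ultimately show "e \<in> join_bipartite D P Q" using V by (simp add: join_bipartite_def)
  qed
  have finJ: "finite (join_bipartite D P Q)"
  proof (rule finite_subset)
    show "join_bipartite D P Q \<subseteq> Pow V" unfolding join_bipartite_def V by fast
    show "finite (Pow V)" using finV by simp
  qed
  have cJ: "card (join_bipartite D P Q) = (s choose 2) + s * (card V - s) + card P * card Q"
    using card_join_bipartite[OF fin dj assms(1)] assms(4) cV by simp
  have "card P * card Q \<le> (card V - s) * (card V - s) div 4"
    using half_product_bound(1)[OF le] cV by simp
  then have "card (join_bipartite D P Q) \<le> card E"
    using many unfolding cJ extremal_number_def by linarith
  then have E: "E = join_bipartite D P Q" using card_seteq[OF finJ sub] by simp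
  have "(card V - s) * (card V - s) div 4 \<le> card P * card Q"
    using many unfolding E cJ extremal_number_def by linarith
  then have "card P = (card P + card Q + 1) div 2 \<and> card Q = (card P + card Q) div 2"
    using half_product_bound(2)[OF le] cV by simp
  then show ?thesis
    unfolding extremal_structure_def cV using V dj assms(1,4) E by blast
qed

lemma block_extremal:
  assumes b: "block p s A B D" and p: "2 * (k + l) + 3 \<le> p" and g: "good s M" "1 \<le> M"
    and many: "extremal_number s (card V) \<le> card E"
  shows "extremal_structure s V E"
proof -
  obtain P Q where PQ: "P \<inter> Q = {}" "P \<union> Q = V - D"
      "\<forall>y\<in>P. \<forall>z\<in>P. {y, z} \<notin> E" "\<forall>y\<in>Q. \<forall>z\<in>Q. {y, z} \<notin> E"
    using bipartite_outside_block[OF b p g] by blast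
  have D: "D \<subseteq> V" "card D = s" using b by (auto simp: block_def)
  show ?thesis
  proof (cases "card Q \<le> card P")
    case True
    then show ?thesis using bipartite_extremal[OF PQ(1,2) D PQ(3,4)] many by blast
  next
    case False
    then have le: "card P \<le> card Q" by simp
    have "Q \<inter> P = {}" "Q \<union> P = V - D" using PQ by auto
    then show ?thesis using bipartite_extremal[OF _ _ D PQ(4,3) le many] by blast
  qed
qed

lemma remove_touched:
  assumes "X \<subseteq> V"
  shows "lollipop_free_graph (V - X) (E - touched X) k l s"
    "card (V - X) = card V - card X" "card (E - touched X) + card (touched X) = card E"
proof -
  have "e \<subseteq> V - X \<and> card e = 2" if "e \<in> E - touched X" for e
    using wfE[of e] that by (auto simp: touched_def)
  moreover have "\<not> (\<exists>v w. embeds k (k + l) (E - touched X) v w)"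
    using lollipop_free embeds_mono[OF _ Diff_subset] by metis
  ultimately show "lollipop_free_graph (V - X) (E - touched X) k l s"
    using finV k l s by unfold_locales auto
  show "card (V - X) = card V - card X"
    using assms finV finite_subset by (intro card_Diff_subset) auto
  have "touched X \<subseteq> E" by (auto simp: touched_def)
  then show "card (E - touched X) + card (touched X) = card E"
    using finE by (metis card_Diff_subset card_mono finite_subset le_add_diff_inverse2)
qed

text \<open>The last inequality, written without subtraction, says that the excess over
  \<open>extremal_number\<close> grows by at least one.\<close>

lemma not_good_reduce:
  assumes "\<not> good s M" "s + 2 * M \<le> card V"
  obtains m and V' :: "'a set" and E' where "1 \<le> m" "m \<le> M" "lollipop_free_graph V' E' k l s" "card V = card V' + 2 * m"
    "card E + extremal_number s (card V') < card E' + extremal_number s (card V)"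
proof -
  obtain m A B where mAB: "1 \<le> m" "m \<le> M" "A \<subseteq> V" "B \<subseteq> V" "card A = m" "card B = m"
      "joined A B" and t: "\<not> m * (card V + s - m) \<le> card (touched (A \<union> B))"
    using assms(1) unfolding good_def by blast
  have fin: "finite A" "finite B" using mAB finV finite_subset by auto
  have "card (A \<union> B) = 2 * m"
    using card_Un_disjoint[OF fin joined_disjoint[OF mAB(7)]] mAB by simp
  moreover have X: "A \<union> B \<subseteq> V" using mAB by blast
  ultimately have cV: "card (V - (A \<union> B)) = card V - 2 * m"
    using remove_touched(2)[OF X] by simp
  have le: "s + 2 * m \<le> card V" using mAB assms(2) by linarith
  show thesis
  proof (rule that[OF mAB(1,2) remove_touched(1)[OF X]])
    show "card V = card (V - (A \<union> B)) + 2 * m" using cV le by simp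
    show "card E + extremal_number s (card (V - (A \<union> B)))
        < card (E - touched (A \<union> B)) + extremal_number s (card V)"
      using remove_touched(3)[OF X] t extremal_number_diff[OF le] cV by simp
  qed
qed

end

text \<open>An extension shrinks the block, so a block of a much larger size \<open>M\<close> with
  one dominating vertex less must come first; hence the induction is for all \<open>r\<close>.
  Goodness has to reach far enough for every stage, hence \<open>max M M'\<close>.\<close>

lemma exists_block:
  fixes k l s d r :: nat
  assumes "d \<le> s"
  shows "\<exists>M N. \<forall>(V :: 'a set) E. lollipop_free_graph V E k l s \<longrightarrow> ugraph.good V E s M \<longrightarrow> N \<le> card V \<longrightarrow>
    card V * card V \<le> 8 * card E \<longrightarrow> (\<exists>A B D. ugraph.block V E r d A B D)"
  using assms
proof (induction d arbitrary: r)
  case 0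
  show ?case
  proof (rule exI[of _ 0], rule exI[of _ "Suc (16 * (32 * r) + 32 * (2 ^ (32 * r) * r))"], intro allI impI)
    fix V :: "'a set" and E
    assume "lollipop_free_graph V E k l s" "ugraph.good V E s 0"
      and n: "Suc (16 * (32 * r) + 32 * (2 ^ (32 * r) * r)) \<le> card V" and d: "card V * card V \<le> 8 * card E"
    then interpret lollipop_free_graph V E k l s by blast
    show "\<exists>A B D. block r 0 A B D" using dense_contains_block[OF d, of r] n by auto
  qed
next
  case (Suc d)
  define N2 where "N2 = 3 * r * (2 * (k + l) + 1) + 1"
  define R2 where "R2 = r + N2"
  define q' where "q' = 2 * (k + l) + 2 * (k + l) * R2"
  define N1 where "N1 = 3 * r * q' + N2"
  define R1 where "R1 = r + N1"
  define M2 where "M2 = R2 + r + q' + N2 + 2 * (k + l) + 2 + 2 * (2 * (k + l) + 1) * R2"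
  define M where "M = M2 + q' * R1 + R1 + r + 2 * (k + l) + 2 + 2 * (2 * (k + l) + 1) * R1 + N1 + 1"
  obtain M' N where IH: "\<And>(V :: 'a set) E. lollipop_free_graph V E k l s \<Longrightarrow> ugraph.good V E s M' \<Longrightarrow>
      N \<le> card V \<Longrightarrow> card V * card V \<le> 8 * card E \<Longrightarrow> \<exists>A B D. ugraph.block V E M d A B D"
    using Suc.IH[OF Suc_leD[OF Suc.prems], of M] by blast
  show ?case
  proof (rule exI[of _ "max M M'"], rule exI[of _ N], intro allI impI)
    fix V :: "'a set" and E
    assume lf: "lollipop_free_graph V E k l s" and g: "ugraph.good V E s (max M M')"
      and n: "N \<le> card V" and d: "card V * card V \<le> 8 * card E"
    interpret lollipop_free_graph V E k l s by (rule lf)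
    have "good s M" "good s M'" using good_mono[OF g] by auto
    then obtain A B D where "block M d A B D" using IH[OF lf _ n d] by blast
    then show "\<exists>A B D. block r (Suc d) A B D"
      using extend_block[OF _ _ \<open>good s M\<close> N2_def R2_def q'_def N1_def R1_def M2_def eq_refl[OF M_def[symmetric]]]
        Suc.prems by fastforce
  qed
qed

lemma good_graph_extremal:
  fixes k l s :: nat
  shows "\<exists>M N. 1 \<le> M \<and> (\<forall>(V :: 'a set) E. lollipop_free_graph V E k l s \<longrightarrow> ugraph.good V E s M \<longrightarrow>
    N \<le> card V \<longrightarrow> extremal_number s (card V) \<le> card E \<longrightarrow> extremal_structure s V E)"
proof -
  \<comment> \<open>\<open>2 * (k + l)\<close> vertices per side for the labels and three spare ones
    for the separate triangle.\<close>
  let ?r = "2 * (k + l) + 3"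
  obtain M N where MN: "\<And>(V :: 'a set) E. lollipop_free_graph V E k l s \<Longrightarrow> ugraph.good V E s M \<Longrightarrow>
      N \<le> card V \<Longrightarrow> card V * card V \<le> 8 * card E \<Longrightarrow> \<exists>A B D. ugraph.block V E ?r s A B D"
    using exists_block[of s s k l ?r] by blast
  \<comment> \<open>\<open>M + 1\<close> instead of \<open>M\<close> ensures that goodness applies
    to \<open>m = 1\<close>, that is, to single edges.\<close>
  have "extremal_structure s V E" if lf: "lollipop_free_graph V E k l s" and g: "ugraph.good V E s (M + 1)"
    and n: "N + 2 * s \<le> card V" and E: "extremal_number s (card V) \<le> card E" for V :: "'a set" and E
  proof -
    interpret lollipop_free_graph V E k l s by (rule lf)
    have "1 \<le> s" by (cases rule: parity_cases) auto
    then have "card V * card V \<le> 8 * card E"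
      using extremal_number_dense[of s "card V"] n E by linarith
    moreover have "good s M" using good_mono[OF g] by simp
    ultimately obtain A B D where "block ?r s A B D" using MN[OF lf] n by auto
    then show ?thesis using block_extremal[OF _ order_refl g _ E] by simp
  qed
  then show ?thesis by (intro exI[of _ "M + 1"] exI[of _ "N + 2 * s"]) auto
qed

text \<open>Call \<open>card E\<close> minus \<open>extremal_number s (card V)\<close> the excess. A
  deletion removes at most \<open>2 * M\<close> vertices and raises the excess by at least one, so
  \<open>2 * M\<close> times the excess plus \<open>card V\<close> does not decrease. Deletions lead
  either to a good graph, whose excess is not positive, or to a graph of bounded size, where this
  quantity is at most \<open>K\<close>.\<close>

lemma lollipop_free_bound:
  fixes k l s :: nat
  shows "\<exists>N. \<forall>(V :: 'a set) E. lollipop_free_graph V E k l s \<longrightarrow> N \<le> card V \<longrightarrow>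
    card E \<le> extremal_number s (card V) \<and>
    (extremal_number s (card V) \<le> card E \<longrightarrow> extremal_structure s V E)"
proof -
  obtain M N where M: "1 \<le> M" and MN: "\<And>(V :: 'a set) E. lollipop_free_graph V E k l s \<Longrightarrow>
      ugraph.good V E s M \<Longrightarrow> N \<le> card V \<Longrightarrow> extremal_number s (card V) \<le> card E \<Longrightarrow> extremal_structure s V E"
    using good_graph_extremal by blast
  define N' where "N' = N + s + 2 * M"
  \<comment> \<open>\<open>K\<close> bounds \<open>2 * M * card E + card V\<close> for graphs on at
    most \<open>N' + 2 * M\<close> vertices, the sizes from which a deletion can fall below
    \<open>N'\<close>.\<close>
  define K where "K = 2 * M * ((N' + 2 * M) * (N' + 2 * M)) + N' + 2 * M"
  have bound: "card E \<le> extremal_number s (card V) \<or>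
      2 * M * card E + card V \<le> 2 * M * extremal_number s (card V) + K"
    if "lollipop_free_graph V E k l s" "N' \<le> card V" for V :: "'a set" and E
    using that
  proof (induction "card V" arbitrary: V E rule: less_induct)
    case less
    interpret lollipop_free_graph V E k l s by (rule less.prems)
    show ?case
    proof (cases "good s M")
      case True
      have "card E \<le> extremal_number s (card V)"
      proof (rule ccontr)
        assume neg: "\<not> card E \<le> extremal_number s (card V)"
        then have "extremal_structure s V E"
          using MN[OF less.prems(1) True] less.prems(2) by (simp add: N'_def)
        then show False using extremal_structure_card[OF finV] neg by simp
      qed
      then show ?thesis by simp
    next
      case False
      have "s + 2 * M \<le> card V" using less.prems(2) by (simp add: N'_def)
      from not_good_reduce[OF False this] obtain m and V' :: "'a set" and E' where m: "1 \<le> m" "m \<le> M"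
        and lf: "lollipop_free_graph V' E' k l s" and cV: "card V = card V' + 2 * m"
        and cE: "card E + extremal_number s (card V') < card E' + extremal_number s (card V)" .
      show ?thesis
      proof (cases "N' \<le> card V'")
        case True
        from less.hyps[OF _ lf True] cV m
        have "card E' \<le> extremal_number s (card V') \<or>
          2 * M * card E' + card V' \<le> 2 * M * extremal_number s (card V') + K" by simp
        then show ?thesis
        proof
          assume "card E' \<le> extremal_number s (card V')"
          then show ?thesis using cE by linarith
        next
          assume *: "2 * M * card E' + card V' \<le> 2 * M * extremal_number s (card V') + K"
          have "2 * M * (card E + extremal_number s (card V') + 1) \<le> 2 * M * (card E' + extremal_number s (card V))"
            using cE by (intro mult_le_mono2) simp
          then have "2 * M * card E + 2 * M * extremal_number s (card V') + 2 * M
              \<le> 2 * M * card E' + 2 * M * extremal_number s (card V)"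
            by (simp add: algebra_simps)
          then show ?thesis using * cV m by linarith
        qed
      next
        case False
        then have n: "card V \<le> N' + 2 * M" using cV m by linarith
        have "card E \<le> (\<Sum>x\<in>V. card (nbrs x))" by (rule card_edges_le_degree_sum)
        also have "\<dots> \<le> (\<Sum>x\<in>V. card V)" using finV nbrs_subset by (intro sum_mono card_mono) auto
        also have "\<dots> \<le> (N' + 2 * M) * (N' + 2 * M)" using n by (simp add: mult_le_mono)
        finally have "2 * M * card E \<le> 2 * M * ((N' + 2 * M) * (N' + 2 * M))" by (rule mult_le_mono2)
        then show ?thesis unfolding K_def using n by linarith
      qed
    qed
  qed
  have upper: "card E \<le> extremal_number s (card V)"
    if "lollipop_free_graph V E k l s" "N' + K + 1 \<le> card V" for V :: "'a set" and E
  proof (rule ccontr)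
    assume neg: "\<not> card E \<le> extremal_number s (card V)"
    then have "2 * M * extremal_number s (card V) \<le> 2 * M * card E"
      by (intro mult_le_mono2) simp
    then show False using bound[OF that(1)] that(2) neg by linarith
  qed
  \<comment> \<open>A graph attaining the bound without being good would shrink to one with positive
    excess, against \<open>upper\<close>; the extra \<open>2 * M\<close> keeps the smaller graph
    above the threshold of \<open>upper\<close>.\<close>
  have "extremal_structure s V E"
    if lf: "lollipop_free_graph V E k l s" and n: "N' + K + 1 + 2 * M \<le> card V"
      and E: "extremal_number s (card V) \<le> card E" for V :: "'a set" and E
  proof -
    interpret lollipop_free_graph V E k l s by (rule lf)
    have "good s M"
    proof (rule ccontr)
      assume bad: "\<not> good s M"
      have "s + 2 * M \<le> card V" using n by (simp add: N'_def)
      from not_good_reduce[OF bad this] obtain m and V' :: "'a set" and E' where m: "1 \<le> m" "m \<le> M"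
        and lf': "lollipop_free_graph V' E' k l s" and cV: "card V = card V' + 2 * m"
        and cE: "card E + extremal_number s (card V') < card E' + extremal_number s (card V)" .
      have "card E' \<le> extremal_number s (card V')" using upper[OF lf'] cV m n by linarith
      then show False using cE E by linarith
    qed
    then show ?thesis using MN[OF lf _ _ E] n by (simp add: N'_def)
  qed
  then show ?thesis using upper by (intro exI[of _ "N' + K + 1 + 2 * M"]) auto
qed

theorem theorem3p3:
  fixes k l t :: nat
  assumes "k \<ge> 4" and "l \<ge> 2" and "even l"
    and "t = (k - 1) div 2 + (l - 1) div 2"
  shows "\<exists>n\<^sub>0. \<forall>n\<ge>n\<^sub>0.
           unique_extremal_graph n (edge_blow_up (lollipop k l) 3) (H_graph n 2 (t + 2))"
proof -
  define s where "s = t + 1"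
  \<comment> \<open>For even \<open>l\<close> the two floors in \<open>t\<close> add up to
    \<open>(k + l - 1) div 2 - 1\<close>.\<close>
  have s: "s = (k + l - 1) div 2" 
  proof -
    obtain j where j: "l = 2 * j + 2" using assms(2,3) by (metis add.commute evenE le_add_diff_inverse dvd_diff_nat dvd_refl)
    have "k + l - 1 = (k - 1) + (j + 1) * 2" "l - 1 = 1 + j * 2" using j assms(1) by simp_all
    then show ?thesis unfolding s_def assms(4) by simp
  qed
  have s1: "1 \<le> s" by (simp add: s_def)
  let ?F = "edge_blow_up (lollipop k l) 3"
  obtain N where N: "\<And>(V :: nat set) E. lollipop_free_graph V E k l s \<Longrightarrow> N \<le> card V \<Longrightarrow>
    card E \<le> extremal_number s (card V) \<and>
    (extremal_number s (card V) \<le> card E \<longrightarrow> extremal_structure s V E)"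
    using lollipop_free_bound by blast
  have structured_free: "free_graph_on n ?F G"
    if G: "simple_graph G" "card (verts G) = n" "extremal_structure s (verts G) (edges G)"
    for G :: "'b graph" and n
  proof -
    obtain D P Q where D: "card D = s" "edges G = join_bipartite D P Q" "verts G = D \<union> P \<union> Q"
      using G(3) unfolding extremal_structure_def by blast
    moreover have "finite D" using G(1) D(3) by (simp add: simple_graph_def)
    ultimately have "\<not> (\<exists>v w. embeds k (k + l) (edges G) v w)"
      using join_bipartite_lollipop_free[OF assms(1-3)] s by metis
    then show ?thesis using G contains_copy_blow_up_iff[OF assms(1,2) G(1)] by (simp add: free_graph_on_def)
  qed
  have free_lollipop: "lollipop_free_graph (verts G) (edges G) k l s" if "free_graph_on n ?F G"
    for G :: "nat graph" and n
  proof -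
    have G: "simple_graph G" "\<not> contains_copy G ?F" using that by (auto simp: free_graph_on_def)
    then have "\<not> (\<exists>v w. embeds k (k + l) (edges G) v w)"
      using contains_copy_blow_up_iff[OF assms(1,2) G(1)] by blast
    then show ?thesis
      using G(1) assms(1-3) s by unfold_locales (auto simp: simple_graph_def)
  qed
  show ?thesis
  proof (intro exI allI impI)
    fix n assume n: "max N s \<le> n"
    let ?H = "H_graph n 2 (t + 2)"
    have ts: "t + 2 = s + 1" by (simp add: s_def)
    have "s \<le> n" using n by simp
    note H = H_graph_structure[OF s1 this, folded ts]
    have finH: "finite (verts ?H)" using H(1) by (simp add: simple_graph_def)
    have cH: "card (edges ?H) = extremal_number s n"
      using extremal_structure_card[OF finH H(3)] H(2) by simp
    have ub: "card (edges G) \<le> extremal_number s n" if "free_graph_on n ?F G" for G :: "nat graph"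
      using N[OF free_lollipop[OF that]] that n by (simp add: free_graph_on_def)
    have ext: "extremal_graph n ?F ?H"
      unfolding extremal_graph_def cH using structured_free[OF H] ub by blast
    obtain f :: "nat + nat \<Rightarrow> nat" where f: "inj f" 
  proof
    show "inj (case_sum (\<lambda>i. 2 * i) (\<lambda>i. 2 * i + 1) :: nat + nat \<Rightarrow> nat)"
      by (rule injI) (auto split: sum.splits; presburger)
  qed
    \<comment> \<open>A copy of the extremal graph on natural numbers competes with
      \<open>G'\<close> and shows that \<open>G'\<close> has at least
      \<open>extremal_number s n\<close> edges.\<close>
    define G0 :: "nat graph" where "G0 = (f ` verts ?H, (\<lambda>e. f ` e) ` edges ?H)"
    have "graph_iso G' ?H" if G': "extremal_graph n ?F G'" for G' :: "nat graph"
    proof -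
      have "extremal_number s n \<le> card (edges G')"
      proof -
        have cV0: "card (verts G0) = n"
          using f H(2) by (simp add: G0_def card_image inj_on_subset)
        have ext0: "extremal_structure s (verts G0) (edges G0)"
          using extremal_structure_image[OF f H(3)] by (simp add: G0_def)
        have "simple_graph G0"
          using H(1) f unfolding simple_graph_def G0_def
          by (auto simp: card_image inj_on_subset)
        then have "free_graph_on n ?F G0" "finite (verts G0)"
          using structured_free[OF _ cV0 ext0] by (simp_all add: simple_graph_def)
        then have "card (edges G0) \<le> card (edges G')" "finite (verts G0)"
          using G' unfolding extremal_graph_def by blast+
        then show ?thesis using extremal_structure_card[OF _ ext0] cV0 by simp
      qed
      have free: "free_graph_on n ?F G'" using G' by (simp add: extremal_graph_def)
      then have c: "card (verts G') = n" "finite (verts G')"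
        by (auto simp: free_graph_on_def simple_graph_def)
      have "extremal_structure s (verts G') (edges G')"
        using N[OF free_lollipop[OF free]] c n \<open>extremal_number s n \<le> card (edges G')\<close> by simp
      then show ?thesis
        using extremal_structure_iso[OF c(2) finH _ _ H(3)] c H(2) by simp
    qed
    then show "unique_extremal_graph n ?F ?H"
      unfolding unique_extremal_graph_def using ext by blast
  qed
qed

end
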